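(* Assume that $\mathcal Y$ is discrete, that $L(y,y')=\mathbf 1_{y\neq y'}$ is the misclassification loss, and that the noise assumption $\mathbf{(H)}$ (stated in the context) holds with function $\omega$ and associated quantity $\tau^*_m$. Then for any realization $x_1,\dots,x_n$ of $X_1,\dots,X_n$, any integer $m\ge 1$, any $0<\theta<1$ and any $0\le\varepsilon\le 1$, $$\mathbb P\Big(\mathbb L\big((\hat g_1^n)_{\hat k}\big)-\mathbb L(g^* )-(1+\theta)\big(\mathbb L\big((\hat g_1^n)_{\tilde k}\big)-\mathbb L(g^* )\big)>\varepsilon\Big)\le \Big(N+2\exp\Big(\frac{\ln 2}{t_{mix}}\Big)\Big)\exp\Bigg(-\frac{1}{4t_{mix}(1+\theta)}\,\frac{\theta\gamma_{ps}m\varepsilon}{16\big(1+\frac1{\gamma_{ps}}\big)m\tau^*_m+80\theta}\Bigg).$$ Moreover, the following oracle inequality holds: $$\mathbb E\Big(\mathbb L\big((\hat g_1^n)_{\hat k}\big)-\mathbb L(g^* )\Big)\le(1+\theta)\Bigg(\mathbb L\big((\hat g_1^n)_{\tilde k}\big)-\mathbb L(g^* )+\frac{4t_{mix}\big(16(1+\frac1{\gamma_{ps}})m\tau^*_m+80\theta\big)}{\theta\gamma_{ps}m}\ln\Big(e\Big(2\exp\Big(\frac{\ln 2}{t_{mix}}\Big)+N\Big)\Big)\Bigg).$$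
   Context: Process. Let $\mathcal Y$ be a Polish space (here discrete) and $(Y_t)_{t\in\mathbb Z}$ a $\mathcal Y$-valued Markov chain of order $k_0$ that is time homogeneous, stationary and uniformly ergodic. Fix an integer $p\ge k_0$ and put $X_t=(Y_t,Y_{t-1},\dots,Y_{t-p})^T$, with values in $\mathcal X=\mathcal Y^{p+1}$. Then $(X_t)_{t\in\mathbb Z}$ is a time homogeneous, stationary, uniformly ergodic Markov chain of order $1$; $K$ denotes its transition kernel and $Q$ its stationary law. With $d_{TV}(P,P')=\sup_A|P(A)-P'(A)|$, uniform ergodicity means that there are $C>0$ and $0<\rho<1$ with $\sup_{x\in\mathcal X}d_{TV}(K^n(x,\cdot),Q)\le C\rho^n$ for all $n$. The mixing time is $t_{mix}=\min\{t\ge 1:\ \sup_{x\in\mathcal X}d_{TV}(K^t(x,\cdot),Q)\le 1/4\}$. Pseudo spectral gap. View Markov kernels with invariant law $Q$ as bounded operators on $L^2(Q)$; $K^*$ is the adjoint of $K$ on $L^2(Q)$ (the time reversal of $K$). For a self-adjoint Markov operator $M$ on $L^2(Q)$ let $S_2(M)=\{\lambda\in\mathbb C\setminus\{0\}: (\lambda I-M)^{-1}$ does not exist as a bounded linear operator on $L^2(Q)\}$; its spectral gap is $\gamma(M)=1-\sup\{\lambda\in S_2(M):\lambda\ne1\}$ (with $\sup\emptyset=0$) if the eigenvalue $1$ has multiplicity one, and $\gamma(M)=0$ otherwise. The pseudo spectral gap is $\gamma_{ps}=\max_{k\ge1}\gamma((K^* )^kK^k)/k$. Losses. A prediction function is a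 measurable $g:\mathcal Y^p\to\mathcal Y$; $\mathcal F$ is the set of all of them. For a loss $L:\mathcal Y^2\to[0,1]$ write $L(g(X_t)):=L(g(Y_{t-1},\dots,Y_{t-p}),Y_t)$. The expected loss is $\mathbb L(g)=\mathbb E_Q(L(g(X)))$ with $X\sim Q$, and $g^*\in\arg\min_{g\in\mathcal F}\mathbb L(g)$. The out-of-sample empirical loss on the validation set $(X_{n+1},\dots,X_{n+m})$ is $\hat L_m(g)=\frac1m\sum_{j=n+1}^{n+m}L(g(X_j))$. Estimators and selection. Let $\tilde L$ be a loss function (possibly different from $L$), $N$ a positive integer and $\mathcal G_1,\dots,\mathcal G_N\subset\mathcal F$. For a realization $x_1,\dots,x_n$ of the learning set $X_1,\dots,X_n$, $(\hat g_1^n)_k\in\arg\min_{g\in\mathcal G_k}\sum_{t=1}^n\tilde L(g(x_t))$, $k=1,\dots,N$. Put $\tilde k\in\arg\min_{1\le k\le N}\mathbb L((\hat g_1^n)_k)$ and $\hat k\in\arg\min_{1\le k\le N}\hat L_m((\hat g_1^n)_k)$ ($\hat k$ depends on the validation set and is random). $\mathbb P$ and $\mathbb E$ are taken conditionally on $X_1=x_1,\dots,X_n=x_n$; thus the functions $(\hat g_1^n)_k$ are fixed, and $(X_{n+j})_{j\ge1}$ is the chain with kernel $K$ started from $X_n=x_n$. Noise assumption $\mathbf{(H)}$. There is a function $\omega$ such that $x\mapsto\omega(x)/\sqrt x$ is non-increasing and, for every prediction function $g$, $$\sqrt{\mathrm{Var}(\mathbf 1_{g\ne g^*})}\le\omega(\mathbb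 L(g)-\mathbb L(g^* )),$$ where the variance is computed under the stationary law $Q$ and $\mathbf 1_{g\neq g^*}$ is the indicator of $g(Y_{t-1},\dots,Y_{t-p})\ne g^*(Y_{t-1},\dots,Y_{t-p})$. $\tau^*_m$ denotes the smallest positive solution $\varepsilon$ of $\omega(\varepsilon)=\sqrt m\,\varepsilon$. *)

theory Defs
  imports "HOL-Probability.Probability"
begin

section \<open>Chains of order \<open>k0\<close> on a discrete Polish space\<close>

text \<open>
  A discrete Polish space is a countable set with the discrete topology: it is rendered by a type
  of class \<open>countable\<close> carrying the \<open>\<sigma>\<close>-algebra of all subsets, so that every
  function on it is measurable and probability laws on it are \<open>pmf\<close>s.

  The block \<open>(y\<^sub>t, y\<^sub>t\<^sub>-\<^sub>1, \<dots>, y\<^sub>t\<^sub>-\<^sub>r\<^sub>+\<^sub>1)\<close> is a list with the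
  most recent value first.  In particular \<open>X\<^sub>t\<close> is \<open>window (Suc p) Y t\<close>; its head is the value
  to be predicted and its tail is the argument of the prediction function.
\<close>

definition window :: "nat \<Rightarrow> (int \<Rightarrow> 'y) \<Rightarrow> int \<Rightarrow> 'y list" where
  "window r y t = map (\<lambda>i. y (t - int i)) [0..<r]"

text \<open>
  \<open>P\<close> is the transition kernel of a chain of order \<open>k0\<close>; only its values on lists of length
  \<open>k0\<close> matter.  Conditioning on arbitrarily long finite pasts is equivalent to
  conditioning on the whole past.  That \<open>P\<close> does not depend on \<open>t\<close> is time homogeneity.
\<close>

definition markov_chain ::
    "'w measure \<Rightarrow> (int \<Rightarrow> 'w \<Rightarrow> 'y::countable) \<Rightarrow> nat \<Rightarrow> ('y list \<Rightarrow> 'y pmf) \<Rightarrow> bool" where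
  "markov_chain M Y k0 P \<longleftrightarrow>
     prob_space M \<and> (\<forall>t. Y t \<in> measurable M (count_space UNIV)) \<and>
     (\<forall>t r ys a. k0 \<le> r \<longrightarrow> \<P>(\<omega> in M. window r (\<lambda>s. Y s \<omega>) t = ys) > 0 \<longrightarrow>
        \<P>(\<omega> in M. Y (t + 1) \<omega> = a \<bar> window r (\<lambda>s. Y s \<omega>) t = ys) = pmf (P (take k0 ys)) a)"

definition stationary :: "'w measure \<Rightarrow> (int \<Rightarrow> 'w \<Rightarrow> 'y::countable) \<Rightarrow> bool" where
  "stationary M Y \<longleftrightarrow>
     (\<forall>r s t. distr M (count_space UNIV) (\<lambda>\<omega>. window r (\<lambda>u. Y u \<omega>) s)
            = distr M (count_space UNIV) (\<lambda>\<omega>. window r (\<lambda>u. Y u \<omega>) t))"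

definition states :: "nat \<Rightarrow> 'y list set" where
  "states p = {x. length x = Suc p}"

text \<open>The kernel of \<open>X\<close>: \<open>(y\<^sub>t, \<dots>, y\<^sub>t\<^sub>-\<^sub>p)\<close> moves to
  \<open>(a, y\<^sub>t, \<dots>, y\<^sub>t\<^sub>-\<^sub>p\<^sub>+\<^sub>1)\<close>, with \<open>a\<close> drawn given the last \<open>k0\<close> values.\<close>

definition lift_kernel :: "nat \<Rightarrow> nat \<Rightarrow> ('y list \<Rightarrow> 'y pmf) \<Rightarrow> 'y list \<Rightarrow> 'y list pmf" where
  "lift_kernel k0 p P x = map_pmf (\<lambda>a. a # take p x) (P (take k0 x))"

fun kernel_pow :: "('x \<Rightarrow> 'x pmf) \<Rightarrow> nat \<Rightarrow> 'x \<Rightarrow> 'x pmf" where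
  "kernel_pow K 0 x = return_pmf x"
| "kernel_pow K (Suc n) x = bind_pmf (K x) (kernel_pow K n)"

text \<open>Law of the first \<open>m\<close> values after the initial one of the chain with kernel \<open>K\<close> started from
  \<open>x\<close>.\<close>

fun path_law :: "('x \<Rightarrow> 'x pmf) \<Rightarrow> nat \<Rightarrow> 'x \<Rightarrow> 'x list pmf" where
  "path_law K 0 x = return_pmf []"
| "path_law K (Suc m) x = bind_pmf (K x) (\<lambda>x'. map_pmf ((#) x') (path_law K m x'))"

definition d_TV :: "'x pmf \<Rightarrow> 'x pmf \<Rightarrow> real" where
  "d_TV P P' = (SUP A. \<bar>measure_pmf.prob P A - measure_pmf.prob P' A\<bar>)"

definition uniformly_ergodic :: "'x set \<Rightarrow> ('x \<Rightarrow> 'x pmf) \<Rightarrow> 'x pmf \<Rightarrow> bool" where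
  "uniformly_ergodic S K Q \<longleftrightarrow>
     (\<exists>C>0. \<exists>\<rho>. 0 < \<rho> \<and> \<rho> < 1 \<and> (\<forall>n. (SUP x\<in>S. d_TV (kernel_pow K n x) Q) \<le> C * \<rho> ^ n))"

definition mixing_time :: "'x set \<Rightarrow> ('x \<Rightarrow> 'x pmf) \<Rightarrow> 'x pmf \<Rightarrow> nat" where
  "mixing_time S K Q = (LEAST t. 1 \<le> t \<and> (SUP x\<in>S. d_TV (kernel_pow K t x) Q) \<le> 1/4)"


section \<open>Operators on \<open>L\<^sup>2(Q)\<close> and the pseudo spectral gap\<close>

text \<open>
  Complex \<open>L\<^sup>2(Q)\<close> is represented by its square integrable functions; elements and operators are
  identified when they agree \<open>Q\<close>-almost everywhere.  An operator satisfying \<open>bounded_op\<close>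
  respects this identification, by linearity and boundedness.
\<close>

definition L2 :: "'x pmf \<Rightarrow> ('x \<Rightarrow> complex) set" where
  "L2 Q = {f. integrable (measure_pmf Q) (\<lambda>x. (cmod (f x))\<^sup>2)}"

definition L2_inner :: "'x pmf \<Rightarrow> ('x \<Rightarrow> complex) \<Rightarrow> ('x \<Rightarrow> complex) \<Rightarrow> complex" where
  "L2_inner Q f g = measure_pmf.expectation Q (\<lambda>x. f x * cnj (g x))"

definition L2_norm :: "'x pmf \<Rightarrow> ('x \<Rightarrow> complex) \<Rightarrow> real" where
  "L2_norm Q f = sqrt (measure_pmf.expectation Q (\<lambda>x. (cmod (f x))\<^sup>2))"

definition L2_eq :: "'x pmf \<Rightarrow> ('x \<Rightarrow> complex) \<Rightarrow> ('x \<Rightarrow> complex) \<Rightarrow> bool" where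
  "L2_eq Q f g \<longleftrightarrow> (AE x in measure_pmf Q. f x = g x)"

type_synonym 'x operator = "('x \<Rightarrow> complex) \<Rightarrow> ('x \<Rightarrow> complex)"

definition bounded_op :: "'x pmf \<Rightarrow> 'x operator \<Rightarrow> bool" where
  "bounded_op Q T \<longleftrightarrow>
     (\<forall>f\<in>L2 Q. T f \<in> L2 Q) \<and>
     (\<forall>f\<in>L2 Q. \<forall>g\<in>L2 Q. \<forall>a b.
        L2_eq Q (T (\<lambda>x. a * f x + b * g x)) (\<lambda>x. a * T f x + b * T g x)) \<and>
     (\<exists>B. \<forall>f\<in>L2 Q. L2_norm Q (T f) \<le> B * L2_norm Q f)"

definition kernel_op :: "('x \<Rightarrow> 'x pmf) \<Rightarrow> 'x operator" where
  "kernel_op K f = (\<lambda>x. measure_pmf.expectation (K x) f)"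

text \<open>The adjoint is unique up to the identification above, so the choice is immaterial.\<close>

definition adjoint_op :: "'x pmf \<Rightarrow> 'x operator \<Rightarrow> 'x operator" where
  "adjoint_op Q T = (SOME S. bounded_op Q S \<and>
     (\<forall>f\<in>L2 Q. \<forall>g\<in>L2 Q. L2_inner Q (T f) g = L2_inner Q f (S g)))"

definition S2 :: "'x pmf \<Rightarrow> 'x operator \<Rightarrow> complex set" where
  "S2 Q T = {l. l \<noteq> 0 \<and> \<not> (\<exists>R. bounded_op Q R \<and>
     (\<forall>f\<in>L2 Q. L2_eq Q (R (\<lambda>x. l * f x - T f x)) f \<and>
               L2_eq Q (\<lambda>x. l * R f x - T (R f) x) f))}"

text \<open>The eigenspace of \<open>T\<close> for the eigenvalue 1 is one-dimensional.\<close>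

definition eigenvalue_one_simple :: "'x pmf \<Rightarrow> 'x operator \<Rightarrow> bool" where
  "eigenvalue_one_simple Q T \<longleftrightarrow>
     (\<exists>f\<in>L2 Q. \<not> L2_eq Q f (\<lambda>_. 0) \<and> L2_eq Q (T f) f \<and>
        (\<forall>g\<in>L2 Q. L2_eq Q (T g) g \<longrightarrow> (\<exists>c. L2_eq Q g (\<lambda>x. c * f x))))"

text \<open>Meant for self-adjoint \<open>T\<close>, whose spectrum is real; \<open>Re\<close> only converts the type.  The case
  distinction is the convention \<open>sup \<emptyset> = 0\<close>.\<close>

definition spectral_gap :: "'x pmf \<Rightarrow> 'x operator \<Rightarrow> real" where
  "spectral_gap Q T =
     (if eigenvalue_one_simple Q T
      then 1 - (if S2 Q T - {1} = {} then 0 else Sup (Re ` (S2 Q T - {1})))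
      else 0)"

text \<open>The supremum is a maximum: \<open>(K\<^sup>*)\<^sup>k K\<^sup>k\<close> is positive, so the \<open>k\<close>-th term lies
  between 0 and \<open>1/k\<close>.\<close>

definition pseudo_spectral_gap :: "('x \<Rightarrow> 'x pmf) \<Rightarrow> 'x pmf \<Rightarrow> real" where
  "pseudo_spectral_gap K Q =
     (SUP k\<in>{1..}.
        spectral_gap Q ((adjoint_op Q (kernel_op K) ^^ k) \<circ> (kernel_op K ^^ k)) / real k)"


section \<open>Losses\<close>

definition prediction_functions :: "nat \<Rightarrow> ('y list \<Rightarrow> 'y) set" where
  "prediction_functions p = {ys. length ys = p} \<rightarrow>\<^sub>E UNIV"

definition misclassification :: "'y \<Rightarrow> 'y \<Rightarrow> real" where
  "misclassification y y' = of_bool (y \<noteq> y')"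

definition point_loss :: "('y \<Rightarrow> 'y \<Rightarrow> real) \<Rightarrow> ('y list \<Rightarrow> 'y) \<Rightarrow> 'y list \<Rightarrow> real" where
  "point_loss L g x = L (g (tl x)) (hd x)"

definition risk :: "('y \<Rightarrow> 'y \<Rightarrow> real) \<Rightarrow> 'y list pmf \<Rightarrow> ('y list \<Rightarrow> 'y) \<Rightarrow> real" where
  "risk L Q g = measure_pmf.expectation Q (point_loss L g)"

definition validation_loss ::
    "('y \<Rightarrow> 'y \<Rightarrow> real) \<Rightarrow> 'y list list \<Rightarrow> ('y list \<Rightarrow> 'y) \<Rightarrow> real" where
  "validation_loss L v g = (\<Sum>x\<leftarrow>v. point_loss L g x) / real (length v)"

text \<open>\<open>\<omega>(x)/\<surd>x\<close> is only meaningful for \<open>x > 0\<close>, hence the domain of monotonicity.\<close>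

definition noise_assumption ::
    "('y \<Rightarrow> 'y \<Rightarrow> real) \<Rightarrow> nat \<Rightarrow> 'y list pmf \<Rightarrow> ('y list \<Rightarrow> 'y) \<Rightarrow> (real \<Rightarrow> real) \<Rightarrow> bool" where
  "noise_assumption L p Q gstar w \<longleftrightarrow>
     antimono_on {0<..} (\<lambda>x. w x / sqrt x) \<and>
     (\<forall>g\<in>prediction_functions p.
        sqrt (measure_pmf.variance Q (\<lambda>x. of_bool (g (tl x) \<noteq> gstar (tl x))))
          \<le> w (risk L Q g - risk L Q gstar))"

definition smallest_positive_solution :: "(real \<Rightarrow> real) \<Rightarrow> nat \<Rightarrow> real \<Rightarrow> bool" where
  "smallest_positive_solution w m \<tau> \<longleftrightarrow>
     \<tau> > 0 \<and> w \<tau> = sqrt (real m) * \<tau> \<and>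
     (\<forall>\<epsilon>>0. w \<epsilon> = sqrt (real m) * \<epsilon> \<longrightarrow> \<tau> \<le> \<epsilon>)"


section \<open>Conditional law of the validation set\<close>

lemma window_Suc: "window (Suc r) f (t + 1) = f (t + 1) # window r f t"
proof -
  have "[0..<Suc r] = 0 # map Suc [0..<r]"
    by (simp add: map_Suc_upt upt_conv_Cons del: upt_Suc)
  then show ?thesis
    by (simp add: window_def algebra_simps del: upt_Suc)
qed

lemma take_window: "k \<le> r \<Longrightarrow> take k (window r f t) = window k f t"
  by (simp add: window_def take_map)

lemma window_eq_iff: "window r f t = window r g t \<longleftrightarrow> (\<forall>s. t - int r < s \<and> s \<le> t \<longrightarrow> f s = g s)"
proof
  assume *: "window r f t = window r g t"
  show "\<forall>s. t - int r < s \<and> s \<le> t \<longrightarrow> f s = g s"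
  proof (intro allI impI)
    fix s assume s: "t - int r < s \<and> s \<le> t"
    then have "nat (t - s) < r" by auto
    then have "window r f t ! nat (t - s) = f s" "window r g t ! nat (t - s) = g s"
      using s by (auto simp: window_def)
    with * show "f s = g s" by simp
  qed
qed (auto simp: window_def)

lemma pmf_path_law_Cons:
  "pmf (path_law K (Suc m) x) (x' # v) = pmf (K x) x' * pmf (path_law K m x') v"
proof -
  have *: "pmf (map_pmf ((#) z) (path_law K m z)) (x' # v) =
      indicator {x'} z * pmf (path_law K m x') v" for z
  proof (cases "z = x'")
    case True
    then show ?thesis by (simp add: pmf_map_inj')
  next
    case False
    then have "x' # v \<notin> set_pmf (map_pmf ((#) z) (path_law K m z))" by auto
    then show ?thesis using False by (simp add: set_pmf_iff del: set_map_pmf)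
  qed
  show ?thesis
    by (simp add: pmf_bind * measure_pmf_single)
qed

lemma markov_chain_step:
  assumes "markov_chain M Y k0 P" "k0 \<le> r"
  shows "\<P>(\<omega> in M. window (Suc r) (\<lambda>s. Y s \<omega>) (t + 1) = a # ys)
       = \<P>(\<omega> in M. window r (\<lambda>s. Y s \<omega>) t = ys) * pmf (P (take k0 ys)) a"
proof -
  interpret prob_space M using assms by (simp add: markov_chain_def)
  have [measurable]: "Y s \<in> measurable M (count_space UNIV)" for s
    using assms by (simp add: markov_chain_def)
  have [measurable]: "(\<lambda>\<omega>. window q (\<lambda>s. Y s \<omega>) u) \<in> measurable M (count_space UNIV)" for q u
  proof (induction q arbitrary: u)
    case (Suc q)
    note Suc.IH[of "u - 1", measurable]
    have "(\<lambda>\<omega>. Y u \<omega> # window q (\<lambda>s. Y s \<omega>) (u - 1)) \<in> measurable M (count_space UNIV)"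
      by measurable
    then show ?case by (simp only: window_Suc[of q _ "u - 1", simplified])
  qed (simp add: window_def)
  let ?A = "{\<omega>\<in>space M. window r (\<lambda>s. Y s \<omega>) t = ys}"
  let ?B = "{\<omega>\<in>space M. window (Suc r) (\<lambda>s. Y s \<omega>) (t + 1) = a # ys}"
  have "?A \<in> events" by measurable
  then have le: "prob ?B \<le> prob ?A" by (intro finite_measure_mono) (auto simp: window_Suc)
  show ?thesis
  proof (cases "prob ?A > 0")
    case True
    then have "\<P>(\<omega> in M. Y (t + 1) \<omega> = a \<bar> window r (\<lambda>s. Y s \<omega>) t = ys) = pmf (P (take k0 ys)) a"
      using assms by (auto simp: markov_chain_def)
    with True show ?thesis
      by (simp only: cond_prob_def window_Suc list.inject) (simp add: field_simps)
  next
    case False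
    then have "prob ?A = 0" using measure_nonneg[of M ?A] by linarith
    moreover from this have "prob ?B = 0" using le measure_nonneg[of M ?B] by linarith
    ultimately show ?thesis by simp
  qed
qed

text \<open>
  Elementary conditional probability given \<open>X\<^sub>1 = x\<^sub>1, \<dots>, X\<^sub>n = x\<^sub>n\<close>, where
  \<open>x\<^sub>t = window (Suc p) y t\<close>: whenever this event is not null, \<open>(X\<^sub>n\<^sub>+\<^sub>1, \<dots>, X\<^sub>n\<^sub>+\<^sub>m)\<close> has law
  \<open>path_law (lift_kernel k0 p P) m x\<^sub>n\<close>, which also makes sense for null realizations.
\<close>

lemma cond_prob_path_law:
  fixes M :: "'w measure" and Y :: "int \<Rightarrow> 'w \<Rightarrow> 'y::countable" and y :: "int \<Rightarrow> 'y"
    and p n m k0 :: nat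
  defines "X \<equiv> \<lambda>t \<omega>. window (Suc p) (\<lambda>s. Y s \<omega>) t"
  assumes mc: "markov_chain M Y k0 P" and p: "k0 \<le> p" and n: "1 \<le> n"
    and pos: "\<P>(\<omega> in M. \<forall>t\<in>{1..n}. X (int t) \<omega> = window (Suc p) y (int t)) > 0"
  shows "\<P>(\<omega> in M. map (\<lambda>j. X (int j) \<omega>) [n+1..<n+m+1] = v \<bar>
                    \<forall>t\<in>{1..n}. X (int t) \<omega> = window (Suc p) y (int t))
       = pmf (path_law (lift_kernel k0 p P) m (window (Suc p) y (int n))) v"
proof -
  let ?K = "lift_kernel k0 p P"
  let ?E = "\<lambda>n y \<omega>. \<forall>t\<in>{1..n}. X (int t) \<omega> = window (Suc p) y (int t)"
  have E_iff: "?E n y \<omega> \<longleftrightarrow> window (n + p) (\<lambda>s. Y s \<omega>) (int n) = window (n + p) y (int n)"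
    if "1 \<le> n" for n y \<omega>
  proof -
    have "?E n y \<omega> \<longleftrightarrow> (\<forall>t\<in>{1..n}. \<forall>s. int t - int (Suc p) < s \<and> s \<le> int t \<longrightarrow> Y s \<omega> = y s)"
      by (simp add: X_def window_eq_iff)
    also have "\<dots> \<longleftrightarrow> (\<forall>s. - int p < s \<and> s \<le> int n \<longrightarrow> Y s \<omega> = y s)"
    proof (safe, goal_cases)
      case (1 s)
      define t where "t = (if s \<ge> 1 then nat s else 1)"
      have "t \<in> {1..n}" "int t - int (Suc p) < s" "s \<le> int t"
        using 1 that by (auto simp: t_def)
      with 1 show ?case by blast
    qed auto
    finally show ?thesis by (simp add: window_eq_iff)
  qed
  have main: "\<P>(\<omega> in M. map (\<lambda>j. X (int j) \<omega>) [n+1..<n+m+1] = v \<and> ?E n y \<omega>)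
      = \<P>(\<omega> in M. ?E n y \<omega>) * pmf (path_law ?K m (window (Suc p) y (int n))) v"
    if "1 \<le> n" for n m v y
    using that
  proof (induction m arbitrary: n v y)
    case 0
    then show ?case by (cases v) auto
  next
    case (Suc m)
    have upt: "[n+1..<n+Suc m+1] = (n+1) # [(n+1)+1..<(n+1)+m+1]"
      by (simp add: upt_conv_Cons del: upt_Suc)
    have XS: "X (int (n + 1)) \<omega> = Y (int (n + 1)) \<omega> # take p (X (int n) \<omega>)" for \<omega>
      using window_Suc[of p "\<lambda>s. Y s \<omega>" "int n"]
      by (simp add: X_def take_window add.commute)
    have En: "X (int n) \<omega> = window (Suc p) y (int n)" if "?E n y \<omega>" for \<omega>
      using that Suc.prems by auto
    let ?x = "window (Suc p) y (int n)"
    show ?case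
    proof (cases "\<exists>a v'. v = (a # take p ?x) # v'")
      case False
      have "\<not> (map (\<lambda>j. X (int j) \<omega>) [n+1..<n+Suc m+1] = v \<and> ?E n y \<omega>)" for \<omega>
      proof
        assume *: "map (\<lambda>j. X (int j) \<omega>) [n+1..<n+Suc m+1] = v \<and> ?E n y \<omega>"
        then have "X (int n) \<omega> = ?x" using En by blast
        with * show False using False unfolding upt list.map XS by metis
      qed
      then have "{\<omega>\<in>space M. map (\<lambda>j. X (int j) \<omega>) [n+1..<n+Suc m+1] = v \<and> ?E n y \<omega>} = {}"
        by blast
      moreover have "v \<notin> set_pmf (path_law ?K (Suc m) ?x)"
        using False by (auto simp: lift_kernel_def)
      ultimately show ?thesis
        by (simp only: set_pmf_iff not_not measure_empty mult_zero_right)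
    next
      case True
      then obtain a v' where v: "v = (a # take p ?x) # v'" by blast
      define y' where "y' = y(int n + 1 := a)"
      have w': "window q y' (int t) = window q y (int t)" if "t \<le> n" for q t
        using that by (auto simp: window_eq_iff y'_def)
      have x': "window (Suc p) y' (int (n + 1)) = a # take p ?x"
        using w'[of n p] window_Suc[of p y' "int n"]
        by (simp add: take_window y'_def add.commute)
      have E': "?E (n + 1) y' \<omega> \<longleftrightarrow> X (int (n + 1)) \<omega> = a # take p ?x \<and> ?E n y \<omega>" for \<omega>
        using x' w' by (auto simp: atLeastAtMostSuc_conv)
      have "\<P>(\<omega> in M. map (\<lambda>j. X (int j) \<omega>) [n+1..<n+Suc m+1] = v \<and> ?E n y \<omega>)
          = \<P>(\<omega> in M. map (\<lambda>j. X (int j) \<omega>) [(n+1)+1..<(n+1)+m+1] = v' \<and> ?E (n + 1) y' \<omega>)"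
        unfolding upt E' v by (rule arg_cong[where f = "measure M"]) auto
      also have "\<dots> = \<P>(\<omega> in M. ?E (n + 1) y' \<omega>) * pmf (path_law ?K m (a # take p ?x)) v'"
        using Suc.IH[of "n + 1" v' y'] unfolding x' by (meson le_add2)
      also have "\<P>(\<omega> in M. ?E (n + 1) y' \<omega>) =
          \<P>(\<omega> in M. window (Suc (n + p)) (\<lambda>s. Y s \<omega>) (int n + 1) = a # window (n + p) y (int n))"
        using w'[of n "n + p"] window_Suc[of "n + p" y' "int n"]
        by (subst E_iff) (simp_all add: y'_def add.commute)
      also have "\<dots> = \<P>(\<omega> in M. ?E n y \<omega>) * pmf (P (take k0 ?x)) a"
        unfolding E_iff[OF Suc.prems] using p
        by (subst markov_chain_step[OF mc]) (simp_all add: take_window)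
      also have "pmf (P (take k0 ?x)) a = pmf (?K ?x) (a # take p ?x)"
        unfolding lift_kernel_def by (subst pmf_map_inj') (auto simp: inj_def)
      finally show ?thesis by (simp add: v pmf_path_law_Cons del: path_law.simps)
    qed
  qed
  show ?thesis
    using main[OF n, of m v y] pos by (simp add: cond_prob_def)
qed

end

theory Submission
  imports Defs
begin

text \<open>
  The pseudo spectral gap enters only through \<open>0 < \<gamma>\<^sub>p\<^sub>s \<le> 1\<close>: the right-hand sides decrease in
  \<open>\<gamma>\<^sub>p\<^sub>s\<close>, so it suffices to prove the bounds with \<open>\<gamma>\<^sub>p\<^sub>s = 1\<close>, and these leave room for a deviation
  inequality governed by the mixing time.  In total variation three mixing times shrink the distance
  to \<open>Q\<close> to \<open>1/16\<close>; by Cauchy--Schwarz the corresponding power \<open>H\<close> of the kernel contracts centred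
  functions in \<open>L\<^sup>2(Q)\<close> by \<open>1/2\<close>.  Hence \<open>(Hg, h)\<close> is dominated by the form of the kernel
  \<open>(I + Q)/2\<close>, for which exponentially tilted norms are explicit; splitting the path into residue classes
  modulo three mixing times and using convexity of \<open>exp\<close> gives a Bernstein inequality for the
  stationary chain.  An arbitrary starting point costs a burn-in of length proportional to \<open>m\<epsilon>\<close>.

  The variance in that inequality is the one of a difference of two losses, whereas the noise
  assumption bounds the variance of \<open>\<one>{g \<noteq> g\<^sup>*}\<close>, which may be small because \<open>g \<noteq> g\<^sup>*\<close> is
  almost certain.  Applying the assumption to predictors that agree with \<open>g\<close> on a part of the tails
  only, and using stationarity if a single tail carries most of the mass, closes this gap.

  That \<open>\<gamma>\<^sub>p\<^sub>s\<close> lies in \<open>(0, 1]\<close> follows from Neumann series: \<open>(K\<^sup>*)\<^sup>k K\<^sup>k\<close> is within \<open>1/2\<close> of \<open>I/2\<close>, so its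
  spectrum has nonnegative real part, and for large \<open>k\<close> it is within \<open>1/4\<close> of the projection onto
  the constants.
\<close>

section \<open>Expectations and total variation\<close>

text \<open>The kernel need not be reversible, so exponential moments cannot be read off a spectral
  decomposition. They are compared instead through the bilinear form (Hg, h), where Cauchy--Schwarz
  for the form of (I + Q)/2 replaces symmetry. That form is 1 on constants and 1/2 on centred
  functions, which dictates the block length: a total variation distance c costs 4c in squared norm,
  and 4c = 1/4 asks for c = 1/16 = (1/2)^4, reached after three mixing times. Blocks of this length
  divide the exponent by 3 \<open>tm\<close>. At gap one the statement leaves the denominator
  \<open>tm\<close> (1 + \<theta>)(128 m \<tau> + 320 \<theta>), and the numerical choices (23/10,
  400/51, 99/100, 1/200) are tuned to fit into it. The claim is empty unless the exponent exceeds 1,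
  because N + 2 exp(ln 2 / t) is at least 3. An exponent above 1 forces \<epsilon> > 256 \<tau>,
  which puts the excess risk in question above \<tau>, where the noise function can be compared with
  its value at \<tau>.\<close>

abbreviation expect :: "'a pmf \<Rightarrow> ('a \<Rightarrow> 'b) \<Rightarrow> 'b::{banach, second_countable_topology}" where
  "expect p \<equiv> measure_pmf.expectation p"

abbreviation pr :: "'a pmf \<Rightarrow> 'a set \<Rightarrow> real" where
  "pr p \<equiv> measure_pmf.prob p"

lemma expectation_bind_pmf_bounded:
  fixes f :: "'b \<Rightarrow> real"
  assumes "\<And>y. \<bar>f y\<bar> \<le> B"
  shows "expect (bind_pmf p q) f = expect p (\<lambda>x. expect (q x) f)"
  unfolding measure_pmf_bind
  by (rule integral_bind[where K = "count_space UNIV" and B = B and B' = 1])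
    (use assms in \<open>auto simp: measure_pmf.finite_measure_axioms measure_pmf_in_subprob_algebra\<close>)

text \<open>Fubini for an unbounded integrand: the truncations \<open>fn\<close> fall under the
  bounded case, and dominated convergence is applied twice, inside each \<open>q x\<close> with
  bound |f| and outside with bound \<open>?w\<close>, the conditional mean of |f|.\<close>

lemma
  fixes f :: "'b \<Rightarrow> real"
  assumes int: "integrable (measure_pmf (bind_pmf p q)) f"
  shows AE_integrable_bind_pmf: "AE x in measure_pmf p. integrable (measure_pmf (q x)) f"
    and integrable_expectation_bind_pmf:
      "integrable (measure_pmf p) (\<lambda>x. expect (q x) f)"
    and expectation_bind_pmf: "expect (bind_pmf p q) f =
      expect p (\<lambda>x. expect (q x) f)"
proof -
  let ?g = "\<lambda>x. \<integral>\<^sup>+y. norm (f y) \<partial>measure_pmf (q x)"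
  have fin: "(\<integral>\<^sup>+x. ?g x \<partial>measure_pmf p) < \<infinity>"
    using int by (simp add: integrable_iff_bounded)
  have AEfin: "AE x in measure_pmf p. ?g x \<noteq> \<infinity>"
    using fin by (intro nn_integral_PInf_AE) auto
  show AE: "AE x in measure_pmf p. integrable (measure_pmf (q x)) f"
    using AEfin by (rule AE_mp) (auto simp: integrable_iff_bounded less_top)
  \<comment> \<open>\<open>enn2real\<close> sends infinity to 0; by \<open>AEfin\<close> that
    happens on a null set only.\<close>
  let ?w = "\<lambda>x. enn2real (?g x)"
  have w: "integrable (measure_pmf p) ?w"
  proof (rule integrableI_bounded)
    have "(\<integral>\<^sup>+x. norm (?w x) \<partial>measure_pmf p) \<le> (\<integral>\<^sup>+x. ?g x \<partial>measure_pmf p)"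
      by (intro nn_integral_mono) (simp add: ennreal_enn2real_if)
    then show "(\<integral>\<^sup>+x. norm (?w x) \<partial>measure_pmf p) < \<infinity>" using fin by (rule le_less_trans)
  qed simp
  define fn where "fn n y = (if norm (f y) \<le> real n then f y else 0)" for n y
  have fn_le: "norm (fn n y) \<le> norm (f y)" for n y by (simp add: fn_def)
  have fn_bd: "norm (fn n y) \<le> real n" for n y by (simp add: fn_def)
  have fn_lim: "(\<lambda>n. fn n y) \<longlonglongrightarrow> f y" for y
  proof (rule tendsto_eventually)
    show "\<forall>\<^sub>F n in sequentially. fn n y = f y"
      using eventually_ge_at_top[of "nat \<lceil>norm (f y)\<rceil>"]
      by eventually_elim (auto simp: fn_def)
  qed
  have lim_int: "(\<lambda>n. expect r (fn n)) \<longlonglongrightarrow> expect r f"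
    if "integrable (measure_pmf r) f" for r
    using fn_le fn_lim that
    by (intro integral_dominated_convergence[where w = "\<lambda>y. norm (f y)"]) auto
  have bd: "norm (expect (q x) h) \<le> ?w x"
    if "integrable (measure_pmf (q x)) f" "?g x \<noteq> \<infinity>" "\<And>y. norm (h y) \<le> norm (f y)" for x and h :: "'b \<Rightarrow> real"
  proof -
    have h: "integrable (measure_pmf (q x)) h"
      using that(1) by (rule Bochner_Integration.integrable_bound) (use that(3) in auto)
    have "ennreal (norm (expect (q x) h)) \<le> (\<integral>\<^sup>+y. norm (h y) \<partial>measure_pmf (q x))"
      using h by (rule integral_norm_bound_ennreal)
    also have "\<dots> \<le> ?g x" using that(3) by (intro nn_integral_mono) auto
    also have "\<dots> = ennreal (?w x)" using that(2) by (simp add: ennreal_enn2real_if)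
    finally show ?thesis by simp
  qed
  show "integrable (measure_pmf p) (\<lambda>x. expect (q x) f)"
    using w
  proof (rule Bochner_Integration.integrable_bound)
    show "AE x in measure_pmf p. norm (expect (q x) f) \<le> norm (?w x)"
      using AE AEfin by eventually_elim (use bd[of _ f] in simp)
  qed simp
  have "(\<lambda>n. expect p (\<lambda>x. expect (q x) (fn n)))
      \<longlonglongrightarrow> expect p (\<lambda>x. expect (q x) f)"
  proof (rule integral_dominated_convergence[where w = ?w])
    show "AE x in measure_pmf p. (\<lambda>n. expect (q x) (fn n))
        \<longlonglongrightarrow> expect (q x) f"
      using AE by eventually_elim (rule lim_int)
    show "AE x in measure_pmf p. norm (expect (q x) (fn n)) \<le> ?w x" for n
      using AE AEfin by eventually_elim (use bd[of _ "fn n"] fn_le in simp)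
  qed (use w in auto)
  moreover have "expect p (\<lambda>x. expect (q x) (fn n))
      = expect (bind_pmf p q) (fn n)" for n
    using fn_bd by (intro expectation_bind_pmf_bounded[symmetric]) (simp add: real_norm_def)
  ultimately show "expect (bind_pmf p q) f =
      expect p (\<lambda>x. expect (q x) f)"
    using lim_int[OF int] by (simp add: LIMSEQ_unique)
qed


lemma integrable_pmf_bounded:
  fixes f :: "'a \<Rightarrow> 'c::{banach, second_countable_topology}"
  assumes "\<And>x. x \<in> set_pmf p \<Longrightarrow> norm (f x) \<le> B"
  shows "integrable (measure_pmf p) f"
  using assms by (intro measure_pmf.integrable_const_bound[where B = B]) (auto simp: AE_measure_pmf_iff)

lemma expectation_pmf_mono:
  fixes f g :: "'a \<Rightarrow> real"
  assumes "integrable (measure_pmf p) f" "integrable (measure_pmf p) g"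
    and "\<And>x. x \<in> set_pmf p \<Longrightarrow> f x \<le> g x"
  shows "expect p f \<le> expect p g"
  using assms by (intro integral_mono_AE) (auto simp: AE_measure_pmf_iff)

lemma expectation_pmf_cong:
  assumes "\<And>x. x \<in> set_pmf p \<Longrightarrow> f x = g x"
  shows "expect p f = expect p g"
  using assms by (intro integral_cong_AE) (auto simp: AE_measure_pmf_iff)

section \<open>Total variation distance of discrete laws\<close>

lemma bdd_above_d_TV:
  "bdd_above (range (\<lambda>A. \<bar>pr p A - pr q A\<bar>))"
proof (rule bdd_aboveI2[where M = 1])
  fix A
  show "\<bar>pr p A - pr q A\<bar> \<le> 1"
    using measure_pmf.prob_le_1[of p A] measure_pmf.prob_le_1[of q A]
      measure_nonneg[of p A] measure_nonneg[of q A] by linarith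
qed

lemma d_TV_upper: "\<bar>pr p A - pr q A\<bar> \<le> d_TV p q"
  unfolding d_TV_def by (rule cSUP_upper[OF _ bdd_above_d_TV]) simp

lemma d_TV_nonneg: "0 \<le> d_TV p q"
  using d_TV_upper[of p "{}" q] by simp

lemma d_TV_least:
  assumes "\<And>A. \<bar>pr p A - pr q A\<bar> \<le> c"
  shows "d_TV p q \<le> c"
  unfolding d_TV_def using assms by (intro cSUP_least) auto

lemma d_TV_le_1: "d_TV p q \<le> 1"
proof (rule d_TV_least)
  fix A
  show "\<bar>pr p A - pr q A\<bar> \<le> 1"
    using measure_pmf.prob_le_1[of p A] measure_pmf.prob_le_1[of q A]
      measure_nonneg[of p A] measure_nonneg[of q A] by linarith
qed

lemma integrable_count_space_pmf:
  fixes f :: "'a \<Rightarrow> 'c::{banach, second_countable_topology}"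
  shows "integrable (count_space UNIV) (\<lambda>x. pmf p x *\<^sub>R f x) \<longleftrightarrow> integrable (measure_pmf p) f"
  unfolding measure_pmf_eq_density by (subst integrable_density) auto

lemma integral_count_space_pmf:
  fixes f :: "'a \<Rightarrow> 'c::{banach, second_countable_topology}"
  shows "(\<integral>x. pmf p x *\<^sub>R f x \<partial>count_space UNIV) = expect p f"
  unfolding measure_pmf_eq_density by (subst integral_density) auto

lemma measure_count_space_pmf:
  shows "(\<integral>x. pmf p x * indicator A x \<partial>count_space UNIV) = pr p A"
    and "integrable (count_space UNIV) (\<lambda>x. pmf p x * indicator A x)"
proof -
  show "(\<integral>x. pmf p x * indicator A x \<partial>count_space UNIV) = pr p A"
    using integral_count_space_pmf[of p "indicator A :: _ \<Rightarrow> real"] by simp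
  show "integrable (count_space UNIV) (\<lambda>x. pmf p x * indicator A x)"
    using integrable_count_space_pmf[of p "indicator A :: _ \<Rightarrow> real"]
      integrable_pmf_bounded[of p "indicator A :: _ \<Rightarrow> real" 1] by (simp add: indicator_def)
qed

text \<open>After f is shifted to values in [0, b - a], the difference can only grow if f - a is
  replaced by (b - a) times the indicator of {p > q}. The oscillation b - a enters, not twice the
  supremum, and only values on the two supports count: a kernel is controlled on its state space
  only.\<close>

lemma expectation_diff_le_d_TV:
  fixes f :: "'a \<Rightarrow> real"
  assumes f: "\<And>x. x \<in> set_pmf p \<union> set_pmf q \<Longrightarrow> a \<le> f x \<and> f x \<le> b"
  shows "expect p f - expect q f \<le> (b - a) * d_TV p q"
proof -
  have int: "integrable (measure_pmf r) f" if "r = p \<or> r = q" for r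
    using that f by (intro integrable_pmf_bounded[where B = "max \<bar>a\<bar> \<bar>b\<bar>"]) fastforce
  define A where "A = {x. pmf q x < pmf p x}"
  have ab: "a \<le> b" using f set_pmf_not_empty[of p] by fastforce
  have "expect p f - expect q f =
      expect p (\<lambda>x. f x - a) - expect q (\<lambda>x. f x - a)"
    using int by simp
  also have "\<dots> = (\<integral>x. pmf p x * (f x - a) - pmf q x * (f x - a) \<partial>count_space UNIV)"
    using integral_count_space_pmf[of p "\<lambda>x. f x - a"] integral_count_space_pmf[of q "\<lambda>x. f x - a"]
      integrable_count_space_pmf[of p "\<lambda>x. f x - a"] integrable_count_space_pmf[of q "\<lambda>x. f x - a"] int
    by simp
  also have "\<dots> \<le> (\<integral>x. (b - a) * (pmf p x * indicator A x - pmf q x * indicator A x) \<partial>count_space UNIV)"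
  proof (rule integral_mono)
    show "integrable (count_space UNIV) (\<lambda>x. pmf p x * (f x - a) - pmf q x * (f x - a))"
      using integrable_count_space_pmf[of p "\<lambda>x. f x - a"] integrable_count_space_pmf[of q "\<lambda>x. f x - a"] int
      by simp
    show "integrable (count_space UNIV) (\<lambda>x. (b - a) * (pmf p x * indicator A x - pmf q x * indicator A x))"
      using measure_count_space_pmf(2)[of p A] measure_count_space_pmf(2)[of q A] by simp
    fix x
    show "pmf p x * (f x - a) - pmf q x * (f x - a) \<le> (b - a) * (pmf p x * indicator A x - pmf q x * indicator A x)"
    proof (cases "x \<in> set_pmf p \<union> set_pmf q")
      case True
      then have "a \<le> f x" "f x \<le> b" using f by auto
      then show ?thesis
        by (cases "x \<in> A")
          (auto simp: A_def left_diff_distrib[symmetric] mult.commute intro: mult_right_mono mult_nonneg_nonpos)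
    next
      case False
      then have "pmf p x = 0" "pmf q x = 0" by (auto simp: pmf_eq_0_set_pmf)
      then show ?thesis by simp
    qed
  qed
  also have "\<dots> = (b - a) * (pr p A - pr q A)"
    using measure_count_space_pmf[of p A] measure_count_space_pmf[of q A] by simp
  also have "\<dots> \<le> (b - a) * d_TV p q"
    using d_TV_upper[of p A q] ab by (intro mult_left_mono) auto
  finally show ?thesis .
qed

lemma integral_abs_pmf_diff_le_d_TV:
  shows "integrable (count_space UNIV) (\<lambda>x. \<bar>pmf p x - pmf q x\<bar>)"
    and "(\<integral>x. \<bar>pmf p x - pmf q x\<bar> \<partial>count_space UNIV) \<le> 2 * d_TV p q"
proof -
  define A where "A = {x. pmf q x < pmf p x}"
  show "integrable (count_space UNIV) (\<lambda>x. \<bar>pmf p x - pmf q x\<bar>)"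
    by (intro integrable_abs Bochner_Integration.integrable_diff integrable_pmf)
  have "(\<integral>x. \<bar>pmf p x - pmf q x\<bar> \<partial>count_space UNIV) =
     (\<integral>x. (pmf p x * indicator A x - pmf q x * indicator A x)
        + (pmf q x * indicator (- A) x - pmf p x * indicator (- A) x) \<partial>count_space UNIV)"
    by (rule Bochner_Integration.integral_cong) (auto simp: A_def indicator_def)
  also have "\<dots> = (pr p A - pr q A)
       + (pr q (- A) - pr p (- A))"
    by (simp add: measure_count_space_pmf)
  also have "\<dots> \<le> d_TV p q + d_TV p q"
    using d_TV_upper[of p A q] d_TV_upper[of p "- A" q] by linarith
  finally show "(\<integral>x. \<bar>pmf p x - pmf q x\<bar> \<partial>count_space UNIV) \<le> 2 * d_TV p q" by simp
qed

section \<open>From total variation to second moments\<close>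

lemma integral_Cauchy_Schwarz:
  fixes f g :: "'a \<Rightarrow> real"
  assumes [measurable]: "f \<in> borel_measurable M" "g \<in> borel_measurable M"
    and f: "integrable M (\<lambda>x. (f x)\<^sup>2)" and g: "integrable M (\<lambda>x. (g x)\<^sup>2)"
  shows "integrable M (\<lambda>x. f x * g x)"
    and "(\<integral>x. \<bar>f x * g x\<bar> \<partial>M)\<^sup>2 \<le> (\<integral>x. (f x)\<^sup>2 \<partial>M) * (\<integral>x. (g x)\<^sup>2 \<partial>M)"
proof -
  have ennreal_abs_power2: "ennreal \<bar>z\<bar> ^ 2 = ennreal (z\<^sup>2)" for z :: real
    by (simp add: ennreal_power)
  have *: "(\<integral>\<^sup>+x. ennreal \<bar>f x\<bar> * ennreal \<bar>g x\<bar> \<partial>M)\<^sup>2 \<le>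
      (\<integral>\<^sup>+x. (ennreal \<bar>f x\<bar>)\<^sup>2 \<partial>M) * (\<integral>\<^sup>+x. (ennreal \<bar>g x\<bar>)\<^sup>2 \<partial>M)"
    by (rule Cauchy_Schwarz_nn_integral) auto
  also have "\<dots> = ennreal (\<integral>x. (f x)\<^sup>2 \<partial>M) * ennreal (\<integral>x. (g x)\<^sup>2 \<partial>M)"
    unfolding ennreal_abs_power2 using f g by (simp add: nn_integral_eq_integral)
  also have "\<dots> = ennreal ((\<integral>x. (f x)\<^sup>2 \<partial>M) * (\<integral>x. (g x)\<^sup>2 \<partial>M))"
    by (simp add: ennreal_mult)
  finally have le: "(\<integral>\<^sup>+x. ennreal \<bar>f x * g x\<bar> \<partial>M)\<^sup>2 \<le> ennreal ((\<integral>x. (f x)\<^sup>2 \<partial>M) * (\<integral>x. (g x)\<^sup>2 \<partial>M))"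
    by (simp add: abs_mult ennreal_mult)
  then have "(\<integral>\<^sup>+x. ennreal \<bar>f x * g x\<bar> \<partial>M)\<^sup>2 < \<infinity>"
    by (rule le_less_trans) simp
  then have "(\<integral>\<^sup>+x. ennreal \<bar>f x * g x\<bar> \<partial>M) < \<infinity>"
    by (simp add: power_less_top_ennreal)
  then show int: "integrable M (\<lambda>x. f x * g x)"
    by (intro integrableI_bounded) auto
  have "(\<integral>\<^sup>+x. ennreal \<bar>f x * g x\<bar> \<partial>M) = ennreal (\<integral>x. \<bar>f x * g x\<bar> \<partial>M)"
    using int by (intro nn_integral_eq_integral) auto
  then have "ennreal ((\<integral>x. \<bar>f x * g x\<bar> \<partial>M)\<^sup>2) \<le> ennreal ((\<integral>x. (f x)\<^sup>2 \<partial>M) * (\<integral>x. (g x)\<^sup>2 \<partial>M))"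
    using le by (simp add: ennreal_power)
  then show "(\<integral>x. \<bar>f x * g x\<bar> \<partial>M)\<^sup>2 \<le> (\<integral>x. (f x)\<^sup>2 \<partial>M) * (\<integral>x. (g x)\<^sup>2 \<partial>M)"
    by (subst (asm) ennreal_le_iff) (auto intro!: mult_nonneg_nonneg integral_nonneg_AE)
qed

text \<open>Cauchy--Schwarz for the weight \<open>\<bar>p - q\<bar>\<close>; it turns a total variation bound into an
  \<open>L\<^sup>2\<close> bound.\<close>

lemma norm_expectation_diff_power2_le:
  fixes f :: "'a \<Rightarrow> 'c::{banach, second_countable_topology}"
  assumes p: "integrable (measure_pmf p) (\<lambda>x. (norm (f x))\<^sup>2)"
    and q: "integrable (measure_pmf q) (\<lambda>x. (norm (f x))\<^sup>2)"
  shows "(norm (expect p f - expect q f))\<^sup>2 \<le>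
     2 * d_TV p q * (expect p (\<lambda>x. (norm (f x))\<^sup>2) + expect q (\<lambda>x. (norm (f x))\<^sup>2))"
proof -
  have int: "integrable (measure_pmf r) f" if "integrable (measure_pmf r) (\<lambda>x. (norm (f x))\<^sup>2)" for r
  proof -
    have "integrable (measure_pmf r) (\<lambda>x. 1 * norm (f x))"
      using that by (intro integral_Cauchy_Schwarz(1)) auto
    then show ?thesis by (simp add: integrable_norm_iff)
  qed
  let ?d = "\<lambda>x. \<bar>pmf p x - pmf q x\<bar>" and ?C = "count_space UNIV"
  note P = integral_count_space_pmf[symmetric] integrable_count_space_pmf[symmetric]
  have S: "integrable ?C (\<lambda>x. pmf p x * (norm (f x))\<^sup>2)" "integrable ?C (\<lambda>x. pmf q x * (norm (f x))\<^sup>2)"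
    using p q by (simp_all add: P)
  have F: "integrable ?C (\<lambda>x. pmf p x *\<^sub>R f x)" "integrable ?C (\<lambda>x. pmf q x *\<^sub>R f x)"
    using int[OF p] int[OF q] by (simp_all add: P)
  have d_le: "?d x \<le> pmf p x + pmf q x" for x
    using pmf_nonneg[of p x] pmf_nonneg[of q x] by linarith
  have dsq: "integrable ?C (\<lambda>x. ?d x * (norm (f x))\<^sup>2)"
  proof (rule Bochner_Integration.integrable_bound[OF Bochner_Integration.integrable_add[OF S]])
    show "AE x in ?C. norm (?d x * (norm (f x))\<^sup>2) \<le> norm (pmf p x * (norm (f x))\<^sup>2 + pmf q x * (norm (f x))\<^sup>2)"
      by (intro AE_I2) (simp add: abs_mult distrib_right[symmetric] d_le mult_right_mono)
  qed simp
  have "norm (expect p f - expect q f)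
      = norm (\<integral>x. (pmf p x - pmf q x) *\<^sub>R f x \<partial>?C)"
    using F by (simp add: P(1) scaleR_left_diff_distrib)
  also have "\<dots> \<le> (\<integral>x. norm ((pmf p x - pmf q x) *\<^sub>R f x) \<partial>?C)"
    by (rule integral_norm_bound)
  also have "\<dots> = (\<integral>x. \<bar>sqrt (?d x) * (sqrt (?d x) * norm (f x))\<bar> \<partial>?C)"
    by (rule Bochner_Integration.integral_cong) (auto simp: abs_mult mult.assoc[symmetric])
  finally have "(norm (expect p f - expect q f))\<^sup>2 \<le>
      (\<integral>x. \<bar>sqrt (?d x) * (sqrt (?d x) * norm (f x))\<bar> \<partial>?C)\<^sup>2"
    by (rule power_mono) simp
  also have "\<dots> \<le> (\<integral>x. (sqrt (?d x))\<^sup>2 \<partial>?C) * (\<integral>x. (sqrt (?d x) * norm (f x))\<^sup>2 \<partial>?C)"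
    using dsq integral_abs_pmf_diff_le_d_TV(1)[of p q]
    by (intro integral_Cauchy_Schwarz(2)) (simp_all add: power_mult_distrib)
  also have "\<dots> = (\<integral>x. ?d x \<partial>?C) * (\<integral>x. ?d x * (norm (f x))\<^sup>2 \<partial>?C)"
    by (simp add: power_mult_distrib)
  also have "\<dots> \<le> (2 * d_TV p q) * (\<integral>x. pmf p x * (norm (f x))\<^sup>2 + pmf q x * (norm (f x))\<^sup>2 \<partial>?C)"
  proof (rule mult_mono)
    show "(\<integral>x. ?d x * (norm (f x))\<^sup>2 \<partial>?C) \<le> (\<integral>x. pmf p x * (norm (f x))\<^sup>2 + pmf q x * (norm (f x))\<^sup>2 \<partial>?C)"
      using dsq Bochner_Integration.integrable_add[OF S]
      by (intro integral_mono) (auto simp: distrib_right[symmetric] d_le intro!: mult_right_mono)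
  qed (auto intro!: integral_abs_pmf_diff_le_d_TV integral_nonneg_AE simp: d_TV_nonneg)
  also have "\<dots> = 2 * d_TV p q * (expect p (\<lambda>x. (norm (f x))\<^sup>2)
      + expect q (\<lambda>x. (norm (f x))\<^sup>2))"
    using S by (simp add: P(1))
  finally show ?thesis .
qed


section \<open>Mixing\<close>

lemma kernel_pow_add: "kernel_pow K (a + b) x = bind_pmf (kernel_pow K a x) (kernel_pow K b)"
  by (induction a arbitrary: x) (auto simp: bind_return_pmf bind_assoc_pmf intro!: bind_pmf_cong)

lemma prob_bind_pmf:
  "pr (bind_pmf p q) A = expect p (\<lambda>x. pr (q x) A)"
  using expectation_bind_pmf_bounded[of "indicator A" 1 p q] by (simp add: indicator_def)

section \<open>Powers of a kernel with an invariant law\<close>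

locale stationary_kernel =
  fixes S :: "'x set" and K :: "'x \<Rightarrow> 'x pmf" and Q :: "'x pmf"
  assumes set_Q: "set_pmf Q \<subseteq> S"
    and set_K: "\<And>x. x \<in> S \<Longrightarrow> set_pmf (K x) \<subseteq> S"
    and invariant: "bind_pmf Q K = Q"
begin

lemma set_kernel_pow: "x \<in> S \<Longrightarrow> set_pmf (kernel_pow K n x) \<subseteq> S"
  by (induction n arbitrary: x) (use set_K in auto)

lemma invariant_pow: "bind_pmf Q (kernel_pow K n) = Q"
proof (induction n)
  case (Suc n)
  have "bind_pmf Q (kernel_pow K (Suc n)) = bind_pmf (bind_pmf Q K) (kernel_pow K n)"
    unfolding bind_assoc_pmf by (rule bind_pmf_cong) auto
  also have "\<dots> = Q" using Suc by (simp only: invariant)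
  finally show ?case .
qed (simp add: bind_return_pmf')

text \<open>The bound for two laws, applied at each x and integrated against Q: by invariance both
  second moments on the right average to that of f, whence 2c + 2c.\<close>

lemma kernel_pow_mean_square:
  fixes f :: "'x \<Rightarrow> 'c::{banach, second_countable_topology}"
  assumes f: "integrable (measure_pmf Q) (\<lambda>x. (norm (f x))\<^sup>2)"
    and c: "\<And>x. x \<in> S \<Longrightarrow> d_TV (kernel_pow K n x) Q \<le> c"
  shows "integrable (measure_pmf Q)
      (\<lambda>x. (norm (expect (kernel_pow K n x) f - expect Q f))\<^sup>2)"
    and "expect Q
      (\<lambda>x. (norm (expect (kernel_pow K n x) f - expect Q f))\<^sup>2)
      \<le> 4 * c * expect Q (\<lambda>x. (norm (f x))\<^sup>2)"
proof -
  let ?s = "\<lambda>x. (norm (f x))\<^sup>2" and ?H = "kernel_pow K n"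
  let ?D = "\<lambda>x. (norm (expect (?H x) f - expect Q f))\<^sup>2"
  have f': "integrable (measure_pmf (bind_pmf Q ?H)) ?s" using f by (simp add: invariant_pow)
  have cont: "AE x in measure_pmf Q. ?D x \<le>
      2 * c * (expect (?H x) ?s + expect Q ?s)"
    using AE_integrable_bind_pmf[OF f'] AE_measure_pmf[of Q]
  proof eventually_elim
    case (elim x)
    have "?D x \<le> 2 * d_TV (?H x) Q * (expect (?H x) ?s + expect Q ?s)"
      using elim(1) f by (rule norm_expectation_diff_power2_le)
    also have "\<dots> \<le> 2 * c * (expect (?H x) ?s + expect Q ?s)"
      using c[of x] elim(2) set_Q by (intro mult_right_mono add_nonneg_nonneg) auto
    finally show ?case .
  qed
  have int: "integrable (measure_pmf Q)
      (\<lambda>x. 2 * c * (expect (?H x) ?s + expect Q ?s))"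
    using integrable_expectation_bind_pmf[OF f'] by simp
  show *: "integrable (measure_pmf Q) ?D"
    by (rule Bochner_Integration.integrable_bound[OF int]) (use cont in \<open>auto elim!: AE_mp\<close>)
  have "expect Q ?D \<le>
      expect Q (\<lambda>x. 2 * c * (expect (?H x) ?s + expect Q ?s))"
    by (rule integral_mono_AE[OF * int cont])
  also have "\<dots> = 4 * c * expect Q ?s"
    using integrable_expectation_bind_pmf[OF f'] expectation_bind_pmf[OF f'] by (simp add: invariant_pow)
  finally show "expect Q ?D \<le> 4 * c * expect Q ?s" .
qed

text \<open>K^(s+n)(x, .) is a mixture of the laws K^n(y, .) with y in S.\<close>

lemma d_TV_kernel_pow_mono:
  assumes c: "\<And>x. x \<in> S \<Longrightarrow> d_TV (kernel_pow K n x) Q \<le> c" and x: "x \<in> S"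
  shows "d_TV (kernel_pow K (s + n) x) Q \<le> c"
proof (rule d_TV_least)
  fix A
  have "\<bar>expect (kernel_pow K s x) (\<lambda>y. pr (kernel_pow K n y) A - pr Q A)\<bar>
    \<le> expect (kernel_pow K s x) (\<lambda>y. \<bar>pr (kernel_pow K n y) A - pr Q A\<bar>)"
    by (rule integral_abs_bound)
  also have "\<dots> \<le> expect (kernel_pow K s x) (\<lambda>y. c)"
  proof -
    have *: "\<bar>pr (kernel_pow K n y) A - pr Q A\<bar> \<le> c"
      if "y \<in> set_pmf (kernel_pow K s x)" for y
    proof -
      have "y \<in> S" using set_kernel_pow[OF x] that by blast
      from c[OF this] d_TV_upper[of "kernel_pow K n y" A Q] show ?thesis by linarith
    qed
    then have "integrable (measure_pmf (kernel_pow K s x)) (\<lambda>y. \<bar>pr (kernel_pow K n y) A - pr Q A\<bar>)"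
      by (intro integrable_pmf_bounded[where B = c]) auto
    with * show ?thesis by (intro expectation_pmf_mono) auto
  qed
  also have "expect (kernel_pow K s x) (\<lambda>y. pr (kernel_pow K n y) A - pr Q A)
    = pr (kernel_pow K (s + n) x) A - pr Q A"
    unfolding kernel_pow_add prob_bind_pmf
    by (subst Bochner_Integration.integral_diff) (auto intro!: integrable_pmf_bounded[where B = 1])
  finally show "\<bar>pr (kernel_pow K (s + n) x) A - pr Q A\<bar> \<le> c" by simp
qed

text \<open>Dobrushin's argument: y -> K^n(y, A) oscillates by at most 2c, so its means under two
  laws at distance d are at most 2c d apart. For c = 1/4 each further mixing time halves the
  distance.\<close>

lemma d_TV_kernel_pow_add:
  assumes c: "\<And>x. x \<in> S \<Longrightarrow> d_TV (kernel_pow K n x) Q \<le> c" and x: "x \<in> S"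
  shows "d_TV (kernel_pow K (s + n) x) Q \<le> 2 * c * d_TV (kernel_pow K s x) Q"
proof (rule d_TV_least)
  fix A
  let ?P = "kernel_pow K s x"
  have b: "pr Q A - c \<le> pr (kernel_pow K n y) A \<and>
      pr (kernel_pow K n y) A \<le> pr Q A + c"
    if "y \<in> set_pmf ?P \<union> set_pmf Q" for y
  proof -
    have "y \<in> S" using set_kernel_pow[OF x] set_Q that by blast
    from c[OF this] d_TV_upper[of "kernel_pow K n y" A Q] show ?thesis by linarith
  qed
  have "expect ?P (\<lambda>y. pr (kernel_pow K n y) A)
      - expect Q (\<lambda>y. pr (kernel_pow K n y) A)
      \<le> (pr Q A + c - (pr Q A - c)) * d_TV ?P Q"
    using b by (rule expectation_diff_le_d_TV)
  moreover have "expect ?P (\<lambda>y. - pr (kernel_pow K n y) A)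
      - expect Q (\<lambda>y. - pr (kernel_pow K n y) A)
      \<le> (- (pr Q A - c) - (- (pr Q A + c))) * d_TV ?P Q"
    using b by (intro expectation_diff_le_d_TV) (metis (mono_tags, lifting) neg_le_iff_le)
  ultimately show "\<bar>pr (kernel_pow K (s + n) x) A - pr Q A\<bar> \<le> 2 * c * d_TV ?P Q"
    using prob_bind_pmf[of Q "kernel_pow K n" A] 
    by (simp add: kernel_pow_add prob_bind_pmf invariant_pow abs_le_iff)
qed

end

section \<open>The mixing time as a geometric rate\<close>

locale mixing_kernel = stationary_kernel S K Q
  for S :: "'x set" and K :: "'x \<Rightarrow> 'x pmf" and Q :: "'x pmf" +
  assumes ergodic: "uniformly_ergodic S K Q"
begin

definition "tm = mixing_time S K Q"

lemma d_TV_le_Sup: "x \<in> S \<Longrightarrow> d_TV (kernel_pow K n x) Q \<le> (SUP x\<in>S. d_TV (kernel_pow K n x) Q)"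
  by (rule cSUP_upper) (auto intro!: bdd_aboveI2[where M = 1] d_TV_le_1)

text \<open>Uniform ergodicity supplies a witness, so that the \<open>LEAST\<close> in
  \<open>mixing_time\<close> is attained.\<close>

lemma tm_pos: "1 \<le> tm" and d_TV_tm: "x \<in> S \<Longrightarrow> d_TV (kernel_pow K tm x) Q \<le> 1/4"
proof -
  obtain C \<rho> where C: "C > 0" "0 < \<rho>" "\<rho> < 1"
    and b: "\<And>n. (SUP x\<in>S. d_TV (kernel_pow K n x) Q) \<le> C * \<rho> ^ n"
    using ergodic by (auto simp: uniformly_ergodic_def)
  have "(\<lambda>n. C * \<rho> ^ n) \<longlonglongrightarrow> C * 0"
    using C by (intro tendsto_intros LIMSEQ_power_zero) auto
  then have "\<forall>\<^sub>F n in sequentially. C * \<rho> ^ n < 1/4"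
    by (intro order_tendstoD(2)[where y = "C * 0"]) auto
  then have "\<forall>\<^sub>F n in sequentially. C * \<rho> ^ n < 1/4 \<and> 1 \<le> n"
    using eventually_ge_at_top[of 1] by eventually_elim auto
  then obtain n where "C * \<rho> ^ n < 1/4" "1 \<le> n"
    by (auto dest: eventually_happens)
  then have "1 \<le> n \<and> (SUP x\<in>S. d_TV (kernel_pow K n x) Q) \<le> 1/4"
    using b[of n] by linarith
  then have *: "1 \<le> tm \<and> (SUP x\<in>S. d_TV (kernel_pow K tm x) Q) \<le> 1/4"
    unfolding tm_def mixing_time_def by (rule LeastI)
  then show "1 \<le> tm" by simp
  show "d_TV (kernel_pow K tm x) Q \<le> 1/4" if "x \<in> S"
    using d_TV_le_Sup[OF that, of tm] * by linarith
qed

lemma d_TV_mult_tm: "x \<in> S \<Longrightarrow> d_TV (kernel_pow K (Suc k * tm) x) Q \<le> (1/2) ^ (k + 2)"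
proof (induction k arbitrary: x)
  case 0
  then show ?case using d_TV_tm by (simp add: power2_eq_square)
next
  case (Suc k)
  have "d_TV (kernel_pow K (Suc k * tm + tm) x) Q \<le> 2 * (1/4) * d_TV (kernel_pow K (Suc k * tm) x) Q"
    using d_TV_tm Suc.prems by (rule d_TV_kernel_pow_add)
  with Suc.IH[OF Suc.prems] show ?case by (simp add: algebra_simps)
qed

text \<open>The burn-in will be a floor r, of which only r + 1 is bounded below by the real number
  it rounds; hence r + 1 in the exponent. Rounding r down to a multiple of \<open>tm\<close> costs
  the factor 2 = exp (ln 2).\<close>

lemma d_TV_le_powr:
  assumes "x \<in> S"
  shows "d_TV (kernel_pow K r x) Q \<le> 2 * exp (- (ln 2 * real (r + 1) / real tm))"
proof -
  define k where "k = r div tm"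
  have "d_TV (kernel_pow K (k * tm) x) Q \<le> (1/2) ^ k" if "x \<in> S" for x
  proof (cases k)
    case 0
    then show ?thesis by (simp add: d_TV_le_1)
  next
    case (Suc j)
    have "(1/2::real) ^ (j + 2) \<le> (1/2) ^ Suc j" by (rule power_decreasing) auto
    with d_TV_mult_tm[OF that, of j] show ?thesis unfolding Suc by (rule order_trans)
  qed
  from d_TV_kernel_pow_mono[OF this assms, of "r mod tm"]
  have "d_TV (kernel_pow K r x) Q \<le> (1/2) ^ k"
    unfolding k_def by (simp add: mod_mult_div_eq)
  also have "(1/2::real) ^ k = exp (- (ln 2 * real k))"
    by (simp add: exp_minus exp_of_nat_mult mult.commute power_one_over field_simps)
  also have "\<dots> \<le> exp (ln 2 - ln 2 * real (r + 1) / real tm)"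
  proof -
    have "r + 1 \<le> (k + 1) * tm"
      using dividend_less_times_div[of tm r] tm_pos unfolding k_def by (simp add: algebra_simps)
    then have "real (r + 1) \<le> (real k + 1) * real tm"
      by (metis of_nat_1 of_nat_add of_nat_le_iff of_nat_mult)
    then have "real (r + 1) / real tm \<le> real k + 1" using tm_pos by (simp add: field_simps)
    then have "ln 2 * (real (r + 1) / real tm) \<le> ln 2 * (real k + 1)"
      by (rule mult_left_mono) simp
    then show ?thesis by (simp add: algebra_simps)
  qed
  also have "\<dots> = 2 * exp (- (ln 2 * real (r + 1) / real tm))" by (simp add: exp_diff exp_minus divide_inverse)
  finally show ?thesis .
qed

text \<open>Values in a Banach space, because the deviation inequality needs real functions and the
  spectral gap complex ones.\<close>

lemma kernel_pow_contraction:
  fixes f :: "'x \<Rightarrow> 'c::{banach, second_countable_topology}"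
  assumes f: "integrable (measure_pmf Q) (\<lambda>x. (norm (f x))\<^sup>2)"
  shows "integrable (measure_pmf Q)
      (\<lambda>x. (norm (expect (kernel_pow K (3 * tm) x) f - expect Q f))\<^sup>2)"
    and "expect Q
      (\<lambda>x. (norm (expect (kernel_pow K (3 * tm) x) f - expect Q f))\<^sup>2)
      \<le> 1/4 * expect Q (\<lambda>x. (norm (f x))\<^sup>2)"
proof -
  have "d_TV (kernel_pow K (3 * tm) x) Q \<le> 1/16" if "x \<in> S" for x
    using d_TV_mult_tm[OF that, of 2] by (simp add: power_eq_if)
  from kernel_pow_mean_square[OF f this]
  show "integrable (measure_pmf Q)
      (\<lambda>x. (norm (expect (kernel_pow K (3 * tm) x) f - expect Q f))\<^sup>2)"
    and "expect Q
      (\<lambda>x. (norm (expect (kernel_pow K (3 * tm) x) f - expect Q f))\<^sup>2)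
      \<le> 1/4 * expect Q (\<lambda>x. (norm (f x))\<^sup>2)" by simp_all
qed

end


section \<open>A Bernstein inequality for the stationary chain\<close>

lemma expectation_Cauchy_Schwarz:
  fixes f g :: "'a \<Rightarrow> real"
  assumes "integrable (measure_pmf p) (\<lambda>x. (f x)\<^sup>2)" "integrable (measure_pmf p) (\<lambda>x. (g x)\<^sup>2)"
  shows "(expect p (\<lambda>x. f x * g x))\<^sup>2 \<le>
    expect p (\<lambda>x. (f x)\<^sup>2) * expect p (\<lambda>x. (g x)\<^sup>2)"
proof -
  have "\<bar>expect p (\<lambda>x. f x * g x)\<bar> \<le> expect p (\<lambda>x. \<bar>f x * g x\<bar>)"
    by (rule integral_abs_bound)
  then have "(expect p (\<lambda>x. f x * g x))\<^sup>2 \<le> (expect p (\<lambda>x. \<bar>f x * g x\<bar>))\<^sup>2"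
    by (metis abs_ge_zero power2_abs power_mono)
  also have "\<dots> \<le> expect p (\<lambda>x. (f x)\<^sup>2) * expect p (\<lambda>x. (g x)\<^sup>2)"
    using assms by (intro integral_Cauchy_Schwarz(2)) auto
  finally show ?thesis .
qed

section \<open>Path laws and their sparse subsequences\<close>

lemma length_path_law: "v \<in> set_pmf (path_law K m x) \<Longrightarrow> length v = m"
  by (induction m arbitrary: x v) auto

lemma path_law_drop:
  "map_pmf (drop r) (path_law K (r + l) x) = bind_pmf (kernel_pow K r x) (path_law K l)"
proof (induction r arbitrary: x)
  case (Suc r)
  show ?case
    by (simp add: map_bind_pmf map_pmf_comp Suc bind_assoc_pmf)
qed (simp add: bind_return_pmf)

text \<open>The sum over the subsequence of step \<open>Suc T\<close> whose first index is \<open>c\<close>.\<close>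

fun sparse_sum :: "nat \<Rightarrow> ('x \<Rightarrow> real) \<Rightarrow> nat \<Rightarrow> 'x list \<Rightarrow> real" where
  "sparse_sum T z c [] = 0"
| "sparse_sum T z 0 (x # v) = z x + sparse_sum T z T v"
| "sparse_sum T z (Suc c) (x # v) = sparse_sum T z c v"

text \<open>Passing an entry turns the counter 0 into T and \<open>Suc c\<close> into c: the T + 1
  counters are permuted cyclically, and exactly one of them picks up the entry.\<close>

lemma sum_sparse_sum: "(\<Sum>c\<le>T. sparse_sum T z c v) = (\<Sum>x\<leftarrow>v. z x)"
proof (induction v)
  case (Cons x v)
  have "(\<Sum>c\<le>T. sparse_sum T z c (x # v)) = sparse_sum T z 0 (x # v) + (\<Sum>c<T. sparse_sum T z (Suc c) (x # v))"
    by (simp only: sum.atMost_shift)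
  also have "\<dots> = z x + (\<Sum>c\<le>T. sparse_sum T z c v)"
    by (simp add: lessThan_Suc_atMost[symmetric])
  finally show ?case using Cons by simp
qed simp

lemma sparse_sum_le:
  assumes "\<And>x. z x \<le> b" "0 \<le> b"
  shows "sparse_sum T z c v \<le> b * real (length v)"
proof (induction v arbitrary: c)
  case (Cons x v)
  have "b * real (length (x # v)) = b + b * real (length v)" by (simp add: algebra_simps)
  with assms(1)[of x] assms(2) Cons[of T] Cons[of "c - 1"] show ?case
    by (cases c) auto
qed simp

lemma abs_mult_le: "\<bar>a\<bar> \<le> A \<Longrightarrow> \<bar>b\<bar> \<le> B \<Longrightarrow> \<bar>a * b\<bar> \<le> A * B" for a b :: real
  unfolding abs_mult by (intro mult_mono) auto

lemma exp_mean_le: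
  assumes "finite I" "I \<noteq> {}"
  shows "exp ((\<Sum>i\<in>I. a i) / real (card I)) \<le> (\<Sum>i\<in>I. exp (a i)) / real (card I)"
proof -
  have "exp (\<Sum>i\<in>I. (1 / real (card I)) *\<^sub>R a i) \<le> (\<Sum>i\<in>I. (1 / real (card I)) * exp (a i))"
    using assms by (intro convex_on_sum[where C = UNIV]) (auto simp: exp_convex)
  then show ?thesis by (simp add: sum_divide_distrib)
qed

text \<open>The ratio is the one of \<open>weighted_contraction\<close> for the weight exp z. It
  equals 1/(2 exp (-z) - 1) \<le> 1/(1 - 2z) = 1 + 2z + 4z^2 + ...; the coefficient 9/2 in place of
  4 absorbs the remainder as long as z \<le> 1/18.\<close>

lemma quadratic_exp_ratio_bound:
  fixes z :: real
  assumes "z \<le> 1/18"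
  shows "exp z / (2 - exp z) \<le> 1 + 2 * z + 9/2 * z\<^sup>2" and "exp z < 3/2"
proof -
  have 1: "exp (- z) \<ge> 1 - z" using exp_ge_add_one_self[of "- z"] by simp
  have pos: "1 - 2 * z > 0" using assms by simp
  have e: "exp z / (2 - exp z) = 1 / (2 * exp (- z) - 1)"
    by (simp add: exp_minus field_simps)
  have "1 / (2 * exp (- z) - 1) \<le> 1 / (1 - 2 * z)"
    using 1 pos by (intro divide_left_mono mult_pos_pos) auto
  also have "\<dots> \<le> 1 + 2 * z + 9/2 * z\<^sup>2"
  proof -
    have "z\<^sup>2 * (1/2 - 9 * z) \<ge> 0" using assms by (intro mult_nonneg_nonneg) auto
    then have "1 \<le> (1 + 2 * z + 9/2 * z\<^sup>2) * (1 - 2 * z)"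
      by (simp add: power2_eq_square algebra_simps)
    then show ?thesis using pos by (simp add: pos_divide_le_eq)
  qed
  finally show "exp z / (2 - exp z) \<le> 1 + 2 * z + 9/2 * z\<^sup>2" using e by simp
  have "exp (- z) > 2/3" using 1 assms by linarith
  then show "exp z < 3/2" by (simp add: exp_minus field_simps)
qed

section \<open>Tilted norms and exponential moments\<close>

context mixing_kernel
begin

text \<open>\<open>N\<close> is the quadratic form of (I + Q)/2: squared mean plus half the
  variance. Centring splits (Hg, h) into the product of the means and a covariance which, by the
  contraction, is at most half the product of the standard deviations; adding the two is
  Cauchy--Schwarz in the plane.\<close>

lemma mean_form_bound:
  fixes g h :: "'x \<Rightarrow> real"
  assumes g: "\<And>x. \<bar>g x\<bar> \<le> B" and h: "\<And>x. \<bar>h x\<bar> \<le> B'"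
  defines "N \<equiv> \<lambda>f. (expect Q (\<lambda>x. (f x)\<^sup>2) + (expect Q f)\<^sup>2) / 2"
  shows "(expect Q (\<lambda>x. expect (kernel_pow K (3 * tm) x) g * h x))\<^sup>2
    \<le> N g * N h"
proof -
  let ?E = "expect Q" and ?H = "\<lambda>x. expect (kernel_pow K (3 * tm) x) g"
  have B: "\<bar>g x\<bar> \<le> B" "\<bar>h x\<bar> \<le> B'" "0 \<le> B" "0 \<le> B'" for x
    using g[of x] h[of x] by auto
  have Hb: "\<bar>?H x\<bar> \<le> B" for x
  proof -
    have "\<bar>?H x\<bar> \<le> expect (kernel_pow K (3 * tm) x) (\<lambda>y. \<bar>g y\<bar>)" by (rule integral_abs_bound)
    also have "\<dots> \<le> expect (kernel_pow K (3 * tm) x) (\<lambda>y. B)"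
      using g by (intro expectation_pmf_mono integrable_pmf_bounded[where B = B]) (use B in auto)
    finally show ?thesis by simp
  qed
  have [simp]: "integrable Q g" "integrable Q h" "integrable Q (\<lambda>x. (g x)\<^sup>2)" "integrable Q (\<lambda>x. (h x)\<^sup>2)" "integrable Q ?H"
    "integrable Q (\<lambda>x. ?H x * h x)"
  proof -
    show "integrable Q g" "integrable Q h" "integrable Q ?H"
      using g h Hb
      by - (rule integrable_pmf_bounded[where B = B], simp, rule integrable_pmf_bounded[where B = B'], simp,
        rule integrable_pmf_bounded[where B = B], simp)
    show "integrable Q (\<lambda>x. (g x)\<^sup>2)" "integrable Q (\<lambda>x. (h x)\<^sup>2)"
      using power_mono[OF B(1) abs_ge_zero, where n = 2] power_mono[OF B(2) abs_ge_zero, where n = 2]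
      by - (rule integrable_pmf_bounded[where B = "B\<^sup>2"], simp, rule integrable_pmf_bounded[where B = "B'\<^sup>2"], simp)
    show "integrable Q (\<lambda>x. ?H x * h x)"
      using B Hb by (intro integrable_pmf_bounded[where B = "B * B'"]) (auto simp: abs_mult intro!: mult_mono)
  qed
  define a b where "a = ?E g" and "b = ?E h"
  have EH: "?E ?H = a"
    unfolding a_def by (subst expectation_bind_pmf[symmetric]) (simp_all add: invariant_pow)
  define vg vh where "vg = ?E (\<lambda>x. (g x - a)\<^sup>2)" and "vh = ?E (\<lambda>x. (h x - b)\<^sup>2)"
  have Ng: "N g = a\<^sup>2 + vg / 2" and Nh: "N h = b\<^sup>2 + vh / 2"
    unfolding N_def vg_def vh_def a_def b_def
    by (simp_all add: power2_diff) (simp_all add: power2_eq_square field_simps)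
  have ig: "integrable Q (\<lambda>x. (g x - a)\<^sup>2)" and ih: "integrable Q (\<lambda>x. (h x - b)\<^sup>2)"
    by (simp_all add: power2_diff)
  have centre: "expect (kernel_pow K (3 * tm) x) (\<lambda>x. g x - a) - ?E (\<lambda>x. g x - a) = ?H x - a" for x
  proof -
    have "integrable (measure_pmf (kernel_pow K (3 * tm) x)) g" using g by (intro integrable_pmf_bounded[where B = B]) auto
    then show ?thesis by (simp add: a_def)
  qed
  have cH: "integrable Q (\<lambda>x. (?H x - a)\<^sup>2)" "?E (\<lambda>x. (?H x - a)\<^sup>2) \<le> 1/4 * vg"
    using kernel_pow_contraction[of "\<lambda>x. g x - a"] ig
    unfolding centre vg_def real_norm_def power2_abs by blast+
  have "?E (\<lambda>x. ?H x * h x) = ?E (\<lambda>x. (?H x - a) * (h x - b)) + a * b"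
  proof -
    have "?E (\<lambda>x. (?H x - a) * (h x - b)) = ?E (\<lambda>x. ?H x * h x - b * ?H x - a * h x + a * b)"
      by (rule Bochner_Integration.integral_cong) (auto simp: algebra_simps)
    also have "\<dots> = ?E (\<lambda>x. ?H x * h x) - a * b"
      by (simp add: EH b_def[symmetric])
    finally show ?thesis by simp
  qed
  moreover have "(?E (\<lambda>x. (?H x - a) * (h x - b)))\<^sup>2 \<le> (vg / 4) * vh"
  proof -
    have "(?E (\<lambda>x. (?H x - a) * (h x - b)))\<^sup>2 \<le> ?E (\<lambda>x. (?H x - a)\<^sup>2) * vh"
      unfolding vh_def using cH(1) ih by (rule expectation_Cauchy_Schwarz)
    also have "\<dots> \<le> (1/4 * vg) * vh"
      using cH(2) by (rule mult_right_mono) (simp add: vh_def)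
    finally show ?thesis by simp
  qed
  moreover have "(t + a * b)\<^sup>2 \<le> (a\<^sup>2 + vg / 2) * (b\<^sup>2 + vh / 2)" if "t\<^sup>2 \<le> vg / 4 * vh" for t
  proof -
    have nn: "0 \<le> vg" "0 \<le> vh" by (simp_all add: vg_def vh_def)
    have "2 * t * (a * b) \<le> (a\<^sup>2 * vh + b\<^sup>2 * vg) / 2"
    proof -
      have "(2 * t * (a * b))\<^sup>2 = 4 * t\<^sup>2 * (a * b)\<^sup>2" by (simp add: power_mult_distrib)
      also have "\<dots> \<le> 4 * (vg / 4 * vh) * (a * b)\<^sup>2" using that by (intro mult_right_mono) auto
      also have "\<dots> \<le> ((a\<^sup>2 * vh + b\<^sup>2 * vg) / 2)\<^sup>2"
        using zero_le_power2[of "a\<^sup>2 * vh - b\<^sup>2 * vg"] by (simp add: power2_eq_square algebra_simps)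
      finally show ?thesis by (rule power2_le_imp_le) (use nn in auto)
    qed
    then show ?thesis using that nn mult_nonneg_nonneg[OF nn] by (simp add: power2_eq_square algebra_simps)
  qed
  ultimately show ?thesis unfolding Ng Nh by simp
qed


text \<open>\<open>\<surd>w H \<surd>w\<close> is a contraction of \<open>L\<^sup>2(Q)\<close>, written without square roots.\<close>

lemma weighted_contraction:
  fixes w u :: "'x \<Rightarrow> real"
  assumes w: "\<And>x. 0 < w x" "\<And>x. w x < 3/2"
    and ratio: "expect Q (\<lambda>x. w x / (2 - w x)) \<le> 1"
    and u: "\<And>x. \<bar>u x\<bar> \<le> B"
  defines "Hwu \<equiv> \<lambda>x. expect (kernel_pow K (3 * tm) x) (\<lambda>y. w y * u y)"
  shows "expect Q (\<lambda>x. w x * (Hwu x)\<^sup>2) \<le> expect Q (\<lambda>x. w x * (u x)\<^sup>2)"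
proof -
  let ?E = "expect Q"
  define N where "N f = (?E (\<lambda>x. (f x)\<^sup>2) + (?E f)\<^sup>2) / 2" for f :: "'x \<Rightarrow> real"
  have N: "0 \<le> N (\<lambda>x. w x * f x)" "N (\<lambda>x. w x * f x) \<le> ?E (\<lambda>x. w x * (f x)\<^sup>2)"
    if f: "\<And>x. \<bar>f x\<bar> \<le> C" for f C
  proof -
    have C: "(f x)\<^sup>2 \<le> C\<^sup>2" for x using power_mono[OF f[of x] abs_ge_zero, of 2] by simp
    have i1: "integrable Q (\<lambda>x. w x / (2 - w x))"
    proof (rule integrable_pmf_bounded[where B = "3"])
      fix x
      have "w x / (2 - w x) \<le> 3" "w x / (2 - w x) \<ge> 0" using w[of x] by (auto simp: field_simps)
      then show "norm (w x / (2 - w x)) \<le> 3" by (simp only: real_norm_def abs_of_nonneg)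
    qed
    have i2: "integrable Q (\<lambda>x. w x * (2 - w x) * (f x)\<^sup>2)"
    proof (rule integrable_pmf_bounded[where B = "3 * C\<^sup>2"])
      fix x
      have "w x * (2 - w x) * (f x)\<^sup>2 \<le> (3/2 * 2) * C\<^sup>2"
        using w[of x] C[of x] by (intro mult_mono) auto
      moreover have "0 \<le> w x * (2 - w x) * (f x)\<^sup>2" using w[of x] by (intro mult_nonneg_nonneg) auto
      ultimately show "norm (w x * (2 - w x) * (f x)\<^sup>2) \<le> 3 * C\<^sup>2" by simp
    qed
    have i3: "integrable Q (\<lambda>x. w x * (f x)\<^sup>2)"
    proof (rule integrable_pmf_bounded[where B = "3/2 * C\<^sup>2"])
      fix x
      have "w x * (f x)\<^sup>2 \<le> 3/2 * C\<^sup>2" using w[of x] C[of x] by (intro mult_mono) auto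
      moreover have "0 \<le> w x * (f x)\<^sup>2" using w[of x] by (intro mult_nonneg_nonneg) auto
      ultimately show "norm (w x * (f x)\<^sup>2) \<le> 3/2 * C\<^sup>2" by simp
    qed
    \<comment> \<open>The claim amounts to (E wf)^2 \<le> E w(2 - w)f^2. Cauchy--Schwarz with w/(2 -
      w) and w(2 - w)f^2 gives it if the mean of the former is at most 1; this is the source of the
      hypothesis \<open>ratio\<close>.\<close>
    have "(?E (\<lambda>x. w x * f x))\<^sup>2 = (?E (\<lambda>x. sqrt (w x / (2 - w x)) * (sqrt (w x * (2 - w x)) * f x)))\<^sup>2"
    proof -
      have "sqrt (w x / (2 - w x)) * sqrt (w x * (2 - w x)) = w x" for x
        using w[of x] by (simp add: real_sqrt_mult[symmetric] power2_eq_square[symmetric])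
      then show ?thesis by (simp add: mult.assoc[symmetric])
    qed
    also have "\<dots> \<le> ?E (\<lambda>x. (sqrt (w x / (2 - w x)))\<^sup>2) * ?E (\<lambda>x. (sqrt (w x * (2 - w x)) * f x)\<^sup>2)"
    proof (rule expectation_Cauchy_Schwarz)
      have "(sqrt (w x / (2 - w x)))\<^sup>2 = w x / (2 - w x)"
        "(sqrt (w x * (2 - w x)) * f x)\<^sup>2 = w x * (2 - w x) * (f x)\<^sup>2" for x
        using w[of x] by (simp_all add: power_mult_distrib)
      then show "integrable Q (\<lambda>x. (sqrt (w x / (2 - w x)))\<^sup>2)"
        "integrable Q (\<lambda>x. (sqrt (w x * (2 - w x)) * f x)\<^sup>2)" using i1 i2 by simp_all
    qed
    also have "\<dots> = ?E (\<lambda>x. w x / (2 - w x)) * ?E (\<lambda>x. w x * (2 - w x) * (f x)\<^sup>2)"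
    proof -
      have "(sqrt (w x / (2 - w x)))\<^sup>2 = w x / (2 - w x)"
        "(sqrt (w x * (2 - w x)) * f x)\<^sup>2 = w x * (2 - w x) * (f x)\<^sup>2" for x
        using w[of x] by (simp_all add: power_mult_distrib)
      then show ?thesis by simp
    qed
    also have "\<dots> \<le> 1 * ?E (\<lambda>x. w x * (2 - w x) * (f x)\<^sup>2)"
    proof (intro mult_right_mono integral_nonneg_AE AE_I2 mult_nonneg_nonneg ratio)
      show "0 \<le> w x" "0 \<le> 2 - w x" for x using w(1)[of x] w(2)[of x] by linarith+
    qed auto
    finally have "(?E (\<lambda>x. w x * f x))\<^sup>2 + ?E (\<lambda>x. (w x * f x)\<^sup>2) \<le>
      ?E (\<lambda>x. w x * (2 - w x) * (f x)\<^sup>2) + ?E (\<lambda>x. (w x * f x)\<^sup>2)" by simp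
    also have "\<dots> = 2 * ?E (\<lambda>x. w x * (f x)\<^sup>2)"
    proof -
      have eq: "(\<lambda>x. (w x * f x)\<^sup>2) = (\<lambda>x. 2 * (w x * (f x)\<^sup>2) - w x * (2 - w x) * (f x)\<^sup>2)"
        by (auto simp: power2_eq_square algebra_simps)
      show ?thesis unfolding eq using i2 i3 by simp
    qed
    finally show "N (\<lambda>x. w x * f x) \<le> ?E (\<lambda>x. w x * (f x)\<^sup>2)" by (simp add: N_def)
    show "0 \<le> N (\<lambda>x. w x * f x)"
      unfolding N_def by (intro divide_nonneg_nonneg add_nonneg_nonneg integral_nonneg_AE) auto
  qed
  have B0: "0 \<le> B" using u[of undefined] by (meson abs_ge_zero order_trans)
  have wu: "\<bar>w x * u x\<bar> \<le> 3/2 * B" for x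
    using w[of x] u[of x] by (intro abs_mult_le) auto
  have Hb: "\<bar>Hwu x\<bar> \<le> 3/2 * B" for x
  proof -
    have "\<bar>Hwu x\<bar> \<le> expect (kernel_pow K (3 * tm) x) (\<lambda>y. \<bar>w y * u y\<bar>)"
      unfolding Hwu_def by (rule integral_abs_bound)
    also have "\<dots> \<le> expect (kernel_pow K (3 * tm) x) (\<lambda>y. 3/2 * B)"
      using wu by (intro expectation_pmf_mono integrable_pmf_bounded[where B = "3/2 * B"]) (use B0 in auto)
    finally show ?thesis by simp
  qed
  have wH: "\<bar>w x * Hwu x\<bar> \<le> 3/2 * (3/2 * B)" for x
    using w[of x] Hb[of x] by (intro abs_mult_le) auto
  let ?a = "?E (\<lambda>x. w x * (Hwu x)\<^sup>2)" and ?b = "?E (\<lambda>x. w x * (u x)\<^sup>2)"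
  \<comment> \<open>With h = w Hwu the form bound reads a^2 \<le> b a, and a can be
    cancelled.\<close>
  have "?a = ?E (\<lambda>x. Hwu x * (w x * Hwu x))"
    by (rule Bochner_Integration.integral_cong) (auto simp: power2_eq_square)
  then have "?a\<^sup>2 \<le> N (\<lambda>x. w x * u x) * N (\<lambda>x. w x * Hwu x)"
    using mean_form_bound[OF wu wH] by (simp add: N_def Hwu_def)
  also have "\<dots> \<le> ?b * ?a"
    using N(1)[of u B, OF u] N(2)[of u B, OF u] N(1)[of Hwu, OF Hb] N(2)[of Hwu, OF Hb]
    by (intro mult_mono) linarith+
  finally have "?a * ?a \<le> ?b * ?a" by (simp add: power2_eq_square)
  moreover have "0 \<le> ?a" "0 \<le> ?b" 
    using w by (auto intro!: integral_nonneg_AE mult_nonneg_nonneg intro: less_imp_le[OF w(1)])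
  ultimately show ?thesis by (cases "?a = 0") auto
qed

text \<open>Between two counted indices no weight occurs, so c + 1 steps of the chain collapse into
  one step of a power of K; afterwards the counter is reset to T and all later steps have length T +
  1. If m \<le> c no index is counted and the moment is 1.\<close>

lemma expectation_path_law_sparse:
  fixes z :: "'x \<Rightarrow> real"
  assumes z: "\<And>x. z x \<le> 1"
  defines "F \<equiv> \<lambda>T c m x. expect (path_law K m x) (\<lambda>v. exp (sparse_sum T z c v))"
  shows "F T c m x = (if m \<le> c then 1 else
     expect (kernel_pow K (Suc c) x) (\<lambda>y. exp (z y) * F T T (m - Suc c) y))"
    and "0 \<le> F T c m x" "F T c m x \<le> exp (real m)"
proof -
  have bound: "exp (sparse_sum T z c v) \<le> exp (real m)" if "v \<in> set_pmf (path_law K m x)" for T c v m x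
    using sparse_sum_le[of z 1 T c v] z length_path_law[OF that] by simp
  then have int: "integrable (path_law K m x) (\<lambda>v. exp (sparse_sum T z c v))" for T c m x
    by (intro integrable_pmf_bounded[where B = "exp (real m)"]) auto
  show F0: "0 \<le> F T c m x" for T c m x unfolding F_def by simp
  show F1: "F T c m x \<le> exp (real m)" for T c m x
  proof -
    have "F T c m x \<le> expect (path_law K m x) (\<lambda>_. exp (real m))"
      unfolding F_def using int bound by (intro expectation_pmf_mono) auto
    then show ?thesis by simp
  qed
  have step: "F T c (Suc m) x = expect (K x)
      (\<lambda>y. expect (path_law K m y) (\<lambda>v. exp (sparse_sum T z c (y # v))))" for T c m x
    unfolding F_def using int[of "Suc m" x T c] by (simp add: expectation_bind_pmf)
  have step0: "F T 0 (Suc m) x = expect (K x) (\<lambda>y. exp (z y) * F T T m y)" for T m x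
    unfolding step by (simp add: exp_add F_def)
  have stepS: "F T (Suc c) (Suc m) x = expect (K x) (F T c m)" for T c m x
    unfolding step by (simp add: F_def)
  show "F T c m x = (if m \<le> c then 1 else
     expect (kernel_pow K (Suc c) x) (\<lambda>y. exp (z y) * F T T (m - Suc c) y))"
  proof (induction c arbitrary: m x)
    case 0
    have kp0: "kernel_pow K 0 = return_pmf" by (simp add: fun_eq_iff)
    have "F T 0 0 x = 1" by (simp add: F_def)
    then show ?case
      by (cases m) (simp_all add: step0 kp0 bind_return_pmf')
  next
    case (Suc c)
    show ?case
    proof (cases m)
      case 0
      then show ?thesis by (simp add: F_def)
    next
      case m: (Suc m')
      let ?g = "\<lambda>y. exp (z y) * F T T (m' - Suc c) y"
      have "\<bar>?g y\<bar> \<le> exp 1 * exp (real (m' - Suc c))" for y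
        using z[of y] F0[of T T "m' - Suc c" y] F1[of T T "m' - Suc c" y]
        by (intro abs_mult_le) auto
      then have "expect (K x) (\<lambda>y. expect (kernel_pow K (Suc c) y) ?g)
        = expect (kernel_pow K (Suc (Suc c)) x) ?g"
        unfolding kernel_pow.simps(2)[of K "Suc c"] by (intro expectation_bind_pmf_bounded[symmetric])
      then show ?thesis
        unfolding m stepS Suc.IH by (simp del: kernel_pow.simps)
    qed
  qed
qed

text \<open>Along the recursion the norm of F with weight exp z does not increase, and for the
  constant 1, where it starts, its square is E exp z \<le> 1. The first block has length c + 1
  instead of 3 \<open>tm\<close>; the invariance of Q absorbs it.\<close>

lemma expectation_sparse_le_1:
  fixes z :: "'x \<Rightarrow> real"
  assumes z: "\<And>x. z x \<le> 1/18"
    and ratio: "expect Q (\<lambda>x. exp (z x) / (2 - exp (z x))) \<le> 1"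
    and mean: "expect Q (\<lambda>x. exp (z x)) \<le> 1"
    and T: "Suc T = 3 * tm"
  shows "expect Q (\<lambda>x. expect (path_law K m x)
    (\<lambda>v. exp (sparse_sum T z c v))) \<le> 1"
proof -
  let ?E = "expect Q"
  define F where "F c m x = expect (path_law K m x) (\<lambda>v. exp (sparse_sum T z c v))" for c m x
  have z1: "z x \<le> 1" for x using z[of x] by simp
  note F = expectation_path_law_sparse[where z = z and T = T, OF z1, folded F_def]
  have w: "0 < exp (z x)" "exp (z x) < 3/2" for x using quadratic_exp_ratio_bound(2)[OF z] by auto
  have Fb: "\<bar>F c m x\<bar> \<le> exp (real m)" for c m x using F(2,3)[where c = c and m = m and x = x] by simp
  have wF: "?E (\<lambda>x. exp (z x) * (F T m x)\<^sup>2) \<le> 1" for m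
  proof (induction m rule: less_induct)
    case (less m)
    show ?case
    proof (cases "m \<le> T")
      case True
      then show ?thesis using mean by (simp add: F(1)[where c = T and m = m])
    next
      case False
      then have "F T m = (\<lambda>x. expect (kernel_pow K (3 * tm) x) (\<lambda>y. exp (z y) * F T (m - Suc T) y))"
        by (intro ext) (simp add: F(1)[where c = T and m = m] T[symmetric] del: kernel_pow.simps)
      then have "?E (\<lambda>x. exp (z x) * (F T m x)\<^sup>2) \<le> ?E (\<lambda>x. exp (z x) * (F T (m - Suc T) x)\<^sup>2)"
        using weighted_contraction[OF w ratio Fb] by simp
      also have "\<dots> \<le> 1" using False by (intro less) simp
      finally show ?thesis .
    qed
  qed
  have "?E (F c m) \<le> 1"
  proof (cases "m \<le> c")
    case True
    then have "F c m = (\<lambda>x. 1)" by (intro ext) (simp add: F(1)[where c = c and m = m])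
    then show ?thesis by simp
  next
    case False
    let ?F = "F T (m - Suc c)"
    have b: "\<bar>exp (z y) * ?F y\<bar> \<le> 3/2 * exp (real (m - Suc c))" for y
      using w(2)[of y] Fb[of T "m - Suc c" y] by (intro abs_mult_le) auto
    have b2: "\<bar>exp (z y) * (?F y)\<^sup>2\<bar> \<le> 3/2 * (exp (real (m - Suc c)))\<^sup>2" for y
      using w(2)[of y] power_mono[OF Fb[of T "m - Suc c" y] abs_ge_zero, where n = 2]
      by (intro abs_mult_le) auto
    have sq: "(sqrt (exp (z y)))\<^sup>2 = exp (z y)" "(sqrt (exp (z y)) * ?F y)\<^sup>2 = exp (z y) * (?F y)\<^sup>2"
      "sqrt (exp (z y)) * (sqrt (exp (z y)) * ?F y) = exp (z y) * ?F y" for y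
      by (simp_all add: power_mult_distrib mult.assoc[symmetric])
    have "?E (F c m) = ?E (\<lambda>x. expect (kernel_pow K (Suc c) x) (\<lambda>y. exp (z y) * ?F y))"
      by (rule arg_cong[where f = ?E]) (use False in \<open>simp add: fun_eq_iff F(1)[where c = c and m = m] del: kernel_pow.simps\<close>)
    also have "\<dots> = ?E (\<lambda>y. exp (z y) * ?F y)"
      using expectation_bind_pmf_bounded[where p = Q and q = "kernel_pow K (Suc c)", OF b]
      by (simp only: invariant_pow)
    finally have "(?E (F c m))\<^sup>2 = (?E (\<lambda>y. sqrt (exp (z y)) * (sqrt (exp (z y)) * ?F y)))\<^sup>2"
      by (simp only: sq)
    also have "\<dots> \<le> ?E (\<lambda>y. (sqrt (exp (z y)))\<^sup>2) * ?E (\<lambda>y. (sqrt (exp (z y)) * ?F y)\<^sup>2)"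
    proof (rule expectation_Cauchy_Schwarz)
      show "integrable Q (\<lambda>y. (sqrt (exp (z y)))\<^sup>2)"
        unfolding sq using w(2) by (intro integrable_pmf_bounded[where B = "3/2"]) (auto intro: less_imp_le)
      show "integrable Q (\<lambda>y. (sqrt (exp (z y)) * ?F y)\<^sup>2)"
        unfolding sq by (rule integrable_pmf_bounded) (simp only: real_norm_def, rule b2)
    qed
    also have "\<dots> \<le> 1 * 1"
      unfolding sq using mean wF by (intro mult_mono) (auto intro!: integral_nonneg_AE)
    finally show ?thesis by (simp add: abs_square_le_1)
  qed
  then show ?thesis by (simp only: F_def[abs_def])
qed

text \<open>Exponential Markov inequality; averaging over residue classes divides the exponent by 3
  \<open>tm\<close>. The limit 1/36 keeps lam |\<mu> - f| within 1/18, the range of the quadratic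
  bound. The path has length l \<le> m while m stands on the right, since a burn-in shortens the
  path but the threshold refers to m.\<close>

lemma Bernstein:
  fixes f :: "'x \<Rightarrow> real"
  assumes f: "\<And>x. \<bar>f x\<bar> \<le> 1"
  defines "\<mu> \<equiv> expect Q f"
  assumes var: "expect Q (\<lambda>x. (f x - \<mu>)\<^sup>2) \<le> V" and V: "V \<le> 1"
    and lam: "0 \<le> lam" "lam \<le> 1/36" and "l \<le> m"
  shows "pr (bind_pmf Q (path_law K l)) {v. s \<le> (\<Sum>x\<leftarrow>v. \<mu> - f x)}
    \<le> exp ((- lam * s + 23/10 * lam\<^sup>2 * V * real m) / real (3 * tm))"
proof -
  let ?E = "expect Q"
  \<comment> \<open>\<open>L\<close> compensates the second order terms: both moment conditions
    follow from 9/4 (lam^2 V + L^2) \<le> L. As L^2 is at most 529/129600 lam^2 V, the factor 23/10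
    is large enough.\<close>
  define L where "L = 23/10 * lam\<^sup>2 * V"
  define z where "z x = lam * (\<mu> - f x) - L" for x
  have V0: "0 \<le> V" using var by (rule order_trans[rotated]) (auto intro: integral_nonneg_AE)
  have lam2: "lam\<^sup>2 * V \<le> 1/1296"
  proof -
    have "lam\<^sup>2 \<le> (1/36)\<^sup>2" using lam by (intro power_mono) auto
    then have "lam\<^sup>2 * V \<le> (1/36)\<^sup>2 * 1" using V V0 by (intro mult_mono) auto
    then show ?thesis by (simp add: power2_eq_square)
  qed
  have L0: "0 \<le> L" unfolding L_def using V0 by simp
  have intf: "integrable Q f" using f by (intro integrable_pmf_bounded[where B = 1]) auto
  have mu: "\<bar>\<mu>\<bar> \<le> 1"
  proof -
    have "\<bar>\<mu>\<bar> \<le> ?E (\<lambda>x. \<bar>f x\<bar>)" unfolding \<mu>_def by (rule integral_abs_bound)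
    also have "\<dots> \<le> ?E (\<lambda>x. 1)"
      using f intf by (intro expectation_pmf_mono) auto
    finally show ?thesis by simp
  qed
  have md: "\<bar>\<mu> - f x\<bar> \<le> 2" for x using mu f[of x] by linarith
  have zabs: "\<bar>lam * (\<mu> - f x)\<bar> \<le> 1/18" for x
  proof -
    have "lam * \<bar>\<mu> - f x\<bar> \<le> 1/36 * 2" using lam md[of x] by (intro mult_mono) auto
    then show ?thesis using lam by (simp add: abs_mult)
  qed
  have z18: "z x \<le> 1/18" for x using zabs[of x] L0 by (simp add: z_def abs_le_iff)
  have zb: "\<bar>z x\<bar> \<le> 1" for x
    using zabs[of x] L0 lam2 unfolding z_def L_def by linarith
  have intz: "integrable Q z" using zb by (intro integrable_pmf_bounded[where B = 1]) auto
  have intz2: "integrable Q (\<lambda>x. (z x)\<^sup>2)"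
    using zb by (intro integrable_pmf_bounded[where B = 1]) (auto simp: abs_square_le_1)
  have intmf: "integrable Q (\<lambda>x. (f x - \<mu>)\<^sup>2)"
  proof (intro integrable_pmf_bounded[where B = 4])
    fix x show "norm ((f x - \<mu>)\<^sup>2) \<le> 4"
      using power_mono[OF md[of x] abs_ge_zero, of 2] by (simp add: power2_commute)
  qed
  have Ez: "?E z = - L"
    unfolding z_def using intf by (simp add: \<mu>_def)
  have Ez2: "?E (\<lambda>x. (z x)\<^sup>2) \<le> lam\<^sup>2 * V + L\<^sup>2"
  proof -
    have "?E (\<lambda>x. (z x)\<^sup>2) = ?E (\<lambda>x. lam\<^sup>2 * (f x - \<mu>)\<^sup>2 + (2 * lam * L) * (f x - \<mu>) + L\<^sup>2)"
      by (rule Bochner_Integration.integral_cong) (auto simp: z_def power2_eq_square algebra_simps)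
    also have "\<dots> = lam\<^sup>2 * ?E (\<lambda>x. (f x - \<mu>)\<^sup>2) + L\<^sup>2"
      using intmf intf by (simp add: \<mu>_def)
    finally show ?thesis using var by (simp add: mult_left_mono)
  qed
  have L2: "L\<^sup>2 \<le> lam\<^sup>2 * V * (529/129600)"
  proof -
    have "L\<^sup>2 = (529/100) * (lam\<^sup>2 * V) * (lam\<^sup>2 * V)" by (simp add: L_def power2_eq_square)
    also have "\<dots> \<le> (529/100) * (lam\<^sup>2 * V) * (1/1296)" using lam2 V0 by (intro mult_left_mono) auto
    finally show ?thesis by simp
  qed
  have "?E (\<lambda>x. exp (z x) / (2 - exp (z x))) \<le> ?E (\<lambda>x. 1 + 2 * z x + 9/2 * (z x)\<^sup>2)"
  proof (rule expectation_pmf_mono)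
    show "integrable Q (\<lambda>x. exp (z x) / (2 - exp (z x)))"
    proof (intro integrable_pmf_bounded[where B = 3])
      fix x
      show "norm (exp (z x) / (2 - exp (z x))) \<le> 3"
        using quadratic_exp_ratio_bound(2)[OF z18[of x]] by (simp add: field_simps)
    qed
  qed (use intz intz2 quadratic_exp_ratio_bound(1)[OF z18] in auto)
  also have "\<dots> = 1 + 2 * ?E z + 9/2 * ?E (\<lambda>x. (z x)\<^sup>2)" using intz intz2 by simp
  also have "\<dots> \<le> 1"
  proof -
    have "9/2 * ?E (\<lambda>x. (z x)\<^sup>2) \<le> 9/2 * (lam\<^sup>2 * V + lam\<^sup>2 * V * (529/129600))"
      using Ez2 L2 by (intro mult_left_mono) linarith+
    also have "\<dots> \<le> 2 * L" using V0 by (simp add: L_def mult_nonneg_nonneg)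
    finally show ?thesis using Ez by simp
  qed
  finally have ratio: "?E (\<lambda>x. exp (z x) / (2 - exp (z x))) \<le> 1" .
  have "?E (\<lambda>x. exp (z x)) \<le> ?E (\<lambda>x. 1 + z x + (z x)\<^sup>2)"
  proof (rule expectation_pmf_mono)
    show "integrable Q (\<lambda>x. exp (z x))"
      using zb by (intro integrable_pmf_bounded[where B = "exp 1"]) (auto simp: abs_le_iff)
    show "exp (z x) \<le> 1 + z x + (z x)\<^sup>2" for x
    proof (cases "z x \<ge> 0")
      case True
      then show ?thesis using zb[of x] by (intro exp_bound) auto
    next
      case False
      \<comment> \<open>Multiplication by 1 - z > 0 reduces the claim to exp z (1 - z) \<le> 1 \<le>
        1 - z^3.\<close>
      have "(1 + z x + (z x)\<^sup>2) * (1 - z x) \<ge> 1"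
      proof -
        have "(1 + z x + (z x)\<^sup>2) * (1 - z x) = 1 - z x ^ 3" by (simp add: power2_eq_square power3_eq_cube algebra_simps)
        moreover have "z x ^ 3 \<le> 0" using False by (simp add: power_le_zero_eq)
        ultimately show ?thesis by simp
      qed
      moreover have "exp (z x) * (1 - z x) \<le> 1"
      proof -
        have "exp (z x) * (1 - z x) \<le> exp (z x) * exp (- z x)"
          using exp_ge_add_one_self[of "- z x"] by (intro mult_left_mono) auto
        then show ?thesis by (simp add: exp_add[symmetric])
      qed
      ultimately have "exp (z x) * (1 - z x) \<le> (1 + z x + (z x)\<^sup>2) * (1 - z x)" by linarith
      then show ?thesis using False by (simp add: mult_le_cancel_right)
    qed
  qed (use intz intz2 in auto)
  also have "\<dots> = 1 + ?E z + ?E (\<lambda>x. (z x)\<^sup>2)" using intz intz2 by simp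
  also have "\<dots> \<le> 1"
  proof -
    have "?E (\<lambda>x. (z x)\<^sup>2) \<le> lam\<^sup>2 * V + lam\<^sup>2 * V * (529/129600)"
      using Ez2 L2 by linarith
    also have "\<dots> \<le> L" using V0 by (simp add: L_def mult_nonneg_nonneg)
    finally show ?thesis using Ez by simp
  qed
  finally have mean: "?E (\<lambda>x. exp (z x)) \<le> 1" .
  define T where "T = 3 * tm - 1"
  have T: "Suc T = 3 * tm" using tm_pos by (simp add: T_def)
  let ?P = "bind_pmf Q (path_law K l)"
  have len: "length v = l" if "v \<in> set_pmf ?P" for v using that length_path_law by auto
  have sb: "sparse_sum T z c v \<le> real l" if "v \<in> set_pmf ?P" for c v
    using sparse_sum_le[of z 1 T c v] zb len[OF that] by (simp add: abs_le_iff)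
  have ints: "integrable ?P (\<lambda>v. exp (sparse_sum T z c v))" for c
    using sb by (intro integrable_pmf_bounded[where B = "exp (real l)"]) auto
  have sparse: "expect ?P (\<lambda>v. exp (sparse_sum T z c v)) \<le> 1" for c
    using expectation_sparse_le_1[OF z18 ratio mean T, of l c] expectation_bind_pmf[OF ints[of c]] by simp
  have intsum: "integrable ?P (\<lambda>v. (\<Sum>c\<le>T. exp (sparse_sum T z c v)) / real (Suc T))"
    using ints by (intro Bochner_Integration.integrable_divide Bochner_Integration.integrable_sum) auto
  let ?X = "\<lambda>v. exp ((\<Sum>x\<leftarrow>v. z x) / real (Suc T))"
  have X_le: "?X v \<le> (\<Sum>c\<le>T. exp (sparse_sum T z c v)) / real (Suc T)" for v
    using exp_mean_le[of "{..T}" "\<lambda>c. sparse_sum T z c v"] by (simp add: sum_sparse_sum)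
  have intX: "integrable ?P ?X"
    by (rule Bochner_Integration.integrable_bound[OF intsum]) 
      (simp, intro AE_I2, simp only: real_norm_def abs_of_nonneg[OF exp_ge_zero], rule order_trans[OF X_le abs_ge_self])
  have EX: "expect ?P ?X \<le> 1"
  proof -
    have "expect ?P ?X \<le> expect ?P (\<lambda>v. (\<Sum>c\<le>T. exp (sparse_sum T z c v)) / real (Suc T))"
      using intX intsum X_le by (intro expectation_pmf_mono) auto
    also have "\<dots> = (\<Sum>c\<le>T. expect ?P (\<lambda>v. exp (sparse_sum T z c v))) / real (Suc T)"
      using ints by simp
    also have "\<dots> \<le> (\<Sum>c\<le>T. 1) / real (Suc T)"
      using sparse by (intro divide_right_mono sum_mono) auto
    finally show ?thesis by simp
  qed
  define t where "t = exp ((lam * s - real l * L) / real (Suc T))"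
  have sum_z: "(\<Sum>x\<leftarrow>v. z x) = lam * (\<Sum>x\<leftarrow>v. \<mu> - f x) - real (length v) * L" for v
    by (induction v) (auto simp: z_def algebra_simps)
  have "pr ?P {v. s \<le> (\<Sum>x\<leftarrow>v. \<mu> - f x)} \<le> pr ?P {v. t \<le> ?X v}"
  proof (intro measure_pmf.finite_measure_mono_AE AE_pmfI impI)
    fix v assume "v \<in> set_pmf ?P" "v \<in> {v. s \<le> (\<Sum>x\<leftarrow>v. \<mu> - f x)}"
    then show "v \<in> {v. t \<le> ?X v}"
      using len[of v] lam by (auto simp: t_def sum_z intro!: divide_right_mono mult_left_mono)
  qed simp
  also have "\<dots> \<le> expect ?P ?X / t"
    using integral_Markov_inequality_measure[OF intX, of UNIV t] by (auto simp: t_def)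
  also have "\<dots> \<le> 1 / t" using EX by (intro divide_right_mono) (auto simp: t_def)
  also have "\<dots> = exp ((- lam * s + L * real l) / real (3 * tm))"
    unfolding t_def T by (simp add: exp_minus[symmetric] divide_inverse[of 1] minus_divide_left algebra_simps del: minus_divide_left[symmetric])
  also have "\<dots> \<le> exp ((- lam * s + L * real m) / real (3 * tm))"
    using L0 \<open>l \<le> m\<close> by (auto intro!: divide_right_mono mult_left_mono)
  finally show ?thesis by (simp add: L_def)
qed

end


section \<open>Bounded operators and Neumann series\<close>

lemma L2_eq_iff: "L2_eq Q f g \<longleftrightarrow> (\<forall>x\<in>set_pmf Q. f x = g x)"
  by (simp add: L2_eq_def AE_measure_pmf_iff)

lemma L2D: "f \<in> L2 Q \<Longrightarrow> integrable (measure_pmf Q) (\<lambda>x. (cmod (f x))\<^sup>2)"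
  by (simp add: L2_def)

lemma L2_norm_power2: "(L2_norm Q f)\<^sup>2 = expect Q (\<lambda>x. (cmod (f x))\<^sup>2)"
  unfolding L2_norm_def by (rule real_sqrt_pow2) (auto intro: integral_nonneg_AE)

lemma L2_norm_nonneg: "0 \<le> L2_norm Q f"
  by (auto simp: L2_norm_def intro: integral_nonneg_AE)

lemma L2_norm_le_iff: "0 \<le> c \<Longrightarrow> L2_norm Q f \<le> c \<longleftrightarrow> expect Q (\<lambda>x. (cmod (f x))\<^sup>2) \<le> c\<^sup>2"
  by (metis L2_norm_nonneg L2_norm_power2 abs_le_square_iff abs_of_nonneg)

lemma L2_cong: "(\<And>x. x \<in> set_pmf Q \<Longrightarrow> f x = g x) \<Longrightarrow> f \<in> L2 Q \<longleftrightarrow> g \<in> L2 Q"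
  unfolding L2_def mem_Collect_eq by (intro integrable_cong_AE) (auto simp: AE_measure_pmf_iff)

lemma L2_norm_cong: "(\<And>x. x \<in> set_pmf Q \<Longrightarrow> f x = g x) \<Longrightarrow> L2_norm Q f = L2_norm Q g"
  unfolding L2_norm_def by (simp cong: expectation_pmf_cong)

lemma L2_bounded: "(\<And>x. cmod (f x) \<le> B) \<Longrightarrow> f \<in> L2 Q"
  unfolding L2_def mem_Collect_eq
  by (intro integrable_pmf_bounded[where B = "B\<^sup>2"]) (simp add: power_mono)

lemma L2_const [simp]: "(\<lambda>_. c) \<in> L2 Q"
  by (rule L2_bounded) (rule order_refl)

lemma L2_norm_scale: "L2_norm Q (\<lambda>x. a * f x) = cmod a * L2_norm Q f"
  by (simp add: L2_norm_def norm_mult power_mult_distrib real_sqrt_mult)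

lemma L2_scale: "f \<in> L2 Q \<Longrightarrow> (\<lambda>x. a * f x) \<in> L2 Q"
  by (simp add: L2_def norm_mult power_mult_distrib)

lemma L2_add:
  assumes "f \<in> L2 Q" "g \<in> L2 Q"
  shows "(\<lambda>x. f x + g x) \<in> L2 Q"
  unfolding L2_def mem_Collect_eq
proof (rule Bochner_Integration.integrable_bound)
  show "integrable Q (\<lambda>x. 2 * (cmod (f x))\<^sup>2 + 2 * (cmod (g x))\<^sup>2)"
    using assms by (simp add: L2_def)
  have "(cmod (f x + g x))\<^sup>2 \<le> 2 * (cmod (f x))\<^sup>2 + 2 * (cmod (g x))\<^sup>2" for x
  proof -
    have "(cmod (f x + g x))\<^sup>2 \<le> (cmod (f x) + cmod (g x))\<^sup>2" by (intro power_mono norm_triangle_ineq) simp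
    also have "\<dots> \<le> 2 * (cmod (f x))\<^sup>2 + 2 * (cmod (g x))\<^sup>2"
      using zero_le_power2[of "cmod (f x) - cmod (g x)"] by (simp add: power2_eq_square algebra_simps)
    finally show ?thesis .
  qed
  then show "AE x in Q. norm ((cmod (f x + g x))\<^sup>2) \<le> norm (2 * (cmod (f x))\<^sup>2 + 2 * (cmod (g x))\<^sup>2)"
    by simp
qed simp

lemma L2_lincomb: "f \<in> L2 Q \<Longrightarrow> g \<in> L2 Q \<Longrightarrow> (\<lambda>x. a * f x + b * g x) \<in> L2 Q"
  by (intro L2_add L2_scale)

lemma L2_diff: "f \<in> L2 Q \<Longrightarrow> g \<in> L2 Q \<Longrightarrow> (\<lambda>x. f x - g x) \<in> L2 Q"
  using L2_lincomb[of f Q g 1 "-1"] by simp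

lemma L2_sum: "(\<And>i. i \<in> I \<Longrightarrow> F i \<in> L2 Q) \<Longrightarrow> (\<lambda>x. \<Sum>i\<in>I. F i x) \<in> L2 Q"
  by (induction I rule: infinite_finite_induct) (auto intro: L2_add)

lemma L2_product_integrable:
  assumes "f \<in> L2 Q" "g \<in> L2 Q"
  shows "integrable (measure_pmf Q) (\<lambda>x. cmod (f x) * cmod (g x))"
    and "integrable (measure_pmf Q) (\<lambda>x. f x * cnj (g x))"
proof -
  show 1: "integrable (measure_pmf Q) (\<lambda>x. cmod (f x) * cmod (g x))"
    using assms by (intro integral_Cauchy_Schwarz(1)) (auto simp: L2_def)
  show "integrable (measure_pmf Q) (\<lambda>x. f x * cnj (g x))"
    by (rule Bochner_Integration.integrable_bound[OF 1]) (auto simp: norm_mult)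
qed

lemma L2_integrable: "f \<in> L2 Q \<Longrightarrow> integrable (measure_pmf Q) f"
  using L2_product_integrable(2)[of f Q "\<lambda>_. 1"] by simp

lemma L2_inner_le: 
  assumes "f \<in> L2 Q" "g \<in> L2 Q"
  shows "cmod (L2_inner Q f g) \<le> L2_norm Q f * L2_norm Q g"
proof (rule power2_le_imp_le)
  have "cmod (L2_inner Q f g) \<le> expect Q (\<lambda>x. cmod (f x * cnj (g x)))"
    unfolding L2_inner_def by (rule integral_norm_bound)
  then have "(cmod (L2_inner Q f g))\<^sup>2 \<le> (expect Q (\<lambda>x. cmod (f x) * cmod (g x)))\<^sup>2"
    by (intro power_mono) (auto simp: norm_mult)
  also have "\<dots> \<le> (L2_norm Q f)\<^sup>2 * (L2_norm Q g)\<^sup>2"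
    unfolding L2_norm_power2 using assms by (intro expectation_Cauchy_Schwarz L2D)
  finally show "(cmod (L2_inner Q f g))\<^sup>2 \<le> (L2_norm Q f * L2_norm Q g)\<^sup>2" by (simp add: power_mult_distrib)
qed (simp add: L2_norm_nonneg)

lemma L2_inner_self: "L2_inner Q f f = of_real ((L2_norm Q f)\<^sup>2)"
  unfolding L2_inner_def L2_norm_power2 complex_norm_square[symmetric] by (rule integral_complex_of_real)

lemma L2_norm_lincomb_power2:
  assumes "f \<in> L2 Q" "g \<in> L2 Q"
  shows "(L2_norm Q (\<lambda>x. f x + of_real a * g x))\<^sup>2 =
     (L2_norm Q f)\<^sup>2 + 2 * a * Re (L2_inner Q f g) + a\<^sup>2 * (L2_norm Q g)\<^sup>2"
proof -
  have e: "(cmod (f x + of_real a * g x))\<^sup>2 = (cmod (f x))\<^sup>2 + 2 * a * Re (f x * cnj (g x)) + a\<^sup>2 * (cmod (g x))\<^sup>2" for x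
    unfolding cmod_power2 by (simp add: power2_eq_square algebra_simps)
  have "expect Q (\<lambda>x. Re (f x * cnj (g x))) = Re (L2_inner Q f g)"
    unfolding L2_inner_def using L2_product_integrable(2)[OF assms] by (rule integral_Re)
  then show ?thesis
    unfolding L2_norm_power2 e using assms[THEN L2D] L2_product_integrable(2)[OF assms, THEN integrable_Re]
    by simp
qed

lemma L2_norm_add:
  assumes "f \<in> L2 Q" "g \<in> L2 Q"
  shows "L2_norm Q (\<lambda>x. f x + g x) \<le> L2_norm Q f + L2_norm Q g"
proof (rule power2_le_imp_le)
  have "Re (L2_inner Q f g) \<le> L2_norm Q f * L2_norm Q g"
    using L2_inner_le[OF assms] complex_Re_le_cmod order_trans by blast
  then show "(L2_norm Q (\<lambda>x. f x + g x))\<^sup>2 \<le> (L2_norm Q f + L2_norm Q g)\<^sup>2"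
    using L2_norm_lincomb_power2[OF assms, of 1] by (simp add: power2_sum)
qed (simp add: L2_norm_nonneg)

lemma L2_norm_sum:
  "(\<And>i. i \<in> I \<Longrightarrow> F i \<in> L2 Q) \<Longrightarrow> L2_norm Q (\<lambda>x. \<Sum>i\<in>I. F i x) \<le> (\<Sum>i\<in>I. L2_norm Q (F i))"
proof (induction I rule: infinite_finite_induct)
  case (insert i I)
  have "(\<lambda>x. \<Sum>i\<in>I. F i x) \<in> L2 Q" using insert by (intro L2_sum) auto
  then show ?case
    using insert L2_norm_add[of "F i" Q "\<lambda>x. \<Sum>i\<in>I. F i x"] by fastforce
qed (simp_all add: L2_norm_def)

text \<open>Q is discrete, so evaluation at a point of the support is bounded on L2(Q). Convergence
  in norm therefore implies pointwise convergence on the support, without passage to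
  subsequences.\<close>

lemma norm_le_L2_norm:
  assumes "f \<in> L2 Q"
  shows "pmf Q x * (cmod (f x))\<^sup>2 \<le> (L2_norm Q f)\<^sup>2"
proof -
  have "pmf Q x * (cmod (f x))\<^sup>2 = expect Q (\<lambda>y. indicator {x} y * (cmod (f x))\<^sup>2)"
    by (simp add: measure_pmf_single)
  also have "\<dots> \<le> expect Q (\<lambda>y. (cmod (f y))\<^sup>2)"
  proof (rule expectation_pmf_mono)
    show "integrable Q (\<lambda>y. indicator {x} y * (cmod (f x))\<^sup>2)"
      by (intro integrable_pmf_bounded[where B = "(cmod (f x))\<^sup>2"]) (simp add: indicator_def)
  qed (use assms in \<open>auto simp: L2_def indicator_def\<close>)
  finally show ?thesis by (simp add: L2_norm_power2)
qed

lemma L2_norm_eq_0D: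
  assumes "f \<in> L2 Q" "L2_norm Q f = 0" "x \<in> set_pmf Q"
  shows "f x = 0"
  using norm_le_L2_norm[OF assms(1), of x] assms(2) pmf_positive[OF assms(3)]
  by (simp add: mult_le_0_iff)

lemma L2_tendsto_pointwise:
  assumes F: "\<And>n. F n \<in> L2 Q" and lim: "(\<lambda>n. L2_norm Q (F n)) \<longlonglongrightarrow> 0" and x: "x \<in> set_pmf Q"
  shows "(\<lambda>n. F n x) \<longlonglongrightarrow> 0"
proof -
  have p: "0 < pmf Q x" using x by (rule pmf_positive)
  have "(\<lambda>n. (L2_norm Q (F n))\<^sup>2 / pmf Q x) \<longlonglongrightarrow> 0\<^sup>2 / pmf Q x"
    by (intro tendsto_intros lim) (use p in simp)
  then have lim0: "(\<lambda>n. (L2_norm Q (F n))\<^sup>2 / pmf Q x) \<longlonglongrightarrow> 0" by simp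
  have "(cmod (F n x))\<^sup>2 \<le> (L2_norm Q (F n))\<^sup>2 / pmf Q x" for n
    using norm_le_L2_norm[OF F, of x n] p by (simp add: pos_le_divide_eq mult.commute)
  then have "(\<lambda>n. (cmod (F n x))\<^sup>2) \<longlonglongrightarrow> 0"
    by (intro tendsto_sandwich[OF _ _ tendsto_const lim0]) simp_all
  then have "(\<lambda>n. sqrt ((cmod (F n x))\<^sup>2)) \<longlonglongrightarrow> sqrt 0" by (rule tendsto_real_sqrt)
  then show ?thesis by (simp add: tendsto_norm_zero_iff)
qed

text \<open>Completeness of L2(Q) in the form required by Neumann series: the sum is formed
  pointwise on the support, and Fatou's lemma bounds its norm.\<close>

lemma L2_suminf:
  assumes F: "\<And>n. F n \<in> L2 Q" and S: "summable (\<lambda>n. L2_norm Q (F n))"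
  shows "x \<in> set_pmf Q \<Longrightarrow> summable (\<lambda>n. F n x)"
    and "(\<lambda>x. \<Sum>n. F n x) \<in> L2 Q"
    and "L2_norm Q (\<lambda>x. \<Sum>n. F n x) \<le> (\<Sum>n. L2_norm Q (F n))"
proof -
  show pw: "summable (\<lambda>n. F n x)" if x: "x \<in> set_pmf Q" for x
  proof (rule summable_comparison_test)
    have p: "0 < pmf Q x" using x by (rule pmf_positive)
    have "cmod (F n x) \<le> L2_norm Q (F n) / sqrt (pmf Q x)" for n
    proof (rule power2_le_imp_le)
      show "(cmod (F n x))\<^sup>2 \<le> (L2_norm Q (F n) / sqrt (pmf Q x))\<^sup>2"
        using norm_le_L2_norm[OF F, of x n] p by (simp add: power_divide pos_le_divide_eq mult.commute)
    qed (simp add: L2_norm_nonneg)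
    then show "\<exists>N. \<forall>n\<ge>N. norm (F n x) \<le> L2_norm Q (F n) / sqrt (pmf Q x)" by blast
    show "summable (\<lambda>n. L2_norm Q (F n) / sqrt (pmf Q x))" using S by (rule summable_divide)
  qed
  define C where "C = (\<Sum>n. L2_norm Q (F n))"
  have C0: "0 \<le> C" unfolding C_def using S L2_norm_nonneg by (intro suminf_nonneg) auto
  let ?s = "\<lambda>N x. \<Sum>n<N. F n x"
  have s: "(\<integral>\<^sup>+x. ennreal ((cmod (?s N x))\<^sup>2) \<partial>Q) \<le> ennreal (C\<^sup>2)" for N
  proof -
    have "L2_norm Q (?s N) \<le> (\<Sum>n<N. L2_norm Q (F n))" by (rule L2_norm_sum) (rule F)
    also have "\<dots> \<le> C" unfolding C_def using S L2_norm_nonneg by (intro sum_le_suminf) auto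
    finally have "expect Q (\<lambda>x. (cmod (?s N x))\<^sup>2) \<le> C\<^sup>2"
      using C0 by (simp add: L2_norm_le_iff)
    then show ?thesis using L2_sum[of "{..<N}" F Q] F
      by (subst nn_integral_eq_integral) (auto simp: L2_def)
  qed
  let ?g = "\<lambda>x. \<Sum>n. F n x"
  have "(\<integral>\<^sup>+x. ennreal ((cmod (?g x))\<^sup>2) \<partial>Q) = (\<integral>\<^sup>+x. liminf (\<lambda>N. ennreal ((cmod (?s N x))\<^sup>2)) \<partial>Q)"
  proof (rule nn_integral_cong_AE, rule AE_pmfI)
    fix x assume "x \<in> set_pmf Q"
    then have "(\<lambda>N. ?s N x) \<longlonglongrightarrow> ?g x" using pw summable_LIMSEQ by blast
    then have "(\<lambda>N. ennreal ((cmod (?s N x))\<^sup>2)) \<longlonglongrightarrow> ennreal ((cmod (?g x))\<^sup>2)"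
      by (intro tendsto_intros) auto
    then show "ennreal ((cmod (?g x))\<^sup>2) = liminf (\<lambda>N. ennreal ((cmod (?s N x))\<^sup>2))"
      by (rule lim_imp_Liminf[OF trivial_limit_sequentially, symmetric])
  qed
  also have "\<dots> \<le> liminf (\<lambda>N. \<integral>\<^sup>+x. ennreal ((cmod (?s N x))\<^sup>2) \<partial>Q)"
    by (rule nn_integral_liminf) simp
  also have "\<dots> \<le> liminf (\<lambda>N. ennreal (C\<^sup>2))" by (rule Liminf_mono) (use s in simp)
  also have "\<dots> = ennreal (C\<^sup>2)" by (rule Liminf_const) simp
  finally have le: "(\<integral>\<^sup>+x. ennreal ((cmod (?g x))\<^sup>2) \<partial>Q) \<le> ennreal (C\<^sup>2)" .
  then show "?g \<in> L2 Q"
    unfolding L2_def mem_Collect_eq by (intro integrableI_bounded) (auto elim: le_less_trans)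
  then have "(\<integral>\<^sup>+x. ennreal ((cmod (?g x))\<^sup>2) \<partial>Q) = ennreal (expect Q (\<lambda>x. (cmod (?g x))\<^sup>2))"
    by (intro nn_integral_eq_integral) (auto simp: L2_def)
  with le have "expect Q (\<lambda>x. (cmod (?g x))\<^sup>2) \<le> C\<^sup>2" by simp
  then show "L2_norm Q ?g \<le> (\<Sum>n. L2_norm Q (F n))" using C0 by (simp add: L2_norm_le_iff C_def)
qed

section \<open>Bounded operators, modulo equality on the support\<close>

lemma bounded_op_closed: "bounded_op Q T \<Longrightarrow> f \<in> L2 Q \<Longrightarrow> T f \<in> L2 Q"
  by (auto simp: bounded_op_def)

lemma bounded_op_lin:
  "bounded_op Q T \<Longrightarrow> f \<in> L2 Q \<Longrightarrow> g \<in> L2 Q \<Longrightarrow> x \<in> set_pmf Q \<Longrightarrow>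
     T (\<lambda>x. a * f x + b * g x) x = a * T f x + b * T g x"
  unfolding bounded_op_def L2_eq_iff by blast

lemma bounded_op_cong:
  assumes T: "bounded_op Q T" and f: "f \<in> L2 Q" and eq: "\<And>x. x \<in> set_pmf Q \<Longrightarrow> f x = g x" and x: "x \<in> set_pmf Q"
  shows "T f x = T g x"
proof -
  have g: "g \<in> L2 Q" using f eq L2_cong by blast
  let ?d = "\<lambda>x. 1 * f x + (-1) * g x"
  have d: "?d \<in> L2 Q" using f g by (rule L2_lincomb)
  obtain B where "L2_norm Q (T ?d) \<le> B * L2_norm Q ?d" using T d unfolding bounded_op_def by blast
  moreover have "L2_norm Q ?d = L2_norm Q (\<lambda>x. 0)" by (rule L2_norm_cong) (simp add: eq)
  moreover have "L2_norm Q (\<lambda>x. 0) = 0" by (simp add: L2_norm_def)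
  ultimately have "L2_norm Q (T ?d) \<le> 0" by simp
  then have "L2_norm Q (T ?d) = 0" using L2_norm_nonneg[of Q "T ?d"] by linarith
  then have "T ?d x = 0" by (rule L2_norm_eq_0D[OF bounded_op_closed[OF T d] _ x])
  then show ?thesis using bounded_op_lin[OF T f g x, of 1 "-1"] by simp
qed

lemma bounded_op_diff:
  "bounded_op Q T \<Longrightarrow> f \<in> L2 Q \<Longrightarrow> g \<in> L2 Q \<Longrightarrow> x \<in> set_pmf Q \<Longrightarrow>
     T (\<lambda>x. f x - g x) x = T f x - T g x"
  using bounded_op_lin[of Q T f g x 1 "-1"] by simp

lemma bounded_op_scale:
  "bounded_op Q T \<Longrightarrow> f \<in> L2 Q \<Longrightarrow> x \<in> set_pmf Q \<Longrightarrow> T (\<lambda>x. a * f x) x = a * T f x"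
  using bounded_op_lin[of Q T f f x a 0] by simp

lemma bounded_op_sum:
  assumes T: "bounded_op Q T" and F: "\<And>i. F i \<in> L2 Q" and x: "x \<in> set_pmf Q"
  shows "T (\<lambda>x. \<Sum>i<n. F i x) x = (\<Sum>i<(n::nat). T (F i) x)"
proof (induction n)
  case 0
  then show ?case using bounded_op_scale[OF T F x, of 0] by simp
next
  case (Suc n)
  then show ?case
    using bounded_op_lin[OF T L2_sum[of "{..<n}" F Q] F x, of 1 1] F by simp
qed

lemma bounded_opI:
  assumes "\<And>f. f \<in> L2 Q \<Longrightarrow> T f \<in> L2 Q"
    and "\<And>f g a b x. f \<in> L2 Q \<Longrightarrow> g \<in> L2 Q \<Longrightarrow> x \<in> set_pmf Q \<Longrightarrow>
      T (\<lambda>x. a * f x + b * g x) x = a * T f x + b * T g x"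
    and "\<And>f. f \<in> L2 Q \<Longrightarrow> L2_norm Q (T f) \<le> B * L2_norm Q f"
  shows "bounded_op Q T"
  unfolding bounded_op_def L2_eq_iff using assms by blast

lemma bounded_op_bound:
  assumes "bounded_op Q T"
  obtains B where "0 \<le> B" "\<And>f. f \<in> L2 Q \<Longrightarrow> L2_norm Q (T f) \<le> B * L2_norm Q f"
proof -
  obtain B where B: "\<And>f. f \<in> L2 Q \<Longrightarrow> L2_norm Q (T f) \<le> B * L2_norm Q f"
    using assms unfolding bounded_op_def by blast
  show ?thesis
  proof (rule that[of "max 0 B"])
    fix f assume "f \<in> L2 Q"
    then have "L2_norm Q (T f) \<le> B * L2_norm Q f" by (rule B)
    also have "\<dots> \<le> max 0 B * L2_norm Q f" by (intro mult_right_mono L2_norm_nonneg) simp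
    finally show "L2_norm Q (T f) \<le> max 0 B * L2_norm Q f" .
  qed simp
qed

lemma bounded_op_comp:
  assumes T: "bounded_op Q T" and S: "bounded_op Q S"
  shows "bounded_op Q (T \<circ> S)"
proof -
  obtain B where B: "0 \<le> B" "\<And>f. f \<in> L2 Q \<Longrightarrow> L2_norm Q (T f) \<le> B * L2_norm Q f" using bounded_op_bound[OF T] by blast
  obtain C where C: "0 \<le> C" "\<And>f. f \<in> L2 Q \<Longrightarrow> L2_norm Q (S f) \<le> C * L2_norm Q f" using bounded_op_bound[OF S] by blast
  show ?thesis
  proof (rule bounded_opI[where B = "B * C"])
    show "(T \<circ> S) f \<in> L2 Q" if "f \<in> L2 Q" for f using that T S by (simp add: bounded_op_closed)
    show "(T \<circ> S) (\<lambda>x. a * f x + b * g x) x = a * (T \<circ> S) f x + b * (T \<circ> S) g x"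
      if f: "f \<in> L2 Q" "g \<in> L2 Q" and x: "x \<in> set_pmf Q" for f g a b x
    proof -
      have "T (S (\<lambda>x. a * f x + b * g x)) x = T (\<lambda>x. a * S f x + b * S g x) x"
        by (rule bounded_op_cong[OF T]) (use f x S in \<open>auto intro: bounded_op_closed L2_lincomb simp: bounded_op_lin\<close>)
      then show ?thesis using f x T S by (simp add: bounded_op_lin bounded_op_closed)
    qed
    show "L2_norm Q ((T \<circ> S) f) \<le> B * C * L2_norm Q f" if f: "f \<in> L2 Q" for f
      using B(2)[OF bounded_op_closed[OF S f]] mult_left_mono[OF C(2)[OF f] B(1)] by simp
  qed
qed

lemma bounded_op_id: "bounded_op Q id"
  by (rule bounded_opI[where B = 1]) auto

lemma bounded_op_funpow: "bounded_op Q T \<Longrightarrow> bounded_op Q (T ^^ n)"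
  by (induction n) (simp_all only: funpow.simps bounded_op_id bounded_op_comp)

section \<open>Neumann series and resolvents\<close>

lemma L2_norm_funpow_le:
  assumes "\<And>f. f \<in> L2 Q \<Longrightarrow> T f \<in> L2 Q" "\<And>f. f \<in> L2 Q \<Longrightarrow> L2_norm Q (T f) \<le> q * L2_norm Q f" "0 \<le> q" "f \<in> L2 Q"
  shows "(T ^^ n) f \<in> L2 Q \<and> L2_norm Q ((T ^^ n) f) \<le> q ^ n * L2_norm Q f"
proof (induction n)
  case 0
  then show ?case using assms(4) by simp
next
  case (Suc n)
  then have "L2_norm Q (T ((T ^^ n) f)) \<le> q * L2_norm Q ((T ^^ n) f)" by (intro assms(2)) simp
  also have "\<dots> \<le> q * (q ^ n * L2_norm Q f)" using Suc assms(3) by (intro mult_left_mono) auto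
  finally show ?case using Suc assms(1) by (simp add: mult.assoc)
qed

text \<open>That G is a left inverse is telescoping. For the right inverse T has to pass through the
  infinite sum, which it does because T applied to the tails of the series tends to 0 in norm, hence
  pointwise on the support.\<close>

lemma Neumann_series:
  assumes T: "bounded_op Q T" and le: "\<And>f. f \<in> L2 Q \<Longrightarrow> L2_norm Q (T f) \<le> q * L2_norm Q f"
    and q: "0 \<le> q" "q < 1"
  defines "G \<equiv> \<lambda>f x. \<Sum>n. (T ^^ n) f x"
  shows "bounded_op Q G"
    and "f \<in> L2 Q \<Longrightarrow> x \<in> set_pmf Q \<Longrightarrow> G (\<lambda>x. f x - T f x) x = f x"
    and "f \<in> L2 Q \<Longrightarrow> x \<in> set_pmf Q \<Longrightarrow> G f x - T (G f) x = f x"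
proof -
  have Tn: "(T ^^ n) f \<in> L2 Q" "L2_norm Q ((T ^^ n) f) \<le> q ^ n * L2_norm Q f" if "f \<in> L2 Q" for f n
    using L2_norm_funpow_le[where T = T and q = q, OF bounded_op_closed[OF T] le q(1) that] by auto
  have geo: "summable (\<lambda>n. q ^ n * L2_norm Q f)" "(\<Sum>n. q ^ n * L2_norm Q f) = 1 / (1 - q) * L2_norm Q f" for f
  proof -
    have *: "summable (\<lambda>n. q ^ n)" "(\<Sum>n. q ^ n) = 1 / (1 - q)"
      using q by (auto intro: summable_geometric suminf_geometric)
    show "summable (\<lambda>n. q ^ n * L2_norm Q f)" by (rule summable_mult2[OF *(1)])
    show "(\<Sum>n. q ^ n * L2_norm Q f) = 1 / (1 - q) * L2_norm Q f"
      using suminf_mult2[OF *(1), of "L2_norm Q f"] *(2) by simp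
  qed
  have sum: "summable (\<lambda>n. L2_norm Q ((T ^^ n) f))" if "f \<in> L2 Q" for f
  proof (rule summable_comparison_test[OF _ geo(1)[of f]])
    show "\<exists>N. \<forall>n\<ge>N. norm (L2_norm Q ((T ^^ n) f)) \<le> q ^ n * L2_norm Q f"
      using Tn(2)[OF that] by (simp add: abs_of_nonneg[OF L2_norm_nonneg])
  qed
  note S = L2_suminf[OF Tn(1) sum]
  have pw: "summable (\<lambda>n. (T ^^ n) f x)" if "f \<in> L2 Q" "x \<in> set_pmf Q" for f x
    using S(1)[OF that(1) that(1) that(2)] .
  have GL2: "G f \<in> L2 Q" if "f \<in> L2 Q" for f unfolding G_def using S(2)[OF that that] .
  show "bounded_op Q G"
  proof (rule bounded_opI[where B = "1 / (1 - q)"])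
    show "L2_norm Q (G f) \<le> 1 / (1 - q) * L2_norm Q f" if f: "f \<in> L2 Q" for f
    proof -
      have "L2_norm Q (G f) \<le> (\<Sum>n. L2_norm Q ((T ^^ n) f))" unfolding G_def using S(3)[OF f f] .
      also have "\<dots> \<le> (\<Sum>n. q ^ n * L2_norm Q f)" using Tn(2)[OF f] sum[OF f] geo(1) by (intro suminf_le) auto
      finally show ?thesis using geo(2) by simp
    qed
    show "G (\<lambda>x. a * f x + b * g x) x = a * G f x + b * G g x"
      if f: "f \<in> L2 Q" "g \<in> L2 Q" and x: "x \<in> set_pmf Q" for f g a b x
    proof -
      have "G (\<lambda>x. a * f x + b * g x) x = (\<Sum>n. a * (T ^^ n) f x + b * (T ^^ n) g x)"
        unfolding G_def using bounded_op_lin[OF bounded_op_funpow[OF T] f x] by simp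
      also have "\<dots> = a * G f x + b * G g x"
        unfolding G_def using pw[OF f(1) x] pw[OF f(2) x]
        by (subst suminf_add[symmetric]) (auto intro: summable_mult simp: suminf_mult)
      finally show ?thesis .
    qed
  qed (rule GL2)
  show "G (\<lambda>x. f x - T f x) x = f x" if f: "f \<in> L2 Q" and x: "x \<in> set_pmf Q" for f x
  proof -
    have "(T ^^ n) (\<lambda>x. f x - T f x) x = (T ^^ n) f x - (T ^^ Suc n) f x" for n
      unfolding funpow_Suc_right comp_apply
      by (rule bounded_op_diff[OF bounded_op_funpow[OF T] f bounded_op_closed[OF T f] x])
    moreover have "(\<lambda>n. (T ^^ n) f x - (T ^^ Suc n) f x) sums ((T ^^ 0) f x - 0)"
      by (rule telescope_sums'[OF summable_LIMSEQ_zero[OF pw[OF f x]]])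
    ultimately show ?thesis unfolding G_def by (simp add: sums_iff)
  qed
  show "G f x - T (G f) x = f x" if f: "f \<in> L2 Q" and x: "x \<in> set_pmf Q" for f x
  proof -
    let ?s = "\<lambda>N x. \<Sum>n<N. (T ^^ n) f x"
    have sL2: "?s N \<in> L2 Q" for N using Tn(1)[OF f] by (rule L2_sum)
    let ?d = "\<lambda>N x. G f x - ?s N x"
    have dL2: "?d N \<in> L2 Q" for N using GL2[OF f] sL2 by (rule L2_diff)
    have d_le: "L2_norm Q (?d N) \<le> (\<Sum>n. L2_norm Q ((T ^^ (n + N)) f))" for N
    proof -
      have "L2_norm Q (?d N) = L2_norm Q (\<lambda>x. \<Sum>n. (T ^^ (n + N)) f x)"
        unfolding G_def by (intro L2_norm_cong suminf_minus_initial_segment[symmetric] pw[OF f])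
      also have "\<dots> \<le> (\<Sum>n. L2_norm Q ((T ^^ (n + N)) f))"
        using Tn(1)[OF f] summable_ignore_initial_segment[OF sum[OF f], of N] by (intro L2_suminf(3)) auto
      finally show ?thesis .
    qed
    have d_lim: "(\<lambda>N. \<Sum>n. L2_norm Q ((T ^^ (n + N)) f)) \<longlonglongrightarrow> 0" by (rule suminf_exist_split2[OF sum[OF f]])
    have dlim: "(\<lambda>N. L2_norm Q (?d N)) \<longlonglongrightarrow> 0"
      by (rule tendsto_sandwich[OF always_eventually[OF allI[OF L2_norm_nonneg]]
            always_eventually[OF allI[OF d_le]] tendsto_const d_lim])
    have "(\<lambda>N. q * L2_norm Q (?d N)) \<longlonglongrightarrow> q * 0" by (intro tendsto_intros dlim)
    then have qlim: "(\<lambda>N. q * L2_norm Q (?d N)) \<longlonglongrightarrow> 0" by simp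
    have "(\<lambda>N. L2_norm Q (T (?d N))) \<longlonglongrightarrow> 0"
      by (rule tendsto_sandwich[OF always_eventually[OF allI[OF L2_norm_nonneg]]
            always_eventually[OF allI[OF le[OF dL2]]] tendsto_const qlim])
    then have "(\<lambda>N. T (?d N) x) \<longlonglongrightarrow> 0"
      by (rule L2_tendsto_pointwise[OF bounded_op_closed[OF T dL2] _ x])
    moreover have "T (?d N) x = T (G f) x - (\<Sum>n<N. (T ^^ Suc n) f x)" for N
      using bounded_op_diff[OF T GL2[OF f] sL2 x] bounded_op_sum[OF T Tn(1)[OF f] x] by simp
    ultimately have "(\<lambda>N. T (G f) x - (\<Sum>n<N. (T ^^ Suc n) f x)) \<longlonglongrightarrow> 0" by simp
    from tendsto_diff[OF tendsto_const[of "T (G f) x"] this]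
    have "(\<lambda>n. (T ^^ Suc n) f x) sums T (G f) x" by (simp add: sums_def)
    moreover have "(\<lambda>n. (T ^^ Suc n) f x) sums (G f x - (T ^^ 0) f x)"
      unfolding G_def using pw[OF f x] by (subst sums_Suc_iff) (simp add: summable_sums)
    ultimately have "T (G f) x = G f x - (T ^^ 0) f x" by (rule sums_unique2)
    then show ?thesis by simp
  qed
qed

text \<open>l - T = (l - c)(I - E) with E = (T - c)/(l - c) of norm at most r/|l - c| < 1. The
  centre c is free because two discs are used: centre 1/2 with radius 1/2, and centre 0 with radius
  1/4.\<close>

lemma resolvent_exists:
  assumes T: "bounded_op Q T" and le: "\<And>f. f \<in> L2 Q \<Longrightarrow> L2_norm Q (\<lambda>x. T f x - c * f x) \<le> r * L2_norm Q f"
    and r: "0 \<le> r" "r < cmod (l - c)"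
  obtains R where "bounded_op Q R"
    and "\<And>f x. f \<in> L2 Q \<Longrightarrow> x \<in> set_pmf Q \<Longrightarrow> R (\<lambda>x. l * f x - T f x) x = f x"
    and "\<And>f x. f \<in> L2 Q \<Longrightarrow> x \<in> set_pmf Q \<Longrightarrow> l * R f x - T (R f) x = f x"
proof -
  define \<mu> where "\<mu> = l - c"
  have mu: "\<mu> \<noteq> 0" using r by (auto simp: \<mu>_def)
  define E where "E f x = (1 / \<mu>) * (T f x - c * f x)" for f x
  define G where "G f x = (\<Sum>n. (E ^^ n) f x)" for f x
  define q where "q = r / cmod \<mu>"
  have q: "0 \<le> q" "q < 1" using r mu by (auto simp: q_def \<mu>_def)
  have Ele: "L2_norm Q (E f) \<le> q * L2_norm Q f" if "f \<in> L2 Q" for f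
  proof -
    have "L2_norm Q (E f) = cmod (1 / \<mu>) * L2_norm Q (\<lambda>x. T f x - c * f x)"
      unfolding E_def by (rule L2_norm_scale)
    also have "\<dots> \<le> cmod (1 / \<mu>) * (r * L2_norm Q f)" by (intro mult_left_mono le that) simp
    finally show ?thesis by (simp add: q_def norm_divide)
  qed
  have Eop: "bounded_op Q E"
  proof (rule bounded_opI[OF _ _ Ele])
    show "E f \<in> L2 Q" if "f \<in> L2 Q" for f
      unfolding E_def by (intro L2_scale L2_diff bounded_op_closed[OF T] that)
    show "E (\<lambda>x. a * f x + b * g x) x = a * E f x + b * E g x"
      if "f \<in> L2 Q" "g \<in> L2 Q" "x \<in> set_pmf Q" for f g a b x
      unfolding E_def bounded_op_lin[OF T that] by (simp add: algebra_simps)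
  qed
  note N = Neumann_series[OF Eop Ele q, folded G_def]
  have Gop: "bounded_op Q G" using N(1) by (simp add: G_def[abs_def])
  have G1: "G (\<lambda>x. f x - E f x) x = f x" if "f \<in> L2 Q" "x \<in> set_pmf Q" for f x
    using N(2)[OF _ that] by (simp add: G_def[abs_def])
  have G2: "G f x - E (G f) x = f x" if "f \<in> L2 Q" "x \<in> set_pmf Q" for f x
    using N(3)[OF _ that] by (simp add: G_def[abs_def])
  have lT: "l * h x - T h x = \<mu> * (h x - E h x)" for h x
    using mu by (simp add: E_def \<mu>_def field_simps)
  define R where "R f x = (1 / \<mu>) * G f x" for f x
  have Rop: "bounded_op Q R"
  proof -
    have "bounded_op Q (\<lambda>f x. (1 / \<mu>) * f x)"
      by (rule bounded_opI[where B = "cmod (1 / \<mu>)"])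
        (simp_all only: L2_norm_scale L2_scale distrib_left mult.left_commute order_refl)
    from bounded_op_comp[OF this Gop] show ?thesis by (simp add: R_def[abs_def] comp_def)
  qed
  show ?thesis
  proof (rule that[OF Rop])
    fix f x assume f: "f \<in> L2 Q" and x: "x \<in> set_pmf Q"
    have "G (\<lambda>x. \<mu> * (f x - E f x)) x = \<mu> * G (\<lambda>x. f x - E f x) x"
      by (rule bounded_op_scale[OF Gop L2_diff[OF f bounded_op_closed[OF Eop f]] x])
    then show "R (\<lambda>x. l * f x - T f x) x = f x" using G1[OF f x] mu by (simp add: R_def lT)
    have "T (R f) x = (1 / \<mu>) * T (G f) x"
      unfolding R_def by (rule bounded_op_scale[OF T bounded_op_closed[OF Gop f] x])
    then have "l * R f x - T (R f) x = (1 / \<mu>) * (l * G f x - T (G f) x)" by (simp add: R_def algebra_simps)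
    then show "l * R f x - T (R f) x = f x" using G2[OF f x] mu by (simp add: lT)
  qed
qed


section \<open>Bounds for the pseudo spectral gap\<close>

lemma complex_integrable_ReIm:
  assumes "integrable M (\<lambda>x. Re (f x))" "integrable M (\<lambda>x. Im (f x))"
  shows "integrable M f"
proof -
  have "integrable M (\<lambda>x. complex_of_real (Re (f x)) + \<i> * complex_of_real (Im (f x)))"
    using assms by (intro Bochner_Integration.integrable_add integrable_mult_right integrable_of_real)
  then show ?thesis by (simp add: complex_eq[symmetric])
qed

lemma complex_expectation_bind_pmf:
  fixes f :: "'b \<Rightarrow> complex"
  assumes int: "integrable (measure_pmf (bind_pmf p q)) f"
  shows "expect (bind_pmf p q) f =
    expect p (\<lambda>x. expect (q x) f)"
proof -
  note re = integrable_Re[OF int] and im = integrable_Im[OF int]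
  have AE: "AE x in measure_pmf p. integrable (measure_pmf (q x)) f"
    using AE_integrable_bind_pmf[OF re] AE_integrable_bind_pmf[OF im]
    by eventually_elim (rule complex_integrable_ReIm)
  have Re: "Re (expect (q x) f) = expect (q x) (\<lambda>y. Re (f y))"
    and Im: "Im (expect (q x) f) = expect (q x) (\<lambda>y. Im (f y))"
    if "x \<in> set_pmf p" for x
    using AE that by (auto simp: AE_measure_pmf_iff integral_Re integral_Im)
  have iRe: "integrable p (\<lambda>x. Re (expect (q x) f))"
    using integrable_expectation_bind_pmf[OF re]
    by (rule integrable_cong_AE_imp) (auto simp: AE_measure_pmf_iff Re)
  have iIm: "integrable p (\<lambda>x. Im (expect (q x) f))"
    using integrable_expectation_bind_pmf[OF im]
    by (rule integrable_cong_AE_imp) (auto simp: AE_measure_pmf_iff Im)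
  have i: "integrable p (\<lambda>x. expect (q x) f)"
    using iRe iIm by (rule complex_integrable_ReIm)
  show "expect (bind_pmf p q) f =
      expect p (\<lambda>x. expect (q x) f)"
  proof (rule complex_eqI)
    show "Re (expect (bind_pmf p q) f) =
        Re (expect p (\<lambda>x. expect (q x) f))"
      unfolding integral_Re[OF int, symmetric] integral_Re[OF i, symmetric] expectation_bind_pmf[OF re]
      by (rule expectation_pmf_cong) (simp add: Re)
    show "Im (expect (bind_pmf p q) f) =
        Im (expect p (\<lambda>x. expect (q x) f))"
      unfolding integral_Im[OF int, symmetric] integral_Im[OF i, symmetric] expectation_bind_pmf[OF im]
      by (rule expectation_pmf_cong) (simp add: Im)
  qed
qed

lemma L2_bind:
  assumes "bind_pmf Q q = Q" "f \<in> L2 Q" "x \<in> set_pmf Q"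
  shows "f \<in> L2 (q x)"
  using AE_integrable_bind_pmf[of Q q "\<lambda>x. (cmod (f x))\<^sup>2"] assms by (simp add: L2_def AE_measure_pmf_iff)

text \<open>Jensen's inequality at each point, integrated by invariance. The kernel is arbitrary so
  that the facts apply to \<open>K\<close> and to its time reversal.\<close>

lemma
  assumes inv: "bind_pmf Q q = Q"
  shows kernel_op_L2: "f \<in> L2 Q \<Longrightarrow> kernel_op q f \<in> L2 Q"
    and kernel_op_norm_le: "f \<in> L2 Q \<Longrightarrow> L2_norm Q (kernel_op q f) \<le> L2_norm Q f"
    and bounded_op_kernel_op: "bounded_op Q (kernel_op q)"
proof -
  have J: "(cmod (kernel_op q f x))\<^sup>2 \<le> expect (q x) (\<lambda>y. (cmod (f y))\<^sup>2)"
    if "f \<in> L2 Q" "x \<in> set_pmf Q" for f x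
  proof -
    have f: "f \<in> L2 (q x)" using L2_bind[OF inv that] .
    have "cmod (kernel_op q f x) = cmod (L2_inner (q x) f (\<lambda>_. 1))"
      by (simp add: kernel_op_def L2_inner_def)
    also have "\<dots> \<le> L2_norm (q x) f * L2_norm (q x) (\<lambda>_. 1)" using f by (intro L2_inner_le) simp_all
    also have "\<dots> = L2_norm (q x) f" by (simp add: L2_norm_def)
    finally have "(cmod (kernel_op q f x))\<^sup>2 \<le> (L2_norm (q x) f)\<^sup>2" by (rule power_mono) simp
    then show ?thesis by (simp add: L2_norm_power2)
  qed
  have int: "integrable Q (\<lambda>x. expect (q x) (\<lambda>y. (cmod (f y))\<^sup>2))"
    "expect Q (\<lambda>x. expect (q x) (\<lambda>y. (cmod (f y))\<^sup>2)) = (L2_norm Q f)\<^sup>2"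
    if "f \<in> L2 Q" for f
    using integrable_expectation_bind_pmf[of Q q "\<lambda>y. (cmod (f y))\<^sup>2"] expectation_bind_pmf[of Q q "\<lambda>y. (cmod (f y))\<^sup>2"]
      that by (simp_all add: inv L2_def L2_norm_power2)
  show L2: "kernel_op q f \<in> L2 Q" if "f \<in> L2 Q" for f
    unfolding L2_def mem_Collect_eq
  proof (rule Bochner_Integration.integrable_bound[OF int(1)[OF that]], simp, rule AE_pmfI)
    fix x assume "x \<in> set_pmf Q"
    from J[OF that this] show "norm ((cmod (kernel_op q f x))\<^sup>2) \<le>
        norm (expect (q x) (\<lambda>y. (cmod (f y))\<^sup>2))" by simp
  qed
  show le: "L2_norm Q (kernel_op q f) \<le> L2_norm Q f" if "f \<in> L2 Q" for f
    unfolding L2_norm_le_iff[OF L2_norm_nonneg] int(2)[OF that, symmetric]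
    using L2D[OF L2[OF that]] int(1)[OF that] J[OF that] by (rule expectation_pmf_mono)
  show "bounded_op Q (kernel_op q)"
  proof (rule bounded_opI[where B = 1])
    show "kernel_op q (\<lambda>x. a * f x + b * g x) x = a * kernel_op q f x + b * kernel_op q g x"
      if "f \<in> L2 Q" "g \<in> L2 Q" "x \<in> set_pmf Q" for f g a b x
      using L2_integrable[OF L2_bind[OF inv that(1,3)]] L2_integrable[OF L2_bind[OF inv that(2,3)]]
      by (simp add: kernel_op_def)
  qed (use L2 le in simp_all)
qed

text \<open>Restricted to the support of Q, where f is integrable for every power of the kernel; the
  support is closed under K.\<close>

lemma (in stationary_kernel) kernel_op_funpow:
  assumes f: "f \<in> L2 Q" and x: "x \<in> set_pmf Q"
  shows "(kernel_op K ^^ n) f x = expect (kernel_pow K n x) f"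
  using x
proof (induction n arbitrary: x)
  case (Suc n)
  have "set_pmf (K x) \<subseteq> set_pmf Q"
    using Suc.prems set_bind_pmf[of Q K] by (auto simp: invariant)
  then have "(kernel_op K ^^ Suc n) f x = expect (K x) (\<lambda>y. expect (kernel_pow K n y) f)"
    using Suc.IH by (auto simp: kernel_op_def[of K "(kernel_op K ^^ n) f"] intro!: expectation_pmf_cong)
  also have "\<dots> = expect (kernel_pow K (Suc n) x) f"
    using L2_integrable[OF L2_bind[OF invariant_pow[of "Suc n"] f Suc.prems]]
    by (simp add: complex_expectation_bind_pmf)
  finally show ?case .
qed simp

definition joint_law :: "'x pmf \<Rightarrow> ('x \<Rightarrow> 'x pmf) \<Rightarrow> ('x \<times> 'x) pmf" where
  "joint_law Q K = bind_pmf Q (\<lambda>y. map_pmf (Pair y) (K y))"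

text \<open>Conditional law of the earlier of two consecutive states given the later one, in the
  stationary chain; meaningful for x in the support of Q.\<close>

definition reversed_kernel :: "'x pmf \<Rightarrow> ('x \<Rightarrow> 'x pmf) \<Rightarrow> 'x \<Rightarrow> 'x pmf" where
  "reversed_kernel Q K x = map_pmf fst (cond_pmf (joint_law Q K) {z. snd z = x})"

text \<open>Witness for the choice in \<open>adjoint_op\<close>, namely the time reversal: both
  inner products are the mean of f(X1) times the conjugate of g(X0), computed by conditioning the
  pair on its first or on its second component.\<close>

lemma adjoint_exists:
  assumes inv: "bind_pmf Q K = Q"
  shows "\<exists>S. bounded_op Q S \<and> (\<forall>f\<in>L2 Q. \<forall>g\<in>L2 Q. L2_inner Q (kernel_op K f) g = L2_inner Q f (S g))"
proof -
  define J where "J = joint_law Q K"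
  define C where "C x = cond_pmf J {z. snd z = x}" for x
  let ?R = "reversed_kernel Q K"
  have R: "?R x = map_pmf fst (C x)" for x by (simp add: reversed_kernel_def C_def J_def)
  have fst: "map_pmf fst J = Q"
    unfolding J_def joint_law_def map_bind_pmf map_pmf_comp by (simp add: bind_return_pmf')
  have snd: "map_pmf snd J = Q"
    unfolding J_def joint_law_def map_bind_pmf map_pmf_comp by (simp add: inv)
  have nonempty: "set_pmf J \<inter> {z. snd z = x} \<noteq> {}" if "x \<in> set_pmf Q" for x
    using that unfolding snd[symmetric] by auto
  have J: "bind_pmf Q C = J"
    unfolding C_def
  proof (rule bind_cond_pmf_cancel)
    show "set_pmf Q \<inter> {x. snd z = x} \<noteq> {}" if "z \<in> set_pmf J" for z
      using that unfolding snd[symmetric] by auto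
    show "measure J {z. snd z = x} = measure Q {x. snd z = x}" if "snd z = x" for x z
    proof -
      have "measure Q {x. snd z = x} = measure J (snd -` {x. snd z = x})"
        unfolding snd[symmetric] by (rule measure_map_pmf)
      also have "snd -` {x. snd z = x} = {z. snd z = x}" using that by auto
      finally show ?thesis by simp
    qed
  qed (rule nonempty)
  have invR: "bind_pmf Q ?R = Q"
    unfolding R map_bind_pmf[symmetric] J by (rule fst)
  have Csnd: "snd z = x" if "x \<in> set_pmf Q" "z \<in> set_pmf (C x)" for x z
    using that(2) unfolding C_def set_cond_pmf[OF nonempty[OF that(1)]] by simp
  have "L2_inner Q (kernel_op K f) g = L2_inner Q f (kernel_op ?R g)" if f: "f \<in> L2 Q" and g: "g \<in> L2 Q" for f g
  proof -
    let ?\<phi> = "\<lambda>z. f (snd z) * cnj (g (fst z))"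
    have f': "integrable J (\<lambda>z. (cmod (f (snd z)))\<^sup>2)" and g': "integrable J (\<lambda>z. (cmod (g (fst z)))\<^sup>2)"
      using L2D[OF f] L2D[OF g]
        integrable_map_pmf_eq[of snd J "\<lambda>x. (cmod (f x))\<^sup>2"] integrable_map_pmf_eq[of fst J "\<lambda>x. (cmod (g x))\<^sup>2"]
      unfolding fst snd by simp_all
    have "integrable J (\<lambda>z. cmod (f (snd z)) * cmod (g (fst z)))"
      using f' g' by (intro integral_Cauchy_Schwarz(1)) auto
    then have int: "integrable J ?\<phi>"
      by (rule Bochner_Integration.integrable_bound) (auto simp: norm_mult)
    have "L2_inner Q (kernel_op K f) g = expect Q (\<lambda>y. expect (map_pmf (Pair y) (K y)) ?\<phi>)"
      unfolding L2_inner_def kernel_op_def by simp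
    also have "\<dots> = expect J ?\<phi>"
      using int unfolding J_def joint_law_def by (rule complex_expectation_bind_pmf[symmetric])
    also have "\<dots> = expect Q (\<lambda>x. expect (C x) ?\<phi>)"
      using int unfolding J[symmetric] by (rule complex_expectation_bind_pmf)
    also have "\<dots> = expect Q (\<lambda>x. f x * cnj (kernel_op ?R g x))"
    proof (rule expectation_pmf_cong)
      fix x assume x: "x \<in> set_pmf Q"
      have "expect (C x) ?\<phi> = expect (C x) (\<lambda>z. f x * cnj (g (fst z)))"
        by (rule expectation_pmf_cong) (simp add: Csnd[OF x])
      then show "expect (C x) ?\<phi> = f x * cnj (kernel_op ?R g x)"
        by (simp add: kernel_op_def R)
    qed
    finally show ?thesis by (simp add: L2_inner_def)
  qed
  then show ?thesis using bounded_op_kernel_op[OF invR] by blast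
qed

section \<open>Products of a contraction with its adjoint\<close>

locale adjoint_pair =
  fixes Q :: "'x pmf" and A S :: "'x operator"
  assumes A: "bounded_op Q A" and A_le: "\<And>f. f \<in> L2 Q \<Longrightarrow> L2_norm Q (A f) \<le> L2_norm Q f"
    and S: "bounded_op Q S"
    and adj: "\<And>f g. f \<in> L2 Q \<Longrightarrow> g \<in> L2 Q \<Longrightarrow> L2_inner Q (A f) g = L2_inner Q f (S g)"
begin

text \<open>The square of |Sf| is (A S f, f). Only the size of A at the single vector S f enters, so
  a contraction of A that holds on centred functions is inherited by S.\<close>

lemma S_le_gen:
  assumes f: "f \<in> L2 Q" and c: "0 \<le> c" "L2_norm Q (A (S f)) \<le> c * L2_norm Q (S f)"
  shows "L2_norm Q (S f) \<le> c * L2_norm Q f"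
proof (cases "L2_norm Q (S f) = 0")
  case True
  then show ?thesis using c(1) L2_norm_nonneg[of Q f] by simp
next
  case False
  let ?s = "L2_norm Q (S f)"
  have "?s\<^sup>2 = Re (L2_inner Q (A (S f)) f)"
    using adj[OF bounded_op_closed[OF S f] f] by (simp add: L2_inner_self)
  also have "\<dots> \<le> cmod (L2_inner Q (A (S f)) f)" by (rule complex_Re_le_cmod)
  also have "\<dots> \<le> L2_norm Q (A (S f)) * L2_norm Q f"
    by (intro L2_inner_le bounded_op_closed[OF A] bounded_op_closed[OF S] f)
  also have "\<dots> \<le> c * ?s * L2_norm Q f" using c(2) by (rule mult_right_mono) (rule L2_norm_nonneg)
  finally have "?s * ?s \<le> (c * L2_norm Q f) * ?s" by (simp add: power2_eq_square mult_ac)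
  then show ?thesis using False L2_norm_nonneg[of Q "S f"] by (simp add: mult_le_cancel_right)
qed

lemma S_le: "f \<in> L2 Q \<Longrightarrow> L2_norm Q (S f) \<le> L2_norm Q f"
  using S_le_gen[of f 1] A_le[OF bounded_op_closed[OF S]] by simp

text \<open>Since Re (SAf, f) = |Af|^2, expanding the square leaves |SAf|^2 - |Af|^2 + |f|^2/4, and
  S is a contraction. Together with the resolvent bound this confines the spectrum to the disc on
  the diameter [0, 1], without the spectral theorem for positive operators.\<close>

lemma SA_disc:
  assumes f: "f \<in> L2 Q"
  shows "L2_norm Q (\<lambda>x. (S \<circ> A) f x - 1/2 * f x) \<le> 1/2 * L2_norm Q f"
proof (rule power2_le_imp_le)
  have Af: "A f \<in> L2 Q" and SAf: "S (A f) \<in> L2 Q" using f A S by (auto intro: bounded_op_closed)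
  have "Re (L2_inner Q (S (A f)) f) = Re (L2_inner Q f (S (A f)))"
  proof -
    have "L2_inner Q (S (A f)) f = expect Q (\<lambda>x. cnj (f x * cnj (S (A f) x)))"
      unfolding L2_inner_def by (rule Bochner_Integration.integral_cong) (simp_all add: mult.commute)
    also have "\<dots> = cnj (L2_inner Q f (S (A f)))" unfolding L2_inner_def by (rule Bochner_Integration.integral_cnj)
    finally have "L2_inner Q (S (A f)) f = cnj (L2_inner Q f (S (A f)))" .
    then show ?thesis by simp
  qed
  also have "\<dots> = (L2_norm Q (A f))\<^sup>2" using adj[OF f Af, symmetric] by (simp only: L2_inner_self Re_complex_of_real)
  finally have inner: "Re (L2_inner Q (S (A f)) f) = (L2_norm Q (A f))\<^sup>2" .
  have "(L2_norm Q (S (A f)))\<^sup>2 \<le> (L2_norm Q (A f))\<^sup>2"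
    using S_le[OF Af] by (intro power_mono L2_norm_nonneg)
  then show "(L2_norm Q (\<lambda>x. (S \<circ> A) f x - 1/2 * f x))\<^sup>2 \<le> (1/2 * L2_norm Q f)\<^sup>2"
    using L2_norm_lincomb_power2[OF SAf f, of "-1/2"] inner by (simp add: power2_eq_square)
qed (simp add: L2_norm_nonneg)

lemma spectrum_SA_disc:
  assumes "l \<in> S2 Q (S \<circ> A)"
  shows "cmod (l - 1/2) \<le> 1/2"
proof (rule ccontr)
  assume "\<not> cmod (l - 1/2) \<le> 1/2"
  then have "1/2 < cmod (l - 1/2)" by simp
  from resolvent_exists[OF bounded_op_comp[OF S A] SA_disc _ this]
  obtain R where "bounded_op Q R"
    "\<And>f x. f \<in> L2 Q \<Longrightarrow> x \<in> set_pmf Q \<Longrightarrow> R (\<lambda>x. l * f x - (S \<circ> A) f x) x = f x"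
    "\<And>f x. f \<in> L2 Q \<Longrightarrow> x \<in> set_pmf Q \<Longrightarrow> l * R f x - (S \<circ> A) (R f) x = f x" by auto
  then show False using assms unfolding S2_def L2_eq_iff mem_Collect_eq by blast
qed

lemma spectral_gap_le_1: "spectral_gap Q (S \<circ> A) \<le> 1"
proof -
  have "0 \<le> Sup (Re ` (S2 Q (S \<circ> A) - {1}))" if ne: "S2 Q (S \<circ> A) - {1} \<noteq> {}"
  proof -
    obtain l where l: "l \<in> S2 Q (S \<circ> A) - {1}" using ne by blast
    have b: "0 \<le> Re k \<and> Re k \<le> 1" if "k \<in> S2 Q (S \<circ> A)" for k
    proof -
      have "\<bar>Re (k - 1/2)\<bar> \<le> 1/2" using spectrum_SA_disc[OF that] abs_Re_le_cmod order_trans by blast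
      then have "\<bar>Re k - 1/2\<bar> \<le> 1/2" by simp
      then show ?thesis by linarith
    qed
    have "0 \<le> Re l" using b l by blast
    also have "\<dots> \<le> Sup (Re ` (S2 Q (S \<circ> A) - {1}))"
      using l b by (intro cSup_upper bdd_aboveI2[where M = 1]) auto
    finally show ?thesis .
  qed
  then show ?thesis by (auto simp: spectral_gap_def)
qed

end

text \<open>Subtracting the projection onto the constants leaves an operator of norm at most \<open>1/4\<close>, so
  the rest of the spectrum lies in that disc.\<close>

lemma spectral_gap_ge:
  assumes T: "bounded_op Q T"
    and mean: "\<And>f. f \<in> L2 Q \<Longrightarrow> expect Q (T f) = expect Q f"
    and le: "\<And>f. f \<in> L2 Q \<Longrightarrow>
      L2_norm Q (\<lambda>x. T f x - expect Q f) \<le> 1/4 * L2_norm Q f"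
    and one: "\<And>x. x \<in> set_pmf Q \<Longrightarrow> T (\<lambda>_. 1) x = 1"
  shows "spectral_gap Q T \<ge> 3/4"
proof -
  let ?E = "expect Q"
  define T' where "T' f x = T f x - ?E f" for f x
  have T'L2: "T' f \<in> L2 Q" if "f \<in> L2 Q" for f
    unfolding T'_def by (rule L2_diff[OF bounded_op_closed[OF T that] L2_const])
  have T'le: "L2_norm Q (T' f) \<le> 1/4 * L2_norm Q f" if "f \<in> L2 Q" for f
    using le[OF that] by (simp add: T'_def[abs_def])
  have E_lin: "?E (\<lambda>x. a * f x + b * g x) = a * ?E f + b * ?E g" if "f \<in> L2 Q" "g \<in> L2 Q" for a b f g
    using L2_integrable[OF that(1)] L2_integrable[OF that(2)] by simp
  have T': "bounded_op Q T'"
  proof (rule bounded_opI[OF T'L2 _ T'le])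
    show "T' (\<lambda>x. a * f x + b * g x) x = a * T' f x + b * T' g x"
      if "f \<in> L2 Q" "g \<in> L2 Q" "x \<in> set_pmf Q" for f g a b x
      unfolding T'_def bounded_op_lin[OF T that] E_lin[OF that(1,2)] by (simp add: algebra_simps)
  qed
  have simple: "eigenvalue_one_simple Q T"
    unfolding eigenvalue_one_simple_def L2_eq_iff
  proof (intro bexI[where x = "\<lambda>_. 1"] conjI ballI impI)
    show "\<not> (\<forall>x\<in>set_pmf Q. (1::complex) = 0)" using set_pmf_not_empty[of Q] by auto
    fix g assume g: "g \<in> L2 Q" and Tg: "\<forall>x\<in>set_pmf Q. T g x = g x"
    \<comment> \<open>A fixed function minus its mean is fixed and centred, so its norm is at most a
      quarter of itself.\<close>
    let ?h = "\<lambda>x. g x - ?E g"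
    have h: "?h \<in> L2 Q" by (rule L2_diff[OF g L2_const])
    have Eh: "?E ?h = 0" using L2_integrable[OF g] by simp
    have Th: "T ?h x = ?h x" if x: "x \<in> set_pmf Q" for x
    proof -
      have "T (\<lambda>x. 1 * g x + (- ?E g) * 1) x = 1 * T g x + (- ?E g) * T (\<lambda>_. 1) x"
        by (rule bounded_op_lin[OF T g _ x]) simp
      then show ?thesis using Tg x one[OF x] by simp
    qed
    have "L2_norm Q ?h = L2_norm Q (\<lambda>x. T ?h x - ?E ?h)"
      by (rule L2_norm_cong) (simp only: Th Eh diff_zero)
    also have "\<dots> \<le> 1/4 * L2_norm Q ?h" by (rule le[OF h])
    finally have "L2_norm Q ?h = 0" using L2_norm_nonneg[of Q ?h] by linarith
    then show "\<exists>c. \<forall>x\<in>set_pmf Q. g x = c * 1"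
      using L2_norm_eq_0D[OF h] by (intro exI[of _ "?E g"]) auto
  qed (use one in auto)
  have disc: "cmod l \<le> 1/4" if l: "l \<in> S2 Q T" "l \<noteq> 1" for l
  proof (rule ccontr)
    assume "\<not> cmod l \<le> 1/4"
    then have gt: "1/4 < cmod (l - 0)" by simp
    have l0: "l \<noteq> 0" using l by (simp add: S2_def)
    have le0: "L2_norm Q (\<lambda>x. T' f x - 0 * f x) \<le> 1/4 * L2_norm Q f" if "f \<in> L2 Q" for f
      using T'le[OF that] by simp
    from resolvent_exists[OF T' le0 _ gt]
    obtain R' where R': "bounded_op Q R'"
      and R1: "\<And>f x. f \<in> L2 Q \<Longrightarrow> x \<in> set_pmf Q \<Longrightarrow> R' (\<lambda>x. l * f x - T' f x) x = f x"
      and R2: "\<And>f x. f \<in> L2 Q \<Longrightarrow> x \<in> set_pmf Q \<Longrightarrow> l * R' f x - T' (R' f) x = f x" by auto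
    have R'L2: "R' f \<in> L2 Q" if "f \<in> L2 Q" for f using bounded_op_closed[OF R' that] .
    have ET': "?E (T' f) = 0" if "f \<in> L2 Q" for f
      using mean[OF that] L2_integrable[OF bounded_op_closed[OF T that]] by (simp add: T'_def[abs_def])
    have ER': "l * ?E (R' f) = ?E f" if f: "f \<in> L2 Q" for f
    proof -
      have "?E f = ?E (\<lambda>x. l * R' f x + (-1) * T' (R' f) x)"
        by (rule expectation_pmf_cong) (use R2[OF f] in simp)
      also have "\<dots> = l * ?E (R' f)" unfolding E_lin[OF R'L2[OF f] T'L2[OF R'L2[OF f]]] ET'[OF R'L2[OF f]] by simp
      finally show ?thesis by simp
    qed
    \<comment> \<open>On constants the resolvent of T' is 1/l, because T' vanishes there, while that
      of T must be 1/(l - 1). The difference d is added on the mean of f.\<close>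
    define d where "d = 1 / (l - 1) - 1 / l"
    have d: "d * l * (l - 1) = 1" using l0 l(2) by (simp add: d_def field_simps)
    define R where "R f x = R' f x + d * ?E f" for f x
    have RL2: "R f \<in> L2 Q" if "f \<in> L2 Q" for f unfolding R_def by (rule L2_add[OF R'L2[OF that] L2_const])
    have R'1: "R' (\<lambda>_. 1) x = 1 / l" if x: "x \<in> set_pmf Q" for x
    proof -
      have "R' (\<lambda>x. l * 1 - T' (\<lambda>_. 1) x) x = 1" by (rule R1[OF _ x]) simp
      also have "R' (\<lambda>x. l * 1 - T' (\<lambda>_. 1) x) x = R' (\<lambda>x. l * 1) x"
        by (rule bounded_op_cong[OF R' _ _ x]) 
          (simp_all add: L2_diff[OF L2_const T'L2[OF L2_const]], simp add: T'_def one)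
      also have "\<dots> = l * R' (\<lambda>_. 1) x" by (rule bounded_op_scale[OF R' _ x]) simp
      finally show ?thesis using l0 by (simp add: field_simps)
    qed
    obtain B where B: "0 \<le> B" "\<And>f. f \<in> L2 Q \<Longrightarrow> L2_norm Q (R' f) \<le> B * L2_norm Q f"
      using bounded_op_bound[OF R'] by blast
    have E_le: "cmod (?E f) \<le> L2_norm Q f" if "f \<in> L2 Q" for f
      using L2_inner_le[OF that, of "\<lambda>_. 1"] by (simp add: L2_inner_def L2_norm_def)
    have R: "bounded_op Q R"
    proof (rule bounded_opI[where B = "B + cmod d", OF RL2])
      show "R (\<lambda>x. a * f x + b * g x) x = a * R f x + b * R g x"
        if "f \<in> L2 Q" "g \<in> L2 Q" "x \<in> set_pmf Q" for f g a b x
        unfolding R_def bounded_op_lin[OF R' that] E_lin[OF that(1,2)] by (simp add: algebra_simps)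
      show "L2_norm Q (R f) \<le> (B + cmod d) * L2_norm Q f" if f: "f \<in> L2 Q" for f
      proof -
        have "L2_norm Q (R f) \<le> L2_norm Q (R' f) + L2_norm Q (\<lambda>_. d * ?E f)"
          unfolding R_def[abs_def] by (rule L2_norm_add[OF R'L2[OF f] L2_const])
        also have "L2_norm Q (\<lambda>_. d * ?E f) = cmod d * cmod (?E f)" by (simp add: L2_norm_def norm_mult)
        also have "L2_norm Q (R' f) + \<dots> \<le> B * L2_norm Q f + cmod d * L2_norm Q f"
          using B(2)[OF f] E_le[OF f] by (intro add_mono mult_left_mono) auto
        finally show ?thesis by (simp add: algebra_simps)
      qed
    qed
    have "R (\<lambda>x. l * f x - T f x) x = f x" if f: "f \<in> L2 Q" and x: "x \<in> set_pmf Q" for f x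
    proof -
      have h: "(\<lambda>x. l * f x - T' f x) \<in> L2 Q" by (rule L2_diff[OF L2_scale[OF f] T'L2[OF f]])
      have "R' (\<lambda>x. l * f x - T f x) x = R' (\<lambda>x. 1 * (l * f x - T' f x) + (- ?E f) * 1) x"
        by (rule arg_cong[where f = "\<lambda>h. R' h x"]) (auto simp: T'_def)
      also have "\<dots> = 1 * R' (\<lambda>x. l * f x - T' f x) x + (- ?E f) * R' (\<lambda>_. 1) x"
        by (rule bounded_op_lin[OF R' h _ x]) simp
      also have "\<dots> = f x - ?E f / l" using R1[OF f x] R'1[OF x] by simp
      finally have 1: "R' (\<lambda>x. l * f x - T f x) x = f x - ?E f / l" .
      have "?E (\<lambda>x. l * f x - T f x) = (l - 1) * ?E f"
        using E_lin[OF f bounded_op_closed[OF T f], of l "-1"] mean[OF f] by (simp add: algebra_simps)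
      then have "R (\<lambda>x. l * f x - T f x) x = f x - ?E f / l + d * ((l - 1) * ?E f)" by (simp add: R_def 1)
      also have "d * ((l - 1) * ?E f) = (d * l * (l - 1)) * ?E f / l" using l0 by simp
      also have "\<dots> = ?E f / l" unfolding d by simp
      finally show ?thesis by simp
    qed
    moreover have "l * R f x - T (R f) x = f x" if f: "f \<in> L2 Q" and x: "x \<in> set_pmf Q" for f x
    proof -
      have "T (R f) x = T (\<lambda>x. 1 * R' f x + (d * ?E f) * 1) x"
        by (rule arg_cong[where f = "\<lambda>h. T h x"]) (auto simp: R_def)
      also have "\<dots> = 1 * T (R' f) x + (d * ?E f) * T (\<lambda>_. 1) x"
        by (rule bounded_op_lin[OF T R'L2[OF f] _ x]) simp
      also have "\<dots> = T' (R' f) x + ?E (R' f) + d * ?E f" using one[OF x] by (simp add: T'_def)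
      finally have "l * R f x - T (R f) x = f x + (l - 1) * d * ?E f - ?E (R' f)"
        using R2[OF f x] by (simp add: R_def algebra_simps)
      also have "(l - 1) * d * ?E f = ?E (R' f)"
        unfolding ER'[OF f, symmetric] using d by (simp add: mult_ac)
      finally show ?thesis by simp
    qed
    ultimately show False using R l unfolding S2_def L2_eq_iff mem_Collect_eq by blast
  qed
  have "Sup (Re ` (S2 Q T - {1})) \<le> 1/4" if "S2 Q T - {1} \<noteq> {}"
  proof (rule cSup_least)
    show "y \<le> 1/4" if "y \<in> Re ` (S2 Q T - {1})" for y
      using that disc order_trans[OF complex_Re_le_cmod] by blast
  qed (use that in blast)
  then show ?thesis using simple by (auto simp: spectral_gap_def)
qed

section \<open>The pseudo spectral gap of a mixing chain\<close>

context mixing_kernel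
begin

lemma adjoint_pair_pow:
  "adjoint_pair Q (kernel_op K ^^ k) (adjoint_op Q (kernel_op K) ^^ k)"
proof -
  define S where "S = adjoint_op Q (kernel_op K)"
  have S: "bounded_op Q S" "\<And>f g. f \<in> L2 Q \<Longrightarrow> g \<in> L2 Q \<Longrightarrow> L2_inner Q (kernel_op K f) g = L2_inner Q f (S g)"
    using someI_ex[OF adjoint_exists[OF invariant]] unfolding S_def adjoint_op_def by blast+
  have A: "bounded_op Q (kernel_op K)" using invariant by (rule bounded_op_kernel_op)
  have "L2_inner Q ((kernel_op K ^^ k) f) g = L2_inner Q f ((S ^^ k) g)" if "f \<in> L2 Q" "g \<in> L2 Q" for f g
    using that
  proof (induction k arbitrary: g)
    case (Suc k)
    have "L2_inner Q ((kernel_op K ^^ Suc k) f) g = L2_inner Q ((kernel_op K ^^ k) f) (S g)"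
      using S(2)[OF bounded_op_closed[OF bounded_op_funpow[OF A] Suc.prems(1)] Suc.prems(2)] by simp
    also have "\<dots> = L2_inner Q f ((S ^^ k) (S g))"
      using Suc.prems bounded_op_closed[OF S(1)] by (intro Suc.IH)
    finally show ?case by (simp only: funpow_Suc_right comp_apply)
  qed simp
  moreover have "L2_norm Q ((kernel_op K ^^ k) f) \<le> L2_norm Q f" if "f \<in> L2 Q" for f
    using L2_norm_funpow_le[where T = "kernel_op K" and q = 1 and n = k and Q = Q and f = f]
      kernel_op_L2[OF invariant] kernel_op_norm_le[OF invariant] that by simp
  ultimately show ?thesis
    unfolding S_def[symmetric] by unfold_locales (auto intro: bounded_op_funpow A S(1))
qed

lemma pseudo_spectral_gap_bounds:
  shows "0 < pseudo_spectral_gap K Q" "pseudo_spectral_gap K Q \<le> 1"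
proof -
  let ?g = "\<lambda>k. spectral_gap Q ((adjoint_op Q (kernel_op K) ^^ k) \<circ> (kernel_op K ^^ k)) / real k"
  have le1: "?g k \<le> 1" if "k \<in> {1..}" for k
  proof -
    have "spectral_gap Q ((adjoint_op Q (kernel_op K) ^^ k) \<circ> (kernel_op K ^^ k)) \<le> 1"
      using adjoint_pair_pow by (rule adjoint_pair.spectral_gap_le_1)
    also have "1 \<le> real k" using that by simp
    finally show ?thesis using that by (simp add: divide_le_eq_1)
  qed
  show "pseudo_spectral_gap K Q \<le> 1"
    unfolding pseudo_spectral_gap_def by (rule cSUP_least) (use le1 in auto)
  \<comment> \<open>After three mixing times A halves centred functions, S inherits this, and S A
    contracts them by 1/4.\<close>
  define k where "k = 3 * tm"
  define A where "A = kernel_op K ^^ k"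
  define S where "S = adjoint_op Q (kernel_op K) ^^ k"
  interpret adjoint_pair Q A S unfolding A_def S_def by (rule adjoint_pair_pow)
  let ?E = "expect Q"
  have Ax: "A f x = expect (kernel_pow K k x) f" if "f \<in> L2 Q" "x \<in> set_pmf Q" for f x
    unfolding A_def using that by (rule kernel_op_funpow)
  have contr: "L2_norm Q (\<lambda>x. A f x - ?E f) \<le> 1/2 * L2_norm Q f" if f: "f \<in> L2 Q" for f
  proof -
    have "L2_norm Q (\<lambda>x. A f x - ?E f) = L2_norm Q (\<lambda>x. expect (kernel_pow K k x) f - ?E f)"
      by (rule L2_norm_cong) (simp add: Ax[OF f])
    also have "\<dots> \<le> 1/2 * L2_norm Q f"
      using kernel_pow_contraction(2)[OF L2D[OF f]] L2_norm_nonneg[of Q f]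
      by (subst L2_norm_le_iff) (auto simp: k_def power_mult_distrib L2_norm_power2 power2_eq_square[of "1/2::real"] power_divide)
    finally show ?thesis .
  qed
  have AE1: "A (\<lambda>_. c) x = c" if "x \<in> set_pmf Q" for c x using Ax[OF _ that, of "\<lambda>_. c"] by simp
  have meanA: "?E (A f) = ?E f" if f: "f \<in> L2 Q" for f
  proof -
    have "?E (A f) = ?E (\<lambda>x. expect (kernel_pow K k x) f)"
      by (rule expectation_pmf_cong) (simp add: Ax[OF f])
    also have "\<dots> = ?E f"
      using complex_expectation_bind_pmf[of Q "kernel_pow K k" f] L2_integrable[OF f] by (simp add: invariant_pow)
    finally show ?thesis .
  qed
  have inner1: "L2_inner Q f (\<lambda>_. 1) = ?E f" for f by (simp add: L2_inner_def)
  have inner1': "L2_inner Q (\<lambda>_. 1) f = cnj (?E f)" for f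
    unfolding L2_inner_def by (simp add: Bochner_Integration.integral_cnj)
  have meanS: "?E (S f) = ?E f" if f: "f \<in> L2 Q" for f
  proof -
    have "cnj (?E (S f)) = L2_inner Q (A (\<lambda>_. 1)) f"
      unfolding inner1'[symmetric] by (rule adj[symmetric]) (use f in auto)
    also have "\<dots> = L2_inner Q (\<lambda>_. 1) f"
      unfolding L2_inner_def by (rule expectation_pmf_cong) (simp add: AE1)
    finally show ?thesis by (simp add: inner1')
  qed
  have S1: "S (\<lambda>_. 1) x = 1" if x: "x \<in> set_pmf Q" for x
  proof -
    \<comment> \<open>h = S 1 - 1 is orthogonal to itself: (h, S 1) = (A h, 1) = (h, 1), since A
      preserves means.\<close>
    let ?h = "\<lambda>x. S (\<lambda>_. 1) x - 1"
    have SL: "S (\<lambda>_. 1) \<in> L2 Q" by (rule bounded_op_closed[OF S]) simp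
    have h: "?h \<in> L2 Q" by (rule L2_diff[OF SL L2_const])
    have "L2_inner Q ?h ?h = L2_inner Q ?h (S (\<lambda>_. 1)) - L2_inner Q ?h (\<lambda>_. 1)"
      unfolding L2_inner_def using L2_product_integrable(2)[OF h SL] L2_product_integrable(2)[OF h, of "\<lambda>_. 1"]
      by (subst Bochner_Integration.integral_diff[symmetric]) (auto simp: algebra_simps)
    also have "L2_inner Q ?h (S (\<lambda>_. 1)) = L2_inner Q (A ?h) (\<lambda>_. 1)" by (rule adj[symmetric]) (use h in auto)
    also have "\<dots> = L2_inner Q ?h (\<lambda>_. 1)" unfolding inner1 by (rule meanA[OF h])
    finally have "L2_norm Q ?h = 0" by (simp add: L2_inner_self)
    then have "?h x = 0" by (rule L2_norm_eq_0D[OF h _ x])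
    then show ?thesis by simp
  qed
  have "spectral_gap Q (S \<circ> A) \<ge> 3/4"
  proof (rule spectral_gap_ge[OF bounded_op_comp[OF S A]])
    show "?E ((S \<circ> A) f) = ?E f" if f: "f \<in> L2 Q" for f
      using meanS[OF bounded_op_closed[OF A f]] meanA[OF f] by simp
    show "(S \<circ> A) (\<lambda>_. 1) x = 1" if x: "x \<in> set_pmf Q" for x
    proof -
      have "S (A (\<lambda>_. 1)) x = S (\<lambda>_. 1) x"
        by (rule bounded_op_cong[OF S bounded_op_closed[OF A L2_const] AE1 x])
      then show ?thesis using S1[OF x] by simp
    qed
    show "L2_norm Q (\<lambda>x. (S \<circ> A) f x - ?E f) \<le> 1/4 * L2_norm Q f" if f: "f \<in> L2 Q" for f
    proof -
      have Af: "A f \<in> L2 Q" by (rule bounded_op_closed[OF A f])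
      let ?h = "\<lambda>x. A f x - ?E f"
      have h: "?h \<in> L2 Q" by (rule L2_diff[OF Af L2_const])
      have Sh: "S ?h x = (S \<circ> A) f x - ?E f" if x: "x \<in> set_pmf Q" for x
      proof -
        have "S (\<lambda>x. 1 * A f x + (- ?E f) * 1) x = 1 * S (A f) x + (- ?E f) * S (\<lambda>_. 1) x"
          by (rule bounded_op_lin[OF S Af _ x]) simp
        then show ?thesis using S1[OF x] by simp
      qed
      have Eh: "?E ?h = 0" using meanA[OF f] L2_integrable[OF Af] by simp
      have ESh: "?E (S ?h) = 0" using meanS[OF h] Eh by simp
      have "L2_norm Q (A (S ?h)) \<le> 1/2 * L2_norm Q (S ?h)"
        using contr[OF bounded_op_closed[OF S h]] unfolding ESh by simp
      then have "L2_norm Q (S ?h) \<le> 1/2 * L2_norm Q ?h" by (intro S_le_gen[OF h]) simp_all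
      also have "\<dots> \<le> 1/2 * (1/2 * L2_norm Q f)" using contr[OF f] by (intro mult_left_mono) auto
      finally show ?thesis using L2_norm_cong[of Q "S ?h" "\<lambda>x. (S \<circ> A) f x - ?E f"] Sh by simp
    qed
  qed
  moreover have k: "k \<in> {1..}" "0 < real k" using tm_pos by (auto simp: k_def)
  ultimately have "0 < ?g k" unfolding A_def S_def by simp
  also have "?g k \<le> pseudo_spectral_gap K Q"
    unfolding pseudo_spectral_gap_def using k le1 by (intro cSUP_upper bdd_aboveI2[where M = 1]) auto
  finally show "0 < pseudo_spectral_gap K Q" .
qed

end


section \<open>Variance of loss differences\<close>

text \<open>If no atom of A reaches 3/20, mass is collected along an enumeration until it reaches
  3/20; the last point adds less than 3/20, so the collected mass stays below 3/10. An atom between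
  3/20 and 7/10 is itself a suitable B, as 17/20 - 7/10 = 3/20. The interval is symmetric about 1/2
  because t(1 - t) has to be bounded below on it.\<close>

lemma prob_split_or_atom:
  fixes R :: "'a::countable pmf"
  assumes A: "pr R A > 17/20"
  obtains (split) B where "B \<subseteq> A" "pr R B \<in> {3/20..17/20}"
      "pr R (A - B) \<in> {3/20..17/20}"
    | (atom) a where "a \<in> A" "pmf R a > 7/10"
proof (cases "\<exists>a\<in>A. pmf R a \<ge> 3/20")
  case True
  then obtain a where a: "a \<in> A" "pmf R a \<ge> 3/20" by blast
  show ?thesis
  proof (cases "pmf R a > 7/10")
    case True
    then show ?thesis using a(1) by (rule atom[rotated])
  next
    case False
    have d: "pr R (A - {a}) = pr R A - pmf R a"
      using a(1) by (subst measure_pmf.finite_measure_Diff) (auto simp: measure_pmf_single)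
    have "pr R (A - {a}) \<le> 17/20"
      using d a(2) measure_pmf.prob_le_1[of R A] by linarith
    then show ?thesis
      by (intro split[of "{a}"]) (use a False A d in \<open>auto simp: measure_pmf_single\<close>)
  qed
next
  case False
  define B where "B n = {a\<in>A. to_nat a < n}" for n :: nat
  have "(\<lambda>n. pr R (B n)) \<longlonglongrightarrow> pr R (\<Union>n. B n)"
    by (intro measure_pmf.finite_Lim_measure_incseq) (auto simp: B_def incseq_def)
  also have "(\<Union>n. B n) = A" by (auto simp: B_def)
  finally have "\<forall>\<^sub>F n in sequentially. pr R (B n) > 3/20"
    using A by (intro order_tendstoD(1)) auto
  then obtain n0 where "pr R (B n0) \<ge> 3/20"
    by (auto dest!: eventually_happens intro: less_imp_le)
  define n where "n = (LEAST n. pr R (B n) \<ge> 3/20)"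
  have n: "pr R (B n) \<ge> 3/20"
    unfolding n_def by (rule LeastI) fact
  have "n \<noteq> 0"
  proof
    assume "n = 0"
    with n show False by (simp add: B_def)
  qed
  then obtain k where k: "n = Suc k" by (cases n) auto
  have "\<not> pr R (B k) \<ge> 3/20"
    using not_less_Least[of k "\<lambda>n. pr R (B n) \<ge> 3/20"] k by (simp add: n_def)
  moreover have "pr R (B n) \<le> pr R (B k) + 3/20"
  proof (cases "\<exists>a\<in>A. to_nat a = k")
    case True
    then obtain a where a: "a \<in> A" "to_nat a = k" by blast
    have "B n \<subseteq> insert a (B k)"
      using a by (auto simp: B_def k less_Suc_eq)
    then have "pr R (B n) \<le> pr R (insert a (B k))"
      by (intro measure_pmf.finite_measure_mono) auto
    also have "\<dots> \<le> pr R {a} + pr R (B k)"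
      using measure_Un_le[of "{a}" R "B k"] by simp
    finally show ?thesis using False a(1) by (force simp: measure_pmf_single)
  next
    case False
    then have "B n = B k" by (auto simp: B_def k less_Suc_eq)
    then show ?thesis by simp
  qed
  ultimately have n2: "pr R (B n) < 3/10" by simp
  have d: "pr R (A - B n) = pr R A - pr R (B n)"
    by (subst measure_pmf.finite_measure_Diff) (auto simp: B_def)
  have "pr R (A - B n) \<le> 17/20"
    using d n measure_pmf.prob_le_1[of R A] by linarith
  then show ?thesis
    by (intro split[of "B n"]) (use n n2 d A in \<open>auto simp: B_def\<close>)
qed

section \<open>Excess risk localised to sets of tails\<close>

locale noisy_prediction =
  fixes Q :: "'y::countable list pmf" and p m :: nat and gs :: "'y list \<Rightarrow> 'y"
    and w :: "real \<Rightarrow> real" and \<tau> :: real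
  assumes support: "set_pmf Q \<subseteq> states p" and p_pos: "1 \<le> p"
    and shift: "map_pmf tl Q = map_pmf (take p) Q"
    and optimal: "is_arg_min (risk misclassification Q) (\<lambda>g. g \<in> prediction_functions p) gs"
    and noise: "noise_assumption misclassification p Q gs w"
    and tau: "smallest_positive_solution w m \<tau>"
begin

abbreviation "loss \<equiv> point_loss misclassification"
abbreviation "E \<equiv> expect Q"
abbreviation "preds \<equiv> prediction_functions p"

definition tail_prob :: "'y list set \<Rightarrow> real" where
  "tail_prob B = pr Q {x. tl x \<in> B}"

definition excess_on :: "('y list \<Rightarrow> 'y) \<Rightarrow> 'y list set \<Rightarrow> real" where
  "excess_on g B = E (\<lambda>x. indicator B (tl x) * (loss g x - loss gs x))"

lemma loss_bounds: "0 \<le> loss g x" "loss g x \<le> 1"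
  by (auto simp: point_loss_def misclassification_def)

lemma integrable_loss: "integrable Q (loss g)"
  by (intro integrable_pmf_bounded[where B = 1]) (simp add: loss_bounds)

lemma integrable_indicator_loss: "integrable Q (\<lambda>x. indicator B (tl x) * (loss g x - loss h x))"
  by (intro integrable_pmf_bounded[where B = 1])
    (auto simp: indicator_def point_loss_def misclassification_def)

lemma excess_on_UNIV: "excess_on g UNIV = risk misclassification Q g - risk misclassification Q gs"
  by (simp add: excess_on_def risk_def integrable_loss)

lemma excess_on_Un:
  assumes "B \<inter> C = {}"
  shows "excess_on g (B \<union> C) = excess_on g B + excess_on g C"
proof -
  have "excess_on g (B \<union> C) = E (\<lambda>x. indicator B (tl x) * (loss g x - loss gs x) + indicator C (tl x) * (loss g x - loss gs x))"
    unfolding excess_on_def using assms by (intro Bochner_Integration.integral_cong) (auto simp: indicator_def)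
  then show ?thesis by (simp add: excess_on_def integrable_indicator_loss)
qed

lemma excess_on_cong: "(\<And>z. z \<in> B \<Longrightarrow> g z = h z) \<Longrightarrow> excess_on g B = excess_on h B"
  unfolding excess_on_def by (intro Bochner_Integration.integral_cong) (auto simp: indicator_def point_loss_def)

lemma excess_on_le: "excess_on g B \<le> tail_prob B"
proof -
  have "excess_on g B \<le> E (indicator {x. tl x \<in> B})"
    unfolding excess_on_def
    by (intro expectation_pmf_mono integrable_indicator_loss integrable_pmf_bounded[where B = 1])
      (auto simp: indicator_def point_loss_def misclassification_def)
  then show ?thesis by (simp add: tail_prob_def)
qed

text \<open>Its excess risk is \<open>excess_on g B\<close>. Optimality of gs and the noise
  assumption thereby become statements about arbitrary sets of tails.\<close>

definition hybrid :: "('y list \<Rightarrow> 'y) \<Rightarrow> 'y list set \<Rightarrow> 'y list \<Rightarrow> 'y" where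
  "hybrid g B z = (if z \<in> B then g z else gs z)"

lemma gs_preds: "gs \<in> preds" and gs_min: "h \<in> preds \<Longrightarrow> risk misclassification Q gs \<le> risk misclassification Q h"
  using optimal by (auto simp: is_arg_min_def not_less)

lemma hybrid_preds: "g \<in> preds \<Longrightarrow> hybrid g B \<in> preds"
  using gs_preds by (auto simp: prediction_functions_def hybrid_def PiE_def extensional_def)

lemma excess_hybrid: "excess_on (hybrid g B) UNIV = excess_on g B"
  unfolding excess_on_def
  by (intro Bochner_Integration.integral_cong) (auto simp: indicator_def point_loss_def hybrid_def)

lemma excess_on_nonneg: "g \<in> preds \<Longrightarrow> 0 \<le> excess_on g B"
  using gs_min[OF hybrid_preds] excess_on_UNIV[of "hybrid g B"] excess_hybrid[of g B] by simp

lemma excess_on_mono: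
  assumes "g \<in> preds" "B \<subseteq> C" shows "excess_on g B \<le> excess_on g C"
  using excess_on_Un[of B "C - B" g] excess_on_nonneg[OF assms(1), of "C - B"] assms(2)
  by (simp add: Un_absorb1)

lemma tau_pos: "0 < \<tau>"
  using tau by (simp add: smallest_positive_solution_def)

text \<open>Monotonicity of \<open>\<omega>(x)/\<surd>x\<close> between \<open>\<tau>\<close> and the excess risk.\<close>

lemma noise_bound:
  assumes g: "g \<in> preds" and B: "\<And>z. z \<in> B \<Longrightarrow> g z \<noteq> gs z" and e: "\<tau> \<le> excess_on g B"
  shows "tail_prob B * (1 - tail_prob B) \<le> real m * \<tau> * excess_on g B"
proof -
  let ?e = "excess_on g B" and ?I = "\<lambda>x. of_bool (hybrid g B (tl x) \<noteq> gs (tl x)) :: real"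
  \<comment> \<open>As g differs from gs everywhere on B, the hybrid differs from gs exactly there,
    and the indicator in the noise assumption is Bernoulli with parameter
    \<open>tail_prob B\<close>.\<close>
  have I: "?I = indicator {x. tl x \<in> B}"
    using B by (auto simp: hybrid_def indicator_def fun_eq_iff)
  have var: "measure_pmf.variance Q ?I = tail_prob B * (1 - tail_prob B)"
  proof -
    have int: "integrable Q ?I" "integrable Q (\<lambda>x. (?I x)\<^sup>2)"
      by (auto intro!: integrable_pmf_bounded[where B = 1])
    have sq: "(\<lambda>x. (?I x)\<^sup>2) = ?I" by (auto simp: fun_eq_iff)
    have EI: "E ?I = tail_prob B" unfolding I by (simp add: tail_prob_def)
    show ?thesis
      unfolding measure_pmf.variance_eq[OF int] unfolding sq EI by (simp add: power2_eq_square algebra_simps)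
  qed
  have "sqrt (tail_prob B * (1 - tail_prob B)) \<le> w (risk misclassification Q (hybrid g B) - risk misclassification Q gs)"
    using noise hybrid_preds[OF g] unfolding noise_assumption_def var[symmetric] by blast
  then have w: "sqrt (tail_prob B * (1 - tail_prob B)) \<le> w ?e"
    unfolding excess_on_UNIV[symmetric] excess_hybrid .
  have e0: "0 < ?e" using tau_pos e by linarith
  have mono: "antimono_on {0<..} (\<lambda>x. w x / sqrt x)" and wt: "w \<tau> = sqrt (real m) * \<tau>"
    using noise tau by (auto simp: noise_assumption_def smallest_positive_solution_def)
  have "w ?e / sqrt ?e \<le> w \<tau> / sqrt \<tau>"
    by (rule monotone_onD[OF mono, of \<tau> ?e]) (use tau_pos e0 e in auto)
  also have "\<dots> = sqrt (real m * \<tau>)"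
    unfolding wt using tau_pos by (simp add: real_sqrt_mult real_div_sqrt flip: times_divide_eq_right)
  finally have "w ?e \<le> sqrt (real m * \<tau>) * sqrt ?e" using e0 by (simp add: pos_divide_le_eq)
  then have "w ?e \<le> sqrt (real m * \<tau> * ?e)" by (simp add: real_sqrt_mult)
  with w show ?thesis using order_trans real_sqrt_le_iff by blast
qed

lemma tail_prob_eq: "tail_prob B = pr (map_pmf tl Q) B"
  by (simp add: tail_prob_def vimage_def)

lemma tail_prob_singleton: "tail_prob {a} = pmf (map_pmf tl Q) a"
  unfolding tail_prob_eq by (rule measure_pmf_single)

lemma tail_prob_le_1: "tail_prob B \<le> 1" and tail_prob_nonneg: "0 \<le> tail_prob B"
  by (simp_all add: tail_prob_def)

text \<open>By stationarity a tail \<open>a\<close> of large probability is continued by its own first value, so that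
  a prediction at \<open>a\<close> different from the optimal one is costly.\<close>

lemma atom_cost:
  assumes g: "g \<in> preds" and ga: "g a \<noteq> gs a" and a: "tail_prob {a} > 7/10"
  shows "1 - 3 * (1 - tail_prob {a}) \<le> excess_on g {a}"
    and "pr Q {x. hd x \<noteq> gs a} \<le> 1 - tail_prob {a}"
proof -
  let ?P = "pr Q"
  define q where "q c = ?P {x. tl x = a \<and> hd x = c}" for c
  have "?P {x. tl x = a} > 0" using a by (simp add: tail_prob_def)
  then obtain x0 where "x0 \<in> set_pmf Q" "tl x0 = a"
    using measure_pmf_zero_iff[of Q "{x. tl x = a}"] by auto
  then have la: "length a = p" using support by (auto simp: states_def)
  have take: "?P {x. take p x = a} = tail_prob {a}"
  proof -
    have "?P {x. take p x = a} = pr (map_pmf (take p) Q) {a}" by (simp add: vimage_def)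
    then show ?thesis unfolding shift[symmetric] tail_prob_eq .
  qed
  \<comment> \<open>By \<open>shift\<close>, the p most recent values form the block a with
    probability \<open>tail_prob {a}\<close>, and then the value to be predicted is the head of
    a.\<close>
  have hd_le: "?P {x. hd x \<noteq> hd a} \<le> 1 - tail_prob {a}"
  proof -
    have "hd x = hd a" if "take p x = a" for x
      using hd_take[of p x] that p_pos by simp
    then have "{x. hd x \<noteq> hd a} \<subseteq> - {x. take p x = a}" by blast
    then have "?P {x. hd x \<noteq> hd a} \<le> ?P (- {x. take p x = a})"
      by (intro measure_pmf.finite_measure_mono) auto
    also have "\<dots> = 1 - tail_prob {a}"
      using measure_pmf.prob_compl[of "{x. take p x = a}" Q] take by (simp add: Compl_eq_Diff_UNIV)
    finally show ?thesis .
  qed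
  have q_other: "q c \<le> 1 - tail_prob {a}" if "c \<noteq> hd a" for c
    unfolding q_def using that by (intro order_trans[OF measure_pmf.finite_measure_mono hd_le]) auto
  have q_hd: "q (hd a) \<ge> 1 - 2 * (1 - tail_prob {a})"
  proof -
    have "tail_prob {a} \<le> ?P ({x. tl x = a \<and> hd x = hd a} \<union> {x. hd x \<noteq> hd a})"
      unfolding tail_prob_def by (intro measure_pmf.finite_measure_mono) auto
    also have "\<dots> \<le> q (hd a) + ?P {x. hd x \<noteq> hd a}"
      unfolding q_def by (rule measure_Un_le) auto
    finally show ?thesis using hd_le by argo
  qed
  have ex: "excess_on h {a} = q (gs a) - q (h a)" for h
  proof -
    have "excess_on h {a} = E (\<lambda>x. indicator {x. tl x = a \<and> hd x = gs a} x - indicator {x. tl x = a \<and> hd x = h a} x)"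
      unfolding excess_on_def
      by (intro Bochner_Integration.integral_cong) (auto simp: indicator_def point_loss_def misclassification_def)
    also have "\<dots> = q (gs a) - q (h a)"
      unfolding q_def by (subst Bochner_Integration.integral_diff) (auto intro!: integrable_pmf_bounded[where B = 1] simp: indicator_def)
    finally show ?thesis .
  qed
  have "gs(a := hd a) \<in> preds"
    using gs_preds la by (auto simp: prediction_functions_def PiE_def extensional_def)
  then have "q (hd a) \<le> q (gs a)"
    using excess_on_nonneg[of "gs(a := hd a)" "{a}"] ex[of "gs(a := hd a)"] by simp
  \<comment> \<open>With u = 1 - \<open>tail_prob {a}\<close> < 3/10, every value other than
    \<open>hd a\<close> has q at most u < 1 - 2u, so an optimal predictor chooses
    \<open>hd a\<close>.\<close>
  then have gsa: "gs a = hd a" using q_other[of "gs a"] q_hd a by force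
  show "1 - 3 * (1 - tail_prob {a}) \<le> excess_on g {a}"
    using ex[of g] q_hd q_other[of "g a"] ga gsa by simp
  show "?P {x. hd x \<noteq> gs a} \<le> 1 - tail_prob {a}" using hd_le gsa by simp
qed

lemma loss_difference_variance:
  assumes g: "g \<in> preds" and h: "h \<in> preds"
  defines "f \<equiv> \<lambda>x. loss g x - loss h x"
  shows "E (\<lambda>x. (f x - E f)\<^sup>2) \<le> pr Q {x. f x \<noteq> 0}"
proof -
  have f: "\<bar>f x\<bar> \<le> 1" for x using loss_bounds[of g x] loss_bounds[of h x] by (auto simp: f_def)
  have int: "integrable Q f" "integrable Q (\<lambda>x. (f x)\<^sup>2)"
    using f by (auto intro!: integrable_pmf_bounded[where B = 1] simp: abs_square_le_1)
  have "E (\<lambda>x. (f x - E f)\<^sup>2) = E (\<lambda>x. (f x)\<^sup>2) - (E f)\<^sup>2"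
    using int by (rule measure_pmf.variance_eq)
  also have "\<dots> \<le> E (\<lambda>x. (f x)\<^sup>2)" by simp
  also have "\<dots> \<le> E (indicator {x. f x \<noteq> 0})"
    by (intro expectation_pmf_mono int integrable_pmf_bounded[where B = 1])
      (use f in \<open>auto simp: indicator_def abs_square_le_1\<close>)
  finally show ?thesis by simp
qed

text \<open>The noise assumption controls the variance of the indicator of \<open>g \<noteq> gs\<close> only, which is also
  small when \<open>g\<close> differs from \<open>gs\<close> almost surely.  It is therefore applied to hybrids agreeing
  with a competitor on a set of tails of intermediate probability; if there is no such set, the
  tails have a heavy atom and \<open>atom_cost\<close> applies.\<close>

lemma variance_or_gap:
  assumes g: "g \<in> preds" and h: "h \<in> preds"
    and less: "excess_on h UNIV < excess_on g UNIV"
    and tau1: "2 * \<tau> \<le> excess_on g UNIV" and tau2: "\<tau> \<le> 1/10"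
  defines "f \<equiv> \<lambda>x. loss g x - loss h x"
  obtains V where "E (\<lambda>x. (f x - E f)\<^sup>2) \<le> V" "V \<le> 1"
    "V \<le> 400/51 * (real m * \<tau> * (excess_on g UNIV + excess_on h UNIV)) \<or>
      2/5 \<le> excess_on g UNIV - excess_on h UNIV"
proof -
  note result = that
  let ?d = "excess_on g UNIV" and ?dh = "excess_on h UNIV"
  \<comment> \<open>Both predictors are merged into one that differs from gs wherever g or h does:
    the difference f of the losses vanishes for tails outside A, and the excess of k on A lies
    between that of g and the sum of the two.\<close>
  define k where "k z = (if g z \<noteq> gs z then g z else h z)" for z
  define A where "A = {z. k z \<noteq> gs z}"
  have k: "k \<in> preds"
    using g h by (auto simp: prediction_functions_def PiE_def extensional_def k_def)
  have var: "E (\<lambda>x. (f x - E f)\<^sup>2) \<le> pr Q {x. f x \<noteq> 0}"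
    unfolding f_def using g h by (rule loss_difference_variance)
  also have "\<dots> \<le> tail_prob A"
    unfolding tail_prob_def
    by (intro measure_pmf.finite_measure_mono) (auto simp: f_def A_def k_def point_loss_def)
  finally have varA: "E (\<lambda>x. (f x - E f)\<^sup>2) \<le> tail_prob A" .
  then have var1: "E (\<lambda>x. (f x - E f)\<^sup>2) \<le> 1" using tail_prob_le_1[of A] by linarith
  define D where "D = {z. g z \<noteq> gs z}"
  have D: "excess_on g D = ?d"
  proof -
    have "excess_on g (- D) = excess_on gs (- D)" by (rule excess_on_cong) (simp add: D_def)
    also have "\<dots> = 0" by (simp add: excess_on_def)
    finally show ?thesis using excess_on_Un[of D "- D" g] by simp
  qed
  have kD: "excess_on k D = ?d" unfolding D[symmetric] by (rule excess_on_cong) (simp add: D_def k_def)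
  have kAD: "excess_on k (A - D) \<le> ?dh"
  proof -
    have "excess_on k (A - D) = excess_on h (A - D)" by (rule excess_on_cong) (simp add: D_def k_def)
    also have "\<dots> \<le> ?dh" by (rule excess_on_mono[OF h]) simp
    finally show ?thesis .
  qed
  have DA: "D \<subseteq> A" by (auto simp: D_def A_def k_def)
  let ?e = "excess_on k A"
  have eA: "?d \<le> ?e" "?e \<le> ?d + ?dh"
    using excess_on_Un[of D "A - D" k] kD kAD excess_on_nonneg[OF k, of "A - D"] DA
    by (simp_all add: Un_absorb1)
  have mt: "0 \<le> real m * \<tau>" using tau_pos by simp
  have e_le: "real m * \<tau> * excess_on k B \<le> real m * \<tau> * (?d + ?dh)" if "B \<subseteq> A" for B
    using excess_on_mono[OF k that] eA(2) by (intro mult_left_mono mt) linarith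
  have noise_k: "tail_prob B * (1 - tail_prob B) \<le> real m * \<tau> * (?d + ?dh)"
    if "B \<subseteq> A" "\<tau> \<le> excess_on k B" for B
    using noise_bound[OF k _ that(2)] e_le[OF that(1)] that(1) by (force simp: A_def)
  \<comment> \<open>t(1 - t) is at least 51/400 on [3/20, 17/20], so the noise term is at least
    51/400 and the trivial V = 1 is admissible.\<close>
  have mid: thesis if B: "B \<subseteq> A" "\<tau> \<le> excess_on k B" "tail_prob B \<in> {3/20..17/20}" for B
  proof (rule result[OF var1 order_refl], rule disjI1)
    have "(tail_prob B - 3/20) * (17/20 - tail_prob B) \<ge> 0" using B(3) by (intro mult_nonneg_nonneg) auto
    then have "51/400 \<le> tail_prob B * (1 - tail_prob B)" by (simp add: algebra_simps)
    also note noise_k[OF B(1,2)]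
    finally show "1 \<le> 400/51 * (real m * \<tau> * (?d + ?dh))" by simp
  qed
  show thesis
  proof (cases "tail_prob A \<le> 17/20")
    case True
    show thesis
    proof (rule result[OF varA tail_prob_le_1], rule disjI1)
      have "tail_prob A * (3/20) \<le> tail_prob A * (1 - tail_prob A)"
        using True tail_prob_nonneg by (intro mult_left_mono) auto
      also have "\<dots> \<le> real m * \<tau> * (?d + ?dh)" using tau1 tau_pos eA by (intro noise_k) auto
      finally have "tail_prob A \<le> 20/3 * (real m * \<tau> * (?d + ?dh))" by simp
      also have "\<dots> \<le> 400/51 * (real m * \<tau> * (?d + ?dh))"
        using mt excess_on_nonneg[OF g, of UNIV] excess_on_nonneg[OF h, of UNIV]
        by (intro mult_right_mono mult_nonneg_nonneg[OF mt]) auto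
      finally show "tail_prob A \<le> 400/51 * (real m * \<tau> * (?d + ?dh))" .
    qed
  next
    case False
    then have "pr (map_pmf tl Q) A > 17/20" by (simp add: tail_prob_eq)
    then show thesis
    proof (cases rule: prob_split_or_atom)
      case (split B)
      have "excess_on k B + excess_on k (A - B) = ?e"
        using excess_on_Un[of B "A - B" k] split(1) by (simp add: Un_absorb1)
      \<comment> \<open>The excess of k on A is at least 2 \<tau>, so one of the two pieces carries
        \<tau>.\<close>
      then consider "\<tau> \<le> excess_on k B" | "\<tau> \<le> excess_on k (A - B)"
        using tau1 eA(1) by linarith
      then show thesis
        using split by cases (auto intro: mid[of B] mid[of "A - B"] simp del: atLeastAtMost_iff simp: tail_prob_eq)
    next
      case (atom a)
      let ?u = "1 - tail_prob {a}"
      have a: "tail_prob {a} > 7/10" using atom(2) by (simp add: tail_prob_singleton)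
      have aA: "{a} \<subseteq> A" using atom(1) by simp
      have ka: "k a \<noteq> gs a" using atom(1) by (simp add: A_def)
      \<comment> \<open>The cost of an atom above 7/10 exceeds 1 - 3 * 3/10 = 1/10; this is where
        \<tau> \<le> 1/10 enters.\<close>
      have ea: "\<tau> \<le> excess_on k {a}" using atom_cost(1)[OF k ka a] a tau2 by argo
      show thesis
      proof (cases "tail_prob {a} \<le> 17/20")
        case True
        then show thesis using a by (intro mid[OF aA ea]) auto
      next
        case False
        then have u: "?u < 3/20" by simp
        have other: "excess_on l UNIV \<le> ?u" if "l \<in> preds" "l a = gs a" for l
        proof -
          have "excess_on l {a} = excess_on gs {a}" by (rule excess_on_cong) (simp add: that)
          also have "\<dots> = 0" by (simp add: excess_on_def)
          finally have "excess_on l UNIV = excess_on l (- {a})" using excess_on_Un[of "{a}" "- {a}" l] by simp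
          also have "\<dots> \<le> tail_prob (- {a})" by (rule excess_on_le)
          also have "\<dots> = ?u"
            unfolding tail_prob_def using measure_pmf.prob_compl[of "{x. tl x = a}" Q]
            by (simp add: Compl_eq_Diff_UNIV set_diff_eq)
          finally show ?thesis .
        qed
        show thesis
        proof (cases "g a = gs a")
          case True
          \<comment> \<open>h errs at the atom and g does not, so h would be worse than g.\<close>
          then have ha: "h a \<noteq> gs a" using ka by (simp add: k_def)
          have "1 - 3 * ?u \<le> ?dh"
            using atom_cost(1)[OF h ha a] excess_on_mono[OF h, of "{a}" UNIV] by simp
          then have False using other[OF g True] less u by argo
          then show thesis ..
        next
          case ga: False
          have d: "1 - 3 * ?u \<le> ?d"
            using atom_cost(1)[OF g ga a] excess_on_mono[OF g, of "{a}" UNIV] by simp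
          show thesis
          proof (cases "h a = gs a")
            case True
            \<comment> \<open>g errs at the atom and h does not: the gap is at least 1 - 4u, which
              exceeds 2/5 for u < 3/20.\<close>
            show thesis
              by (rule result[OF var1 order_refl], rule disjI2) (use other[OF h True] d u in argo)
          next
            case ha: False
            \<comment> \<open>Both err at the atom: if the tail is a and the observed value is
              \<open>gs a\<close>, both lose 1 and f vanishes.\<close>
            have "pr Q {x. f x \<noteq> 0} \<le> pr Q ({x. tl x \<noteq> a} \<union> {x. hd x \<noteq> gs a})"
              using ga ha
              by (intro measure_pmf.finite_measure_mono) (auto simp: f_def point_loss_def misclassification_def)
            also have "\<dots> \<le> pr Q {x. tl x \<noteq> a} + pr Q {x. hd x \<noteq> gs a}"
              by (rule measure_Un_le) auto
            also have "pr Q {x. tl x \<noteq> a} = ?u"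
              unfolding tail_prob_def using measure_pmf.prob_compl[of "{x. tl x = a}" Q]
              by (simp add: set_diff_eq)
            also have "?u + pr Q {x. hd x \<noteq> gs a} \<le> 2 * ?u"
              using atom_cost(2)[OF g ga a] by simp
            finally have v: "E (\<lambda>x. (f x - E f)\<^sup>2) \<le> 2 * ?u" using var by linarith
            show thesis
            proof (rule result[OF v])
              show "2 * ?u \<le> 1" using u by simp
              have "?u * (17/20) \<le> ?u * tail_prob {a}"
                using u tail_prob_le_1[of "{a}"] by (intro mult_left_mono) auto
              also have "\<dots> \<le> real m * \<tau> * (?d + ?dh)" using noise_k[OF aA ea] by (simp add: mult.commute)
              finally have "2 * ?u \<le> 40/17 * (real m * \<tau> * (?d + ?dh))" by simp
              also have "\<dots> \<le> 400/51 * (real m * \<tau> * (?d + ?dh))"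
                using mt excess_on_nonneg[OF g, of UNIV] excess_on_nonneg[OF h, of UNIV]
                by (intro mult_right_mono mult_nonneg_nonneg[OF mt]) auto
              finally show "2 * ?u \<le> 400/51 * (real m * \<tau> * (?d + ?dh)) \<or> 2/5 \<le> ?d - ?dh" by simp
            qed
          qed
        qed
      qed
    qed
  qed
qed

end

text \<open>Bernstein's exponent against the required one, with M = m \<tau>. The first alternative
  for V needs 138/5 * 225/51 < 0.9801 * 128 in front of M, the second 138/5 * 5/2 + 216 * 0.99 <
  0.9801 * 320 in front of \<theta>.\<close>

lemma exponent_comparison:
  fixes d dt \<epsilon> \<theta> V M m :: real
  assumes th: "0 < \<theta>" "\<theta> < 1" and eps: "0 < \<epsilon>" and dt: "0 \<le> dt" and d: "(1 + \<theta>) * dt + \<epsilon> < d"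
    and V: "0 \<le> V" "V \<le> 1" "V \<le> 400/51 * (M * (d + dt)) \<or> 2/5 \<le> d - dt" and M: "0 \<le> M"
  shows "(138/5 * V + 216 * (99/100 * (d - dt))) * (\<theta> * \<epsilon>)
    \<le> (99/100 * (d - dt))\<^sup>2 * ((1 + \<theta>) * (128 * M + 320 * \<theta>))"
proof -
  define D where "D = d - dt"
  have De: "\<epsilon> \<le> D"
  proof -
    have "0 \<le> \<theta> * dt" using th dt by simp
    then show ?thesis using d by (simp add: D_def algebra_simps)
  qed
  have D0: "0 < D" using De eps by linarith
  have lin: "216 * (99/100 * D) * (\<theta> * \<epsilon>) \<le> 10692/50 * D\<^sup>2 * \<theta>"
  proof -
    have "D * \<epsilon> * \<theta> \<le> D * D * \<theta>" using De D0 th by (intro mult_right_mono mult_left_mono) auto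
    then show ?thesis by (simp add: power2_eq_square mult_ac)
  qed
  have D2: "0 \<le> D\<^sup>2 * \<theta>" "0 \<le> D\<^sup>2 * \<theta>\<^sup>2" "0 \<le> M * D\<^sup>2" "0 \<le> M * D\<^sup>2 * \<theta>" using th M by auto
  have rhs: "(99/100 * D)\<^sup>2 * ((1 + \<theta>) * (128 * M + 320 * \<theta>)) =
    9801/10000 * (128 * (M * D\<^sup>2) + 128 * (M * D\<^sup>2 * \<theta>) + 320 * (D\<^sup>2 * \<theta>) + 320 * (D\<^sup>2 * \<theta>\<^sup>2))"
    by (simp add: power2_eq_square algebra_simps)
  from V(3) have "(138/5 * V + 216 * (99/100 * D)) * (\<theta> * \<epsilon>) \<le> (99/100 * D)\<^sup>2 * ((1 + \<theta>) * (128 * M + 320 * \<theta>))"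
  proof
    assume V1: "V \<le> 400/51 * (M * (d + dt))"
    \<comment> \<open>\<open>(2 + \<theta>)(\<theta>d + \<epsilon>)\<close> squared exceeds \<open>8\<theta>(1 + \<theta>)\<epsilon>((2 + \<theta>)d - \<epsilon>)\<close> by
      \<open>(\<theta>(2 + \<theta>)d - (2 + 3\<theta>)\<epsilon>)\<^sup>2\<close>.\<close>
    have key: "8 * (\<theta> * \<epsilon>) * (d + dt) \<le> (2 + \<theta>)\<^sup>2 * D\<^sup>2"
    proof -
      \<comment> \<open>The hypothesis on d, expressed through D: (1 + \<theta>) D > \<theta> d +
        \<epsilon>.\<close>
      define u where "u = (1 + \<theta>) * D - (\<theta> * d + \<epsilon>)"
      have u: "0 \<le> u" using d by (simp add: u_def D_def algebra_simps)
      have a: "(1 + \<theta>) * (d + dt) \<le> (2 + \<theta>) * d - \<epsilon>" using d by (simp add: algebra_simps)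
      have dpos: "0 < d" using D0 dt by (simp add: D_def)
      have "8 * (\<theta> * \<epsilon>) * (d + dt) * (1 + \<theta>)\<^sup>2 = 8 * \<theta> * \<epsilon> * (1 + \<theta>) * ((1 + \<theta>) * (d + dt))"
        by (simp add: power2_eq_square algebra_simps)
      also have "\<dots> \<le> 8 * \<theta> * \<epsilon> * (1 + \<theta>) * ((2 + \<theta>) * d - \<epsilon>)"
        using a th eps by (intro mult_left_mono) auto
      also have "\<dots> \<le> (2 + \<theta>)\<^sup>2 * (\<theta> * d + \<epsilon>)\<^sup>2"
        using zero_le_power2[of "\<theta> * (2 + \<theta>) * d - (2 + 3 * \<theta>) * \<epsilon>"]
        by (simp add: power2_eq_square algebra_simps)
      also have "\<dots> \<le> (2 + \<theta>)\<^sup>2 * ((1 + \<theta>) * D)\<^sup>2"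
        using u th eps dpos by (intro mult_left_mono power_mono) (auto simp: u_def)
      finally have "8 * (\<theta> * \<epsilon>) * (d + dt) * (1 + \<theta>)\<^sup>2 \<le> ((2 + \<theta>)\<^sup>2 * D\<^sup>2) * (1 + \<theta>)\<^sup>2"
        by (simp add: power_mult_distrib mult_ac)
      then show ?thesis using th by (simp add: mult_le_cancel_right)
    qed
    have "(2 + \<theta>)\<^sup>2 \<le> 9/2 * (1 + \<theta>)"
    proof -
      have "(2 * \<theta> + 1) * (\<theta> - 1) \<le> 0" using th by (intro mult_nonneg_nonpos) auto
      then show ?thesis by (simp add: power2_eq_square algebra_simps)
    qed
    then have "(2 + \<theta>)\<^sup>2 * D\<^sup>2 \<le> 9/2 * (1 + \<theta>) * D\<^sup>2" by (rule mult_right_mono) simp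
    with key have "\<theta> * \<epsilon> * (d + dt) \<le> 9/16 * (1 + \<theta>) * D\<^sup>2" by linarith
    then have "M * (\<theta> * \<epsilon> * (d + dt)) \<le> M * (9/16 * (1 + \<theta>) * D\<^sup>2)" using M by (rule mult_left_mono)
    moreover have "V * (\<theta> * \<epsilon>) \<le> 400/51 * (M * (d + dt)) * (\<theta> * \<epsilon>)"
      using V1 th eps by (intro mult_right_mono) auto
    moreover have "400/51 * (M * (d + dt)) * (\<theta> * \<epsilon>) = 400/51 * (M * (\<theta> * \<epsilon> * (d + dt)))"
      by (simp add: algebra_simps)
    ultimately have "V * (\<theta> * \<epsilon>) \<le> 400/51 * (M * (9/16 * (1 + \<theta>) * D\<^sup>2))" by linarith
    then have Vb: "V * (\<theta> * \<epsilon>) \<le> 225/51 * (M * D\<^sup>2 + M * D\<^sup>2 * \<theta>)" by (simp add: algebra_simps)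
    have "(138/5 * V + 216 * (99/100 * D)) * (\<theta> * \<epsilon>) = 138/5 * (V * (\<theta> * \<epsilon>)) + 216 * (99/100 * D) * (\<theta> * \<epsilon>)"
      by (simp add: algebra_simps)
    then show ?thesis unfolding rhs using Vb lin D2 by argo
  next
    assume "2/5 \<le> d - dt"
    then have "2/5 \<le> D" by (simp add: D_def)
    have "V * (\<theta> * \<epsilon>) \<le> 1 * (\<theta> * D)" using V De th eps by (intro mult_mono) auto
    also have "\<dots> \<le> 5/2 * (D\<^sup>2 * \<theta>)"
    proof -
      have "1 * (D * \<theta>) \<le> (5/2 * D) * (D * \<theta>)" using \<open>2/5 \<le> D\<close> th D0 by (intro mult_right_mono) auto
      then show ?thesis by (simp add: power2_eq_square mult_ac)
    qed
    finally have Vb: "V * (\<theta> * \<epsilon>) \<le> 5/2 * (D\<^sup>2 * \<theta>)" .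
    have "(138/5 * V + 216 * (99/100 * D)) * (\<theta> * \<epsilon>) = 138/5 * (V * (\<theta> * \<epsilon>)) + 216 * (99/100 * D) * (\<theta> * \<epsilon>)"
      by (simp add: algebra_simps)
    then show ?thesis unfolding rhs using Vb lin D2 by argo
  qed
  then show ?thesis by (simp only: D_def)
qed


section \<open>Model selection\<close>

lemma le_step_sum:
  fixes u h :: real
  assumes "0 < h" "u \<le> real n * h"
  shows "u \<le> h * (\<Sum>i<n. of_bool (real i * h < u))"
  using assms(2)
proof (induction n)
  case (Suc n)
  show ?case
  proof (cases "u \<le> real n * h")
    case True
    then have "u \<le> h * (\<Sum>i<n. of_bool (real i * h < u))" by (rule Suc.IH)
    also have "\<dots> \<le> h * (\<Sum>i<Suc n. of_bool (real i * h < u))" using assms(1) by simp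
    finally show ?thesis .
  next
    case False
    have "of_bool (real i * h < u) = (1::real)" if "i < Suc n" for i
    proof -
      have "real i * h \<le> real n * h" using that assms(1) by (intro mult_right_mono) auto
      then show ?thesis using False by simp
    qed
    then have "(\<Sum>i<Suc n. of_bool (real i * h < u)) = (\<Sum>i<Suc n. 1::real)" by (intro sum.cong) auto
    then show ?thesis using Suc.prems by (simp add: mult.commute)
  qed
qed simp

text \<open>The tail integral is replaced by its upper Riemann sums of mesh \<open>h\<close>.\<close>

lemma expectation_le_of_exponential_tail:
  fixes U :: "'a \<Rightarrow> real"
  assumes int: "integrable (measure_pmf p) U" and U: "\<And>v. U v \<le> 1" and C: "1 \<le> C" and B: "0 < B"
    and tail: "\<And>\<epsilon>. 0 \<le> \<epsilon> \<Longrightarrow> \<epsilon> \<le> 1 \<Longrightarrow> pr p {v. U v > \<epsilon>} \<le> C * exp (- (\<epsilon> / B))"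
  shows "expect p U \<le> B * ln (exp 1 * C)"
proof -
  \<comment> \<open>At a the tail bound equals 1. Below a probabilities are estimated by 1, beyond
    it the exponential tail contributes B: in total B (ln C + 1).\<close>
  define a where "a = B * ln C"
  have a: "0 \<le> a" using B C by (simp add: a_def)
  have Ca: "C * exp (- (a / B)) = 1" using B C by (simp add: a_def exp_minus)
  have tail': "pr p {v. U v > \<epsilon>} \<le> C * exp (- (\<epsilon> / B))" if "0 \<le> \<epsilon>" for \<epsilon>
  proof (cases "\<epsilon> \<le> 1")
    case True
    then show ?thesis using tail that by blast
  next
    case False
    then have "\<not> U v > \<epsilon>" for v using U[of v] by linarith
    then show ?thesis using C by simp
  qed
  have "expect p U \<le> a + B + h" if h: "0 < h" for h
  proof -
    obtain n where n: "1 \<le> real n * h" using reals_Archimedean3[OF h, THEN spec, of 1] by (auto intro: less_imp_le)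
    let ?S = "\<lambda>v. a + h * (\<Sum>i<n. indicator {v. U v > a + real i * h} v)"
    have iS: "integrable p (\<lambda>v. indicator {v. U v > e} v :: real)" for e
      by (intro integrable_pmf_bounded[where B = 1]) (simp add: indicator_def)
    have "U v \<le> ?S v" for v
    proof -
      have "U v - a \<le> h * (\<Sum>i<n. of_bool (real i * h < U v - a))"
        using U[of v] a n by (intro le_step_sum h) linarith
      also have "(\<Sum>i<n. of_bool (real i * h < U v - a)) = (\<Sum>i<n. indicator {v. U v > a + real i * h} v :: real)"
        by (intro sum.cong) (auto simp: indicator_def)
      finally show ?thesis by simp
    qed
    then have "expect p U \<le> expect p ?S"
      using iS by (intro expectation_pmf_mono int) auto
    also have "\<dots> = a + h * (\<Sum>i<n. pr p {v. U v > a + real i * h})"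
      using iS by simp
    also have "\<dots> \<le> a + h * (\<Sum>i<n. exp (- (h / B)) ^ i)"
    proof -
      have "pr p {v. U v > a + real i * h} \<le> exp (- (h / B)) ^ i" for i
      proof -
        have "pr p {v. U v > a + real i * h} \<le> C * exp (- ((a + real i * h) / B))"
          using a h by (intro tail') simp
        also have "\<dots> = (C * exp (- (a / B))) * exp (real i * (- (h / B)))"
          by (simp add: mult.assoc exp_add[symmetric] add_divide_distrib)
        also have "\<dots> = exp (- (h / B)) ^ i" unfolding Ca exp_of_nat_mult by simp
        finally show ?thesis .
      qed
      then show ?thesis using h by (intro add_left_mono mult_left_mono sum_mono) auto
    qed
    also have "\<dots> \<le> a + h * (1 / (1 - exp (- (h / B))))"
    proof -
      have q: "exp (- (h / B)) < 1" using h B by simp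
      have "(\<Sum>i<n. exp (- (h / B)) ^ i) \<le> (\<Sum>i. exp (- (h / B)) ^ i)"
        using q by (intro sum_le_suminf summable_geometric) auto
      also have "\<dots> = 1 / (1 - exp (- (h / B)))" using q by (intro suminf_geometric) auto
      finally show ?thesis using h by (intro add_left_mono mult_left_mono) auto
    qed
    also have "h * (1 / (1 - exp (- (h / B)))) \<le> B + h"
    proof -
      \<comment> \<open>exp (-y) \<le> 1/(1 + y) bounds the geometric sum by h (1 + y)/y = B + h,
        and the mesh h is arbitrary.\<close>
      define y where "y = h / B"
      have y: "0 < y" using h B by (simp add: y_def)
      have "exp (- y) \<le> 1 / (1 + y)"
        using exp_ge_add_one_self[of y] y by (simp add: exp_minus divide_inverse le_imp_inverse_le)
      then have 1: "y / (1 + y) \<le> 1 - exp (- y)" using y by (simp add: field_simps)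
      have "h * (1 / (1 - exp (- y))) \<le> h * (1 / (y / (1 + y)))"
        using 1 y h by (intro mult_left_mono divide_left_mono mult_pos_pos) (auto intro: less_le_trans[of 0 "y / (1 + y)"])
      also have "\<dots> = B + h" using y B h by (simp add: y_def field_simps)
      finally show ?thesis by (simp add: y_def)
    qed
    finally show ?thesis by simp
  qed
  then have "expect p U \<le> a + B" by (rule field_le_epsilon)
  moreover have "ln (exp 1 * C) = 1 + ln C" using C by (subst ln_mult) auto
  ultimately show ?thesis by (simp add: a_def distrib_left)
qed

section \<open>The chain of windows as a stationary kernel\<close>

lemma measurable_window:
  assumes "\<And>t. Y t \<in> measurable M (count_space UNIV)"
  shows "(\<lambda>\<omega>. window r (\<lambda>s. Y s \<omega> :: 'y::countable) t) \<in> measurable M (count_space UNIV)"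
proof (induction r arbitrary: t)
  case (Suc r)
  note Suc[of "t - 1", measurable] assms[measurable]
  have "(\<lambda>\<omega>. Y t \<omega> # window r (\<lambda>s. Y s \<omega>) (t - 1)) \<in> measurable M (count_space UNIV)" by measurable
  then show ?case by (simp only: window_Suc[of r _ "t - 1", simplified])
qed (simp add: window_def)

lemma set_path_law:
  assumes "\<And>x. x \<in> S \<Longrightarrow> set_pmf (K x) \<subseteq> S" "x \<in> S" "v \<in> set_pmf (path_law K m x)"
  shows "set v \<subseteq> S"
  using assms(2,3)
proof (induction m arbitrary: x v)
  case (Suc m)
  then obtain x' v' where "x' \<in> set_pmf (K x)" "v' \<in> set_pmf (path_law K m x')" "v = x' # v'" by auto
  then show ?case using Suc.IH[of x' v'] Suc.prems(1) assms(1)[of x] by auto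
qed simp

text \<open>Q is invariant because a window of p + 1 values arises by one Markov step from a window
  of p \<ge> k0 values, with the transition of \<open>lift_kernel\<close>. The second identity is
  invariance seen through \<open>tl\<close>: a step of the lifted kernel from x has tail
  \<open>take p x\<close>.\<close>

lemma stationary_kernel_lift_kernel:
  fixes M :: "'w measure" and Y :: "int \<Rightarrow> 'w \<Rightarrow> 'y::countable"
  assumes p: "k0 \<le> p" and mc: "markov_chain M Y k0 P" and st: "stationary M Y"
    and Q: "measure_pmf Q = distr M (count_space UNIV) (\<lambda>\<omega>. window (Suc p) (\<lambda>s. Y s \<omega>) 0)"
  shows "stationary_kernel (states p) (lift_kernel k0 p P) Q"
    and "map_pmf tl Q = map_pmf (take p) Q"
proof -
  interpret prob_space M using mc by (simp add: markov_chain_def)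
  let ?K = "lift_kernel k0 p P"
  have [measurable]: "Y t \<in> measurable M (count_space UNIV)" for t using mc by (simp add: markov_chain_def)
  have W [measurable]: "(\<lambda>\<omega>. window r (\<lambda>s. Y s \<omega>) t) \<in> measurable M (count_space UNIV)" for r t
    by (rule measurable_window) measurable
  have probQ: "pr Q A = \<P>(\<omega> in M. window (Suc p) (\<lambda>s. Y s \<omega>) t \<in> A)" for A t
  proof -
    have "measure_pmf Q = distr M (count_space UNIV) (\<lambda>\<omega>. window (Suc p) (\<lambda>s. Y s \<omega>) t)"
      unfolding Q using st unfolding stationary_def by blast
    then have "pr Q A = measure (distr M (count_space UNIV) (\<lambda>\<omega>. window (Suc p) (\<lambda>s. Y s \<omega>) t)) A"
      by simp
    also have "\<dots> = measure M ((\<lambda>\<omega>. window (Suc p) (\<lambda>s. Y s \<omega>) t) -` A \<inter> space M)"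
      by (rule measure_distr) auto
    also have "(\<lambda>\<omega>. window (Suc p) (\<lambda>s. Y s \<omega>) t) -` A \<inter> space M = {\<omega>\<in>space M. window (Suc p) (\<lambda>s. Y s \<omega>) t \<in> A}"
      by auto
    finally show ?thesis .
  qed
  have "pr Q (states p) = 1"
    unfolding probQ[of _ 0] by (simp add: states_def window_def prob_space)
  then have supp: "set_pmf Q \<subseteq> states p"
    by (subst (asm) measure_pmf.prob_eq_1) (auto simp: AE_measure_pmf_iff)
  have pQ: "pmf Q (a # z) = pr Q {x. take p x = z} * pmf (P (take k0 z)) a" for a z
  proof -
    have "pmf Q (a # z) = \<P>(\<omega> in M. window (Suc p) (\<lambda>s. Y s \<omega>) (0 + 1) = a # z)"
      unfolding measure_pmf_single[symmetric] probQ[of _ "0 + 1"] by simp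
    also have "\<dots> = \<P>(\<omega> in M. window p (\<lambda>s. Y s \<omega>) 0 = z) * pmf (P (take k0 z)) a"
      by (rule markov_chain_step[OF mc p])
    also have "\<P>(\<omega> in M. window p (\<lambda>s. Y s \<omega>) 0 = z) = pr Q {x. take p x = z}"
      unfolding probQ[of _ 0] by (simp add: take_window)
    finally show ?thesis .
  qed
  have inv: "bind_pmf Q ?K = Q"
  proof (rule pmf_eqI)
    fix x'
    show "pmf (bind_pmf Q ?K) x' = pmf Q x'"
    proof (cases x')
      case Nil
      have "x' \<notin> set_pmf (bind_pmf Q ?K)" "x' \<notin> set_pmf Q"
        using Nil supp by (auto simp: lift_kernel_def states_def)
      then show ?thesis by (simp only: set_pmf_iff not_not)
    next
      case (Cons a z)
      have K: "pmf (?K x) (a # z) = indicator {x. take p x = z} x * pmf (P (take k0 z)) a" for x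
      proof (cases "take p x = z")
        case True
        then have "take k0 x = take k0 z" using p by (auto simp: min_def)
        have "pmf (?K x) (a # z) = pmf (map_pmf (\<lambda>a. a # z) (P (take k0 z))) (a # z)"
          using True \<open>take k0 x = take k0 z\<close> by (simp add: lift_kernel_def)
        also have "\<dots> = pmf (P (take k0 z)) a" by (subst pmf_map_inj') (auto simp: inj_def)
        finally show ?thesis using True by simp
      next
        case False
        then have "a # z \<notin> set_pmf (?K x)" by (auto simp: lift_kernel_def)
        then show ?thesis using False by (simp add: set_pmf_iff del: set_map_pmf)
      qed
      show ?thesis unfolding Cons pQ pmf_bind K by simp
    qed
  qed
  show "stationary_kernel (states p) ?K Q"
    using supp inv by unfold_locales (auto simp: lift_kernel_def states_def)
  have "map_pmf tl Q = map_pmf tl (bind_pmf Q ?K)" by (simp add: inv)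
  also have "\<dots> = bind_pmf Q (\<lambda>x. return_pmf (take p x))"
    unfolding map_bind_pmf lift_kernel_def map_pmf_comp by simp
  finally show "map_pmf tl Q = map_pmf (take p) Q" by (simp add: map_pmf_def)
qed

section \<open>Deviation of the selected predictor\<close>

locale model_selection =
  noisy_prediction Q p m gs w \<tau> + mixing_kernel "states p" K Q
  for Q :: "'y::countable list pmf" and p m :: nat and gs w \<tau> and K +
  fixes N :: nat and ghat :: "nat \<Rightarrow> 'y list \<Rightarrow> 'y" and kt :: nat and khat :: "'y list list \<Rightarrow> nat"
    and \<theta> :: real and x0 :: "'y list"
  assumes ghat: "\<And>k. k \<in> {1..N} \<Longrightarrow> ghat k \<in> prediction_functions p"
    and kt: "kt \<in> {1..N}" and m_pos: "1 \<le> m"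
    and khat: "\<And>v. length v = m \<Longrightarrow> set v \<subseteq> states p \<Longrightarrow>
      is_arg_min (\<lambda>k. validation_loss misclassification v (ghat k)) (\<lambda>k. k \<in> {1..N}) (khat v)"
    and theta: "0 < \<theta>" "\<theta> < 1" and x0: "x0 \<in> states p"
begin

abbreviation "excess g \<equiv> risk misclassification Q g - risk misclassification Q gs"

text \<open>The exponent of the statement at pseudo spectral gap 1: 128 = 4 * 16 * 2 and 320 = 4 *
  80.\<close>

definition "rate \<epsilon> = \<theta> * real m * \<epsilon> / (real tm * ((1 + \<theta>) * (128 * (real m * \<tau>) + 320 * \<theta>)))"

lemma excess_bounds: "excess g \<le> 1" "g \<in> preds \<Longrightarrow> 0 \<le> excess g"
proof -
  have "risk misclassification Q g \<le> E (\<lambda>_. 1)"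
    unfolding risk_def by (intro expectation_pmf_mono integrable_loss) (auto simp: loss_bounds)
  moreover have "0 \<le> risk misclassification Q gs"
    unfolding risk_def by (intro integral_nonneg_AE) (simp add: loss_bounds)
  ultimately show "excess g \<le> 1" by simp
  show "0 \<le> excess g" if "g \<in> preds" using gs_min[OF that] by simp
qed

text \<open>The noise term only enlarges the denominator. What remains without it is small enough to
  be paid by the burn-in.\<close>

lemma rate_le:
  assumes "0 \<le> \<epsilon>"
  shows "rate \<epsilon> \<le> real m * \<epsilon> / (320 * real tm)"
proof -
  have t: "0 < real tm" using tm_pos by simp
  have "rate \<epsilon> \<le> \<theta> * real m * \<epsilon> / (real tm * (320 * \<theta>))"
    unfolding rate_def
  proof (rule divide_left_mono)
    have "1 * (320 * \<theta>) \<le> (1 + \<theta>) * (128 * (real m * \<tau>) + 320 * \<theta>)"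
      using theta tau_pos by (intro mult_mono) auto
    then show "real tm * (320 * \<theta>) \<le> real tm * ((1 + \<theta>) * (128 * (real m * \<tau>) + 320 * \<theta>))"
      using t by simp
    show "0 \<le> \<theta> * real m * \<epsilon>" using theta assms by simp
    show "0 < real tm * ((1 + \<theta>) * (128 * (real m * \<tau>) + 320 * \<theta>)) * (real tm * (320 * \<theta>))"
      using t theta tau_pos by (intro mult_pos_pos add_pos_pos add_nonneg_pos) auto
  qed
  also have "\<dots> = real m * \<epsilon> / (320 * real tm)" using theta by (simp add: field_simps)
  finally show ?thesis .
qed

text \<open>\<theta> < 1 gives 1 + \<theta> > 2 \<theta>, whence 256 = 2 * 128. For \<epsilon> \<le>
  1 this places the relevant excess risks above 2 \<tau> and \<tau> below 1/10, as
  \<open>variance_or_gap\<close> requires.\<close>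

lemma rate_gt_1_imp:
  assumes "1 < rate \<epsilon>"
  shows "256 * \<tau> < \<epsilon>"
proof -
  have t: "1 \<le> real tm" using tm_pos by simp
  have mp: "0 < real m" using m_pos by simp
  have pos: "0 < real tm * ((1 + \<theta>) * (128 * (real m * \<tau>) + 320 * \<theta>))"
    using t theta tau_pos by (intro mult_pos_pos add_pos_pos add_nonneg_pos) auto
  have "1 * ((2 * \<theta>) * (128 * (real m * \<tau>))) \<le> real tm * ((1 + \<theta>) * (128 * (real m * \<tau>) + 320 * \<theta>))"
    using t theta tau_pos mp by (intro mult_mono mult_nonneg_nonneg add_nonneg_nonneg) auto
  also have "\<dots> < \<theta> * real m * \<epsilon>" using assms pos by (simp add: rate_def pos_less_divide_eq)
  finally have "(\<theta> * real m) * (256 * \<tau>) < (\<theta> * real m) * \<epsilon>" by (simp add: mult_ac)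
  then show ?thesis using theta mp by (simp add: mult_less_cancel_left_pos)
qed

text \<open>One fixed competitor, on the stationary path left after a burn-in. The factor 99/100 is
  the share of \<Delta> that survives the burn-in.\<close>

lemma competitor_deviation:
  assumes \<epsilon>: "0 < \<epsilon>" "\<epsilon> \<le> 1" "1 < rate \<epsilon>" and k: "k \<in> {1..N}"
    and ex: "excess (ghat k) - (1 + \<theta>) * excess (ghat kt) > \<epsilon>" and l: "l \<le> m"
  defines "f \<equiv> \<lambda>x. loss (ghat k) x - loss (ghat kt) x"
  defines "\<Delta> \<equiv> excess (ghat k) - excess (ghat kt)"
  shows "pr (bind_pmf Q (path_law K l)) {v. 99/100 * \<Delta> * real m \<le> (\<Sum>x\<leftarrow>v. \<Delta> - f x)}
    \<le> exp (- rate \<epsilon>)"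
proof -
  let ?d = "excess (ghat k)" and ?dt = "excess (ghat kt)"
  have g: "ghat k \<in> preds" "ghat kt \<in> preds" using ghat k kt by auto
  have tau: "256 * \<tau> < \<epsilon>" using \<epsilon>(3) by (rule rate_gt_1_imp)
  have dt: "0 \<le> ?dt" using excess_bounds(2)[OF g(2)] .
  then have thdt: "0 \<le> \<theta> * ?dt" using theta by simp
  have less: "?dt < ?d" and eps_d: "\<epsilon> < ?d" using ex \<epsilon>(1) thdt dt by (simp_all add: algebra_simps)
  have fb: "\<bar>f x\<bar> \<le> 1" for x by (simp add: f_def point_loss_def misclassification_def)
  have mean: "E f = \<Delta>"
    unfolding f_def \<Delta>_def risk_def using integrable_loss by simp
  obtain V where V: "E (\<lambda>x. (f x - E f)\<^sup>2) \<le> V" "V \<le> 1"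
    "V \<le> 400/51 * (real m * \<tau> * (?d + ?dt)) \<or> 2/5 \<le> ?d - ?dt"
  proof (rule variance_or_gap[OF g])
    show "excess_on (ghat kt) UNIV < excess_on (ghat k) UNIV" unfolding excess_on_UNIV by (rule less)
    show "2 * \<tau> \<le> excess_on (ghat k) UNIV" unfolding excess_on_UNIV using tau eps_d tau_pos by linarith
    show "\<tau> \<le> 1/10" using tau \<epsilon>(2) by simp
  qed (auto simp: f_def excess_on_UNIV)
  have V0: "0 \<le> V" using V(1) by (rule order_trans[rotated]) (auto intro: integral_nonneg_AE)
  have D: "0 < \<Delta>" using less by (simp add: \<Delta>_def)
  define D' where "D' = 99/100 * \<Delta>"
  have D': "0 < D'" using D by (simp add: D'_def)
  \<comment> \<open>Minimising -lam D' + 23/10 lam^2 V gives lam = D' / (23/5 V). The summand 36 D'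
    enforces lam \<le> 1/36, and at least half of the linear term remains, that is D'^2 /
    (2c).\<close>
  define c where "c = 23/5 * V + 36 * D'"
  have c: "0 < c" using V0 D' by (simp add: c_def add_nonneg_pos)
  define lam where "lam = D' / c"
  have lam: "0 \<le> lam" "lam \<le> 1/36" using D' c V0 by (simp_all add: lam_def c_def field_simps)
  have lc: "lam * c = D'" using c by (simp add: lam_def)
  have "23/10 * lam\<^sup>2 * V = lam / 2 * (lam * (23/5 * V))" by (simp add: power2_eq_square)
  also have "\<dots> \<le> lam / 2 * (lam * c)" using lam D' by (intro mult_left_mono) (auto simp: c_def)
  also have "\<dots> = lam * D' / 2" by (simp add: lc)
  finally have quad: "23/10 * lam\<^sup>2 * V \<le> lam * D' / 2" .
  have t: "0 < real tm" using tm_pos by simp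
  have mp: "0 < real m" using m_pos by simp
  have "pr (bind_pmf Q (path_law K l)) {v. 99/100 * \<Delta> * real m \<le> (\<Sum>x\<leftarrow>v. \<Delta> - f x)}
    \<le> exp ((- lam * (99/100 * \<Delta> * real m) + 23/10 * lam\<^sup>2 * V * real m) / real (3 * tm))"
    by (rule Bernstein[of f V lam l m "99/100 * \<Delta> * real m", unfolded mean,
          OF fb V(1)[unfolded mean] V(2) lam l])
  also have "\<dots> \<le> exp (- rate \<epsilon>)"
  proof -
    have "(- lam * (99/100 * \<Delta> * real m) + 23/10 * lam\<^sup>2 * V * real m) / real (3 * tm)
      = - ((lam * D' - 23/10 * lam\<^sup>2 * V) * real m / (3 * real tm))"
    proof -
      have "- lam * (99/100 * \<Delta> * real m) + 23/10 * lam\<^sup>2 * V * real m = - ((lam * D' - 23/10 * lam\<^sup>2 * V) * real m)"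
        by (simp add: D'_def algebra_simps)
      then show ?thesis by simp
    qed
    also have "\<dots> \<le> - ((lam * D' / 2) * real m / (3 * real tm))"
    proof -
      have "lam * D' / 2 \<le> lam * D' - 23/10 * lam\<^sup>2 * V" using quad by linarith
      then show ?thesis unfolding neg_le_iff_le by (intro divide_right_mono mult_right_mono) simp_all
    qed
    also have "(lam * D' / 2) * real m / (3 * real tm) = D'\<^sup>2 * real m / (real tm * (138/5 * V + 216 * D'))"
    proof -
      have "138/5 * V + 216 * D' = 6 * c" by (simp add: c_def)
      then show ?thesis using c t by (simp add: lam_def power2_eq_square field_simps)
    qed
    also have "- \<dots> \<le> - rate \<epsilon>"
    proof -
      have cmp: "(138/5 * V + 216 * D') * (\<theta> * \<epsilon>) \<le> D'\<^sup>2 * ((1 + \<theta>) * (128 * (real m * \<tau>) + 320 * \<theta>))"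
        unfolding D'_def \<Delta>_def
        by (rule exponent_comparison) (use theta \<epsilon>(1) dt ex V0 V(2,3) tau_pos in \<open>auto simp: mult.assoc\<close>)
      have p1: "0 < 138/5 * V + 216 * D'" using V0 D' by (simp add: add_nonneg_pos)
      have p2: "0 < (1 + \<theta>) * (128 * (real m * \<tau>) + 320 * \<theta>)"
        using theta tau_pos by (intro mult_pos_pos add_nonneg_pos) auto
      have "\<theta> * \<epsilon> / ((1 + \<theta>) * (128 * (real m * \<tau>) + 320 * \<theta>)) \<le> D'\<^sup>2 / (138/5 * V + 216 * D')"
        using cmp p1 p2 by (simp add: divide_le_eq pos_le_divide_eq mult.commute mult.left_commute)
      then have "(\<theta> * \<epsilon> / ((1 + \<theta>) * (128 * (real m * \<tau>) + 320 * \<theta>))) * (real m / real tm)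
        \<le> (D'\<^sup>2 / (138/5 * V + 216 * D')) * (real m / real tm)"
        using t mp by (intro mult_right_mono) auto
      moreover have "rate \<epsilon> = (\<theta> * \<epsilon> / ((1 + \<theta>) * (128 * (real m * \<tau>) + 320 * \<theta>))) * (real m / real tm)"
        by (simp add: rate_def mult_ac)
      ultimately show ?thesis by (simp add: mult_ac)
    qed
    finally show ?thesis by simp
  qed
  finally show ?thesis .
qed

lemma selected_excess_deviation:
  assumes \<epsilon>: "0 \<le> \<epsilon>" "\<epsilon> \<le> 1"
  shows "pr (path_law K m x0)
      {v. excess (ghat (khat v)) - (1 + \<theta>) * excess (ghat kt) > \<epsilon>}
    \<le> (real N + 2 * exp (ln 2 / real tm)) * exp (- rate \<epsilon>)"
proof (cases "rate \<epsilon> \<le> 1")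
  case True
  have "1 \<le> exp (1::real) * exp (- rate \<epsilon>)" using True by (simp add: exp_add[symmetric])
  also have "\<dots> \<le> 3 * exp (- rate \<epsilon>)" using exp_le by (intro mult_right_mono) auto
  also have "\<dots> \<le> (real N + 2 * exp (ln 2 / real tm)) * exp (- rate \<epsilon>)"
  proof (rule mult_right_mono)
    have "1 \<le> exp (ln 2 / real tm)" by simp
    moreover have "1 \<le> real N" using kt by simp
    ultimately show "3 \<le> real N + 2 * exp (ln 2 / real tm)" by linarith
  qed simp
  finally show ?thesis using measure_pmf.prob_le_1 order_trans by blast
next
  case False
  then have rate: "1 < rate \<epsilon>" by simp
  have eps: "0 < \<epsilon>" using rate_gt_1_imp[OF rate] tau_pos by linarith
  let ?PP = "path_law K m x0"
  define I where "I = {k\<in>{1..N}. excess (ghat k) - (1 + \<theta>) * excess (ghat kt) > \<epsilon>}"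
  define f where "f k x = loss (ghat k) x - loss (ghat kt) x" for k x
  define \<Delta> where "\<Delta> k = excess (ghat k) - excess (ghat kt)" for k
  \<comment> \<open>Skipping r entries changes the sum of f by at most r and its stationary mean by
    r \<Delta> \<le> r; 2r \<le> m \<epsilon>/100 \<le> m \<Delta>/100 is the hundredth missing in
    \<open>W\<close>.\<close>
  define r where "r = nat \<lfloor>real m * \<epsilon> / 200\<rfloor>"
  define W where "W k = {v. 99/100 * \<Delta> k * real m \<le> (\<Sum>x\<leftarrow>v. \<Delta> k - f k x)}" for k
  have x200: "0 \<le> real m * \<epsilon> / 200" using \<epsilon> by simp
  have r: "real r \<le> real m * \<epsilon> / 200" "real m * \<epsilon> / 200 < real (r + 1)"
    using x200 of_nat_floor[OF x200] floor_less_iff[of "real m * \<epsilon> / 200"] unfolding r_def by (simp_all, linarith)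
  have "real m * \<epsilon> \<le> real m" using \<epsilon> by (simp add: mult_left_le)
  then have rm: "r \<le> m" using r(1) by linarith
  define l where "l = m - r"
  have l: "l \<le> m" "m = r + l" using rm by (auto simp: l_def)
  have fb: "\<bar>f k x\<bar> \<le> 1" for k x by (simp add: f_def point_loss_def misclassification_def)
  have Sf: "(\<Sum>x\<leftarrow>v. - f k x) \<le> real (length v)" for v k
  proof (induction v)
    case (Cons x v)
    then show ?case using fb[of k x] by (simp add: abs_le_iff)
  qed simp
  have "pr ?PP {v. excess (ghat (khat v)) - (1 + \<theta>) * excess (ghat kt) > \<epsilon>}
    \<le> pr ?PP (drop r -` (\<Union>k\<in>I. W k))"
  proof (intro measure_pmf.finite_measure_mono_AE AE_pmfI impI)
    fix v assume v: "v \<in> set_pmf ?PP" and "v \<in> {v. excess (ghat (khat v)) - (1 + \<theta>) * excess (ghat kt) > \<epsilon>}"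
    then have ex: "excess (ghat (khat v)) - (1 + \<theta>) * excess (ghat kt) > \<epsilon>" by simp
    define k where "k = khat v"
    have len: "length v = m" using v by (rule length_path_law)
    have "set v \<subseteq> states p" using set_path_law[OF set_K x0 v] .
    from khat[OF len this]
    have k: "k \<in> {1..N}" and "validation_loss misclassification v (ghat k) \<le> validation_loss misclassification v (ghat kt)"
      using kt unfolding is_arg_min_def k_def by (auto simp: not_less)
    then have "(\<Sum>x\<leftarrow>v. loss (ghat k) x) \<le> (\<Sum>x\<leftarrow>v. loss (ghat kt) x)"
      using m_pos len by (simp add: validation_loss_def divide_le_cancel)
    then have "(\<Sum>x\<leftarrow>v. f k x) \<le> 0" unfolding f_def by (simp add: sum_list_subtractf)
    moreover have "(\<Sum>x\<leftarrow>v. f k x) = (\<Sum>x\<leftarrow>take r v. f k x) + (\<Sum>x\<leftarrow>drop r v. f k x)"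
      by (metis append_take_drop_id map_append sum_list_append)
    moreover have "(\<Sum>x\<leftarrow>take r v. - f k x) = - (\<Sum>x\<leftarrow>take r v. f k x)" by (simp add: uminus_sum_list_map comp_def)
    ultimately have "(\<Sum>x\<leftarrow>drop r v. f k x) \<le> real r"
      using Sf[of k "take r v"] len rm by simp
    moreover have "(\<Sum>x\<leftarrow>drop r v. \<Delta> k - f k x) = real l * \<Delta> k - (\<Sum>x\<leftarrow>drop r v. f k x)"
      using len by (simp add: sum_list_subtractf sum_list_triv l_def)
    moreover have "99/100 * \<Delta> k * real m \<le> real l * \<Delta> k - real r"
    proof -
      have dt: "0 \<le> excess (ghat kt)" using excess_bounds(2) ghat kt by blast
      then have "0 \<le> \<theta> * excess (ghat kt)" using theta by simp
      then have De: "\<epsilon> \<le> \<Delta> k" using ex by (simp add: \<Delta>_def k_def algebra_simps)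
      have D1: "\<Delta> k \<le> 1" using excess_bounds(1)[of "ghat k"] dt by (simp add: \<Delta>_def)
      have "real r * \<Delta> k \<le> real r" using D1 by (simp add: mult_left_le)
      moreover have "2 * real r \<le> \<Delta> k * real m / 100"
      proof -
        have "real m * \<epsilon> \<le> real m * \<Delta> k" using De by (rule mult_left_mono) simp
        then show ?thesis using r(1) by (simp add: mult.commute)
      qed
      moreover have "real l * \<Delta> k = real m * \<Delta> k - real r * \<Delta> k" using rm by (simp add: l_def of_nat_diff left_diff_distrib)
      ultimately show ?thesis by (simp add: mult.commute)
    qed
    ultimately have "drop r v \<in> W k" unfolding W_def by simp
    moreover have "k \<in> I" using k ex by (simp add: I_def k_def)
    ultimately show "v \<in> drop r -` (\<Union>k\<in>I. W k)" by blast
  qed simp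
  also have "\<dots> = pr (map_pmf (drop r) (path_law K (r + l) x0)) (\<Union>k\<in>I. W k)"
    by (simp add: l(2)[symmetric])
  also have "\<dots> = expect (kernel_pow K r x0) (\<lambda>x. pr (path_law K l x) (\<Union>k\<in>I. W k))"
    unfolding path_law_drop prob_bind_pmf ..
  \<comment> \<open>The start is replaced by Q once for the union of all events rather than for each
    competitor, so the mixing error adds to N instead of multiplying it.\<close>
  also have "\<dots> \<le> E (\<lambda>x. pr (path_law K l x) (\<Union>k\<in>I. W k)) + d_TV (kernel_pow K r x0) Q"
    using expectation_diff_le_d_TV[of "kernel_pow K r x0" Q 0 "\<lambda>x. pr (path_law K l x) (\<Union>k\<in>I. W k)" 1] by simp
  also have "E (\<lambda>x. pr (path_law K l x) (\<Union>k\<in>I. W k)) = pr (bind_pmf Q (path_law K l)) (\<Union>k\<in>I. W k)"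
    unfolding prob_bind_pmf ..
  also have "\<dots> \<le> (\<Sum>k\<in>I. pr (bind_pmf Q (path_law K l)) (W k))"
    by (rule measure_UNION_le) (auto simp: I_def)
  also have "\<dots> \<le> (\<Sum>k\<in>I. exp (- rate \<epsilon>))"
  proof (rule sum_mono)
    fix k assume k: "k \<in> I"
    show "pr (bind_pmf Q (path_law K l)) (W k) \<le> exp (- rate \<epsilon>)"
      unfolding W_def f_def \<Delta>_def
      by (rule competitor_deviation[OF eps \<epsilon>(2) rate _ _ l(1)]) (use k in \<open>auto simp: I_def\<close>)
  qed
  also have "\<dots> \<le> real N * exp (- rate \<epsilon>)"
  proof -
    have "card I \<le> card {1..N}" by (rule card_mono) (auto simp: I_def)
    then show ?thesis by simp
  qed
  also have "d_TV (kernel_pow K r x0) Q \<le> 2 * exp (ln 2 / real tm) * exp (- rate \<epsilon>)"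
  proof -
    have t: "0 < real tm" using tm_pos by simp
    have "d_TV (kernel_pow K r x0) Q \<le> 2 * exp (- (ln 2 * real (r + 1) / real tm))"
      using x0 by (rule d_TV_le_powr)
    also have "\<dots> \<le> 2 * exp (- rate \<epsilon>)"
    proof -
      have "rate \<epsilon> \<le> real m * \<epsilon> / (320 * real tm)" using \<epsilon>(1) by (rule rate_le)
      also have "\<dots> = (1/320 * (real m * \<epsilon>)) / real tm" by simp
      also have "\<dots> \<le> (ln 2 * real (r + 1)) / real tm"
      proof (rule divide_right_mono)
        \<comment> \<open>The length of the burn-in suffices because 1/320 \<le> (2/3)/200 and 2/3
          \<le> ln 2.\<close>
        have "2/3 * (real m * \<epsilon> / 200) \<le> ln 2 * real (r + 1)"
          using r(2) x200 ln2_ge_two_thirds by (intro mult_mono) auto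
        moreover have "0 \<le> real m * \<epsilon>" using \<epsilon> by simp
        ultimately show "1/320 * (real m * \<epsilon>) \<le> ln 2 * real (r + 1)" by argo
      qed (use t in simp)
      finally show ?thesis by simp
    qed
    also have "\<dots> \<le> 2 * exp (ln 2 / real tm) * exp (- rate \<epsilon>)" using t by (intro mult_right_mono) auto
    finally show ?thesis .
  qed
  finally show ?thesis by (simp add: distrib_right)
qed

end

text \<open>Replacing g by 1 increases the numerator and lowers 16 (1 + 1/g) to 32.\<close>

lemma gap_free_exponent_le:
  fixes \<theta> g m \<tau> t \<epsilon> :: real
  assumes "0 < \<theta>" "0 < g" "g \<le> 1" "0 < m" "0 < \<tau>" "1 \<le> t" "0 \<le> \<epsilon>"
  shows "1 / (4 * t * (1 + \<theta>)) * (\<theta> * g * m * \<epsilon> / (16 * (1 + 1 / g) * m * \<tau> + 80 * \<theta>))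
    \<le> \<theta> * m * \<epsilon> / (t * ((1 + \<theta>) * (128 * (m * \<tau>) + 320 * \<theta>)))"
proof -
  have A: "0 < 32 * (m * \<tau>) + 80 * \<theta>" using assms by (simp add: add_pos_pos)
  have "1 \<le> 1 / g" using assms by (simp add: le_divide_eq)
  then have "32 * (m * \<tau>) \<le> 16 * (1 + 1 / g) * (m * \<tau>)"
    using assms by (intro mult_right_mono mult_nonneg_nonneg) argo+
  then have le: "32 * (m * \<tau>) + 80 * \<theta> \<le> 16 * (1 + 1 / g) * m * \<tau> + 80 * \<theta>" by (simp add: mult.assoc)
  have "\<theta> * g * m * \<epsilon> / (16 * (1 + 1 / g) * m * \<tau> + 80 * \<theta>) \<le> \<theta> * m * \<epsilon> / (32 * (m * \<tau>) + 80 * \<theta>)"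
  proof (rule frac_le[OF _ _ A le])
    show "0 \<le> \<theta> * m * \<epsilon>" using assms by simp
    have "g * (\<theta> * m * \<epsilon>) \<le> 1 * (\<theta> * m * \<epsilon>)" using assms by (intro mult_right_mono) auto
    then show "\<theta> * g * m * \<epsilon> \<le> \<theta> * m * \<epsilon>" by (simp add: mult_ac)
  qed
  then have "1 / (4 * t * (1 + \<theta>)) * (\<theta> * g * m * \<epsilon> / (16 * (1 + 1 / g) * m * \<tau> + 80 * \<theta>))
    \<le> 1 / (4 * t * (1 + \<theta>)) * (\<theta> * m * \<epsilon> / (32 * (m * \<tau>) + 80 * \<theta>))"
    using assms by (intro mult_left_mono) auto
  also have "\<dots> = \<theta> * m * \<epsilon> / (t * ((1 + \<theta>) * (128 * (m * \<tau>) + 320 * \<theta>)))"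
  proof -
    have "128 * (m * \<tau>) + 320 * \<theta> = 4 * (32 * (m * \<tau>) + 80 * \<theta>)" by simp
    then show ?thesis by simp
  qed
  finally show ?thesis .
qed

theorem theorem5p1:
  fixes M :: "'w measure" and Y :: "int \<Rightarrow> 'w \<Rightarrow> 'y::countable"
    and P :: "'y list \<Rightarrow> 'y pmf" and Q :: "'y list pmf"
    and k0 p n m N :: nat
    and Ltilde :: "'y \<Rightarrow> 'y \<Rightarrow> real"
    and G :: "nat \<Rightarrow> ('y list \<Rightarrow> 'y) set" and gstar :: "'y list \<Rightarrow> 'y"
    and y :: "int \<Rightarrow> 'y" and ghat :: "nat \<Rightarrow> 'y list \<Rightarrow> 'y"
    and ktilde :: nat and khat :: "'y list list \<Rightarrow> nat"
    and w :: "real \<Rightarrow> real" and \<tau> \<theta> :: real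
  defines "K \<equiv> lift_kernel k0 p P"
    and "x \<equiv> \<lambda>t::nat. window (Suc p) y (int t)"
    and "L \<equiv> misclassification"
  defines "tmix \<equiv> real (mixing_time (states p) K Q)"
    and "\<gamma>ps \<equiv> pseudo_spectral_gap K Q"
    and "excess \<equiv> \<lambda>g. risk L Q g - risk L Q gstar"
    and "PP \<equiv> path_law K m (x n)"
  assumes "1 \<le> k0" and "k0 \<le> p"
    and "markov_chain M Y k0 P" and "stationary M Y"
    and "measure_pmf Q = distr M (count_space UNIV) (\<lambda>\<omega>. window (Suc p) (\<lambda>s. Y s \<omega>) 0)"
    and "uniformly_ergodic (states p) K Q"
    and "is_arg_min (risk L Q) (\<lambda>g. g \<in> prediction_functions p) gstar"
    and "noise_assumption L p Q gstar w"
    and "1 \<le> N" and "\<And>k. k \<in> {1..N} \<Longrightarrow> G k \<subseteq> prediction_functions p"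
    and "1 \<le> n"
    and "\<And>k. k \<in> {1..N} \<Longrightarrow>
           is_arg_min (\<lambda>g. \<Sum>t=1..n. point_loss Ltilde g (x t)) (\<lambda>g. g \<in> G k) (ghat k)"
    and "is_arg_min (\<lambda>k. risk L Q (ghat k)) (\<lambda>k. k \<in> {1..N}) ktilde"
    and "1 \<le> m"
    and "\<And>v. length v = m \<Longrightarrow> set v \<subseteq> states p \<Longrightarrow>
           is_arg_min (\<lambda>k. validation_loss L v (ghat k)) (\<lambda>k. k \<in> {1..N}) (khat v)"
    and "smallest_positive_solution w m \<tau>"
    and "0 < \<theta>" and "\<theta> < 1"
  shows "(\<forall>\<epsilon>. 0 \<le> \<epsilon> \<and> \<epsilon> \<le> 1 \<longrightarrow>
           measure_pmf.prob PP
             {v. excess (ghat (khat v)) - (1 + \<theta>) * excess (ghat ktilde) > \<epsilon>}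
           \<le> (real N + 2 * exp (ln 2 / tmix)) *
              exp (- (1 / (4 * tmix * (1 + \<theta>)) *
                (\<theta> * \<gamma>ps * real m * \<epsilon> / (16 * (1 + 1 / \<gamma>ps) * real m * \<tau> + 80 * \<theta>)))))
       \<and> measure_pmf.expectation PP (\<lambda>v. excess (ghat (khat v)))
           \<le> (1 + \<theta>) * (excess (ghat ktilde) +
              4 * tmix * (16 * (1 + 1 / \<gamma>ps) * real m * \<tau> + 80 * \<theta>) / (\<theta> * \<gamma>ps * real m) *
              ln (exp 1 * (2 * exp (ln 2 / tmix) + real N)))"
proof -
  have arg_min_ghat: "is_arg_min (\<lambda>g. \<Sum>t=1..n. point_loss Ltilde g (x t)) (\<lambda>g. g \<in> G k) (ghat k)"
    and G_sub: "G k \<subseteq> prediction_functions p" if "k \<in> {1..N}" for k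
    using that by fact+
  have arg_min_khat: "is_arg_min (\<lambda>k. validation_loss L v (ghat k)) (\<lambda>k. k \<in> {1..N}) (khat v)"
    if "length v = m" "set v \<subseteq> states p" for v
    using that by fact
  note chain = stationary_kernel_lift_kernel[OF \<open>k0 \<le> p\<close> \<open>markov_chain M Y k0 P\<close> \<open>stationary M Y\<close>
    \<open>measure_pmf Q = distr M (count_space UNIV) (\<lambda>\<omega>. window (Suc p) (\<lambda>s. Y s \<omega>) 0)\<close>]
  interpret stationary_kernel "states p" K Q unfolding K_def by (rule chain(1))
  interpret mixing_kernel "states p" K Q by unfold_locales fact
  interpret noisy_prediction Q p m gstar w \<tau>
  proof
    show "1 \<le> p" using \<open>1 \<le> k0\<close> \<open>k0 \<le> p\<close> by simp
    show "is_arg_min (risk misclassification Q) (\<lambda>g. g \<in> prediction_functions p) gstar"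
      "noise_assumption misclassification p Q gstar w"
      unfolding L_def[symmetric] by fact+
  qed (fact set_Q chain(2) \<open>smallest_positive_solution w m \<tau>\<close>)+
  have kt: "ktilde \<in> {1..N}"
    using \<open>is_arg_min (\<lambda>k. risk L Q (ghat k)) (\<lambda>k. k \<in> {1..N}) ktilde\<close> by (simp add: is_arg_min_def)
  interpret model_selection Q p m gstar w \<tau> K N ghat ktilde khat \<theta> "x n"
  proof
    show "ghat k \<in> prediction_functions p" if "k \<in> {1..N}" for k
      using arg_min_ghat[OF that] G_sub[OF that] by (auto simp: is_arg_min_def)
    show "is_arg_min (\<lambda>k. validation_loss misclassification v (ghat k)) (\<lambda>k. k \<in> {1..N}) (khat v)"
      if "length v = m" "set v \<subseteq> states p" for v
      using arg_min_khat[OF that] unfolding L_def .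
    show "x n \<in> states p" by (simp add: x_def states_def window_def)
  qed fact+
  have tmix: "tmix = real tm" by (simp add: tmix_def tm_def)
  have gp: "0 < \<gamma>ps" "\<gamma>ps \<le> 1" unfolding \<gamma>ps_def by (rule pseudo_spectral_gap_bounds)+
  let ?A = "16 * (1 + 1 / \<gamma>ps) * real m * \<tau> + 80 * \<theta>"
  let ?C = "real N + 2 * exp (ln 2 / tmix)"
  define U where "U v = excess (ghat (khat v)) - (1 + \<theta>) * excess (ghat ktilde)" for v
  have excess: "excess g = risk misclassification Q g - risk misclassification Q gstar" for g
    by (simp add: excess_def L_def)
  have mp: "0 < real m" using m_pos by simp
  have t1: "1 \<le> tmix" using tm_pos by (simp add: tmix)
  have A: "0 < ?A" using theta gp tau_pos mp by (intro add_nonneg_pos mult_nonneg_nonneg add_nonneg_nonneg) auto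
  have tail: "pr PP {v. U v > \<epsilon>}
      \<le> ?C * exp (- (1 / (4 * tmix * (1 + \<theta>)) * (\<theta> * \<gamma>ps * real m * \<epsilon> / ?A)))"
    if "0 \<le> \<epsilon>" "\<epsilon> \<le> 1" for \<epsilon>
  proof -
    have "pr PP {v. U v > \<epsilon>} \<le> ?C * exp (- rate \<epsilon>)"
      using selected_excess_deviation[OF that] by (simp only: U_def excess PP_def tmix)
    also have "\<dots> \<le> ?C * exp (- (1 / (4 * tmix * (1 + \<theta>)) * (\<theta> * \<gamma>ps * real m * \<epsilon> / ?A)))"
      using gap_free_exponent_le[of \<theta> \<gamma>ps "real m" \<tau> tmix \<epsilon>] theta gp mp tau_pos t1 that(1)
      by (intro mult_left_mono) (auto simp: rate_def tmix)
    finally show ?thesis .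
  qed
  have le1: "excess g \<le> 1" for g unfolding excess by (rule excess_bounds(1))
  have ext: "0 \<le> excess (ghat ktilde)" unfolding excess by (rule excess_bounds(2)[OF ghat[OF kt]])
  have U1: "U v \<le> 1" for v
  proof -
    have "0 \<le> (1 + \<theta>) * excess (ghat ktilde)" using theta ext by simp
    then show ?thesis using le1[of "ghat (khat v)"] by (simp add: U_def)
  qed
  have intZ: "integrable PP (\<lambda>v. excess (ghat (khat v)))"
  proof (rule integrable_pmf_bounded[where B = 1])
    \<comment> \<open>\<open>khat\<close> is specified on paths of length m in the state space only,
      so nonnegativity of the excess risk is argued on the support of the path law.\<close>
    fix v assume v: "v \<in> set_pmf PP"
    have "khat v \<in> {1..N}"
    proof -
      have "length v = m" using v unfolding PP_def by (rule length_path_law)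
      moreover have "set v \<subseteq> states p" using set_path_law[OF set_K x0 v[unfolded PP_def]] .
      ultimately show ?thesis using khat by (simp add: is_arg_min_def)
    qed
    then have "0 \<le> excess (ghat (khat v))" unfolding excess by (intro excess_bounds(2) ghat)
    then show "norm (excess (ghat (khat v))) \<le> 1" using le1 by simp
  qed
  \<comment> \<open>The scale on which the deviation bound decays: its exponent is -\<epsilon>/B,
    and integrating this tail gives the oracle inequality.\<close>
  define B where "B = (1 + \<theta>) * (4 * tmix * ?A / (\<theta> * \<gamma>ps * real m))"
  have B: "0 < B" unfolding B_def using theta gp mp t1 A by (intro mult_pos_pos divide_pos_pos) auto
  have expB: "1 / (4 * tmix * (1 + \<theta>)) * (\<theta> * \<gamma>ps * real m * \<epsilon> / ?A) = \<epsilon> / B" for \<epsilon>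
  proof -
    have "1 / (4 * t * s) * (c * e / A) = e / (s * (4 * t * A / c))" for t s c e A :: real
      by (simp add: mult_ac)
    then show ?thesis unfolding B_def .
  qed
  have "1 \<le> exp (ln 2 / tmix)" using t1 by simp
  then have C: "1 \<le> ?C" by linarith
  have "expect PP U \<le> B * ln (exp 1 * ?C)"
  proof (rule expectation_le_of_exponential_tail[OF _ U1 C B])
    show "integrable PP U" unfolding U_def using intZ by simp
    show "pr PP {v. U v > \<epsilon>} \<le> ?C * exp (- (\<epsilon> / B))" if "0 \<le> \<epsilon>" "\<epsilon> \<le> 1" for \<epsilon>
      using tail[OF that] unfolding expB .
  qed
  moreover have "expect PP U =
      expect PP (\<lambda>v. excess (ghat (khat v))) - (1 + \<theta>) * excess (ghat ktilde)"
    unfolding U_def using intZ by simp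
  ultimately have "expect PP (\<lambda>v. excess (ghat (khat v)))
      \<le> (1 + \<theta>) * excess (ghat ktilde) + B * ln (exp 1 * ?C)" by linarith
  also have "\<dots> = (1 + \<theta>) * (excess (ghat ktilde) +
        4 * tmix * ?A / (\<theta> * \<gamma>ps * real m) * ln (exp 1 * (2 * exp (ln 2 / tmix) + real N)))"
    unfolding B_def add.commute[of "2 * exp (ln 2 / tmix)" "real N"] by (simp only: distrib_left mult.assoc)
  finally have "expect PP (\<lambda>v. excess (ghat (khat v)))
      \<le> (1 + \<theta>) * (excess (ghat ktilde) +
        4 * tmix * ?A / (\<theta> * \<gamma>ps * real m) * ln (exp 1 * (2 * exp (ln 2 / tmix) + real N)))" .
  then show ?thesis using tail by (auto simp: U_def)
qed

end
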